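(* For all $i,j\in[4]$ with $i<j$, the subgroups $M_{i,j}$ and $M'_{i,j}$ of $\mathrm{Aut}(\mathcal{O}_4)$ are contained in $\lambda^{-1}(\mathcal{P}_4^2)$ and are isomorphic to $D_8\times\mathbb{Z}_2^{3}$. The kernels of the restrictions of the canonical projection, $\pi:M_{i,j}\to\mathrm{Out}(\mathcal{O}_4)$ and $\pi:M'_{i,j}\to\mathrm{Out}(\mathcal{O}_4)$, are trivial, and the $12$ groups $\pi(M_{i,j})$ and $\pi(M'_{i,j})$, for $i,j\in[4]$, $i<j$, are mutually distinct.
   Context: $[n]=\{1,\dots,n\}$; $S(A)$ is the symmetric group on $A$, $S_n=S([n])$; permutations are in disjoint cycle form, composed right to left. $D_8$ is the dihedral group of order $8$. The Cuntz algebra $\mathcal{O}_n$ ($n\ge2$) is the universal $C^*$-algebra generated by isometries $S_1,\dots,S_n$ with $\sum_iS_iS_i^*=1$. For a unitary $u\in\mathcal{O}_n$, $\lambda_u$ is the unique unital $*$-endomorphism of $\mathcal{O}_n$ with $\lambda_u(S_i)=uS_i$ for all $i$. A permutation $u\in S([n]^t)$ is identified with the unitary $\sum_{\alpha\in[n]^t}S_{u(\alpha)}S_\alpha^*$, where $S_\alpha=S_{\alpha_1}\cdots S_{\alpha_t}$; $\mathcal{P}_n^t$ is the set of these unitaries, and $\lambda_u$ for a permutation $u$ means $\lambda$ of the corresponding unitary. $\lambda^{-1}(\mathcal{P}_n^2):=\{\lambda_u\in\mathrm{Aut}(\mathcal{O}_n): u\in\mathcal{P}_n^2\}$. $\mathrm{Out}(\mathcal{O}_n)$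 is the quotient of $\mathrm{Aut}(\mathcal{O}_n)$ by inner automorphisms and $\pi$ is the canonical projection. For $i<j$ in $[4]$ let $\{h,k\}=[4]\setminus\{i,j\}$ with $h<k$ and define in $S([4]^2)$: $w_0'=((i,h),(j,h))$, $v_0=((j,h),(j,k))$, $x_0=((i,i),(j,i))((i,j),(j,j))$, $y_0=((h,h),(h,k))((k,h),(k,k))$, $u_0'=((h,i),(h,j))$, $v_0'=((k,i),(k,j))$, $w_0=((h,i),(k,i))$, $z_0=((h,j),(k,j))$, and the $4$-cycles $c_0=((i,h),(i,k),(j,h),(j,k))$, $c_0'=((i,h),(j,k),(i,k),(j,h))$. Let $\widetilde M_{i,j}\le S([4]^2)$ be generated by $c_0,w_0',x_0,y_0,u_0'v_0'$ and $\widetilde M'_{i,j}\le S([4]^2)$ be generated by $c_0',v_0,x_0,y_0,w_0z_0$. $M_{i,j}$ (resp. $M'_{i,j}$) is the subgroup of $\mathrm{Aut}(\mathcal{O}_4)$ generated by $\lambda_g$, $g\in\widetilde M_{i,j}$ (resp. $g\in\widetilde M'_{i,j}$). *)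

theory Defs
  imports
    Complex_Main
    "HOL-Combinatorics.Cycles"
    "HOL-Algebra.Bij"
    "HOL-Algebra.Elementary_Groups"
    "HOL-Algebra.Generated_Groups"
    "HOL-Algebra.Module"
    "HOL-Algebra.Subrings"
begin

section \<open>Unital C*-algebras and their automorphism groups\<close>

definition complex_ring :: "complex ring" where
  "complex_ring = \<lparr>carrier = UNIV, monoid.mult = (*), one = 1, ring.zero = 0, ring.add = (+)\<rparr>"

record 'a cstar = "(complex, 'a) module" +
  adj :: "'a \<Rightarrow> 'a"
  cnorm :: "'a \<Rightarrow> real"

text \<open>The zero algebra is not excluded.\<close>

locale cstar_algebra = module complex_ring A + ring A for A :: "'a cstar" (structure) +
  assumes smult_mult_left:
      "\<lbrakk>x \<in> carrier A; y \<in> carrier A\<rbrakk> \<Longrightarrow> (c \<odot> x) \<otimes> y = c \<odot> (x \<otimes> y)"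
    and smult_mult_right:
      "\<lbrakk>x \<in> carrier A; y \<in> carrier A\<rbrakk> \<Longrightarrow> x \<otimes> (c \<odot> y) = c \<odot> (x \<otimes> y)"
    and adj_closed: "x \<in> carrier A \<Longrightarrow> adj A x \<in> carrier A"
    and adj_add:
      "\<lbrakk>x \<in> carrier A; y \<in> carrier A\<rbrakk> \<Longrightarrow> adj A (x \<oplus> y) = adj A x \<oplus> adj A y"
    and adj_smult: "x \<in> carrier A \<Longrightarrow> adj A (c \<odot> x) = cnj c \<odot> adj A x"
    and adj_mult:
      "\<lbrakk>x \<in> carrier A; y \<in> carrier A\<rbrakk> \<Longrightarrow> adj A (x \<otimes> y) = adj A y \<otimes> adj A x"
    and adj_adj: "x \<in> carrier A \<Longrightarrow> adj A (adj A x) = x"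
    and cnorm_eq_zero: "x \<in> carrier A \<Longrightarrow> cnorm A x = 0 \<longleftrightarrow> x = \<zero>"
    and cnorm_triangle:
      "\<lbrakk>x \<in> carrier A; y \<in> carrier A\<rbrakk> \<Longrightarrow> cnorm A (x \<oplus> y) \<le> cnorm A x + cnorm A y"
    and cnorm_smult: "x \<in> carrier A \<Longrightarrow> cnorm A (c \<odot> x) = cmod c * cnorm A x"
    and cnorm_mult:
      "\<lbrakk>x \<in> carrier A; y \<in> carrier A\<rbrakk> \<Longrightarrow> cnorm A (x \<otimes> y) \<le> cnorm A x * cnorm A y"
    and cstar_identity: "x \<in> carrier A \<Longrightarrow> cnorm A (adj A x \<otimes> x) = (cnorm A x)\<^sup>2"
    and complete:
      "\<lbrakk>\<And>k::nat. z k \<in> carrier A;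
        \<forall>e>0. \<exists>N. \<forall>k\<ge>N. \<forall>m\<ge>N. cnorm A (z k \<ominus> z m) < e\<rbrakk>
       \<Longrightarrow> \<exists>x\<in>carrier A. (\<lambda>k. cnorm A (z k \<ominus> x)) \<longlonglongrightarrow> 0"

definition cstar_subalgebra :: "'a set \<Rightarrow> 'a cstar \<Rightarrow> bool" where
  "cstar_subalgebra B A \<longleftrightarrow>
     subring B A \<and>
     (\<forall>c. \<forall>x\<in>B. c \<odot>\<^bsub>A\<^esub> x \<in> B) \<and>
     (\<forall>x\<in>B. adj A x \<in> B) \<and>
     (\<forall>z x. (\<forall>k::nat. z k \<in> B) \<and> x \<in> carrier A \<and>
        (\<lambda>k. cnorm A (z k \<ominus>\<^bsub>A\<^esub> x)) \<longlonglongrightarrow> 0 \<longrightarrow> x \<in> B)"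

text \<open>The homomorphisms in \<open>ring_hom\<close> are unital.\<close>

definition star_hom :: "'a cstar \<Rightarrow> 'b cstar \<Rightarrow> ('a \<Rightarrow> 'b) set" where
  "star_hom A B =
     {f \<in> ring_hom A B. \<forall>x\<in>carrier A.
        f (adj A x) = adj B (f x) \<and> (\<forall>c. f (c \<odot>\<^bsub>A\<^esub> x) = c \<odot>\<^bsub>B\<^esub> f x)}"

definition Aut :: "'a cstar \<Rightarrow> ('a \<Rightarrow> 'a) monoid" where
  "Aut A = BijGroup (carrier A) \<lparr>carrier := star_hom A A \<inter> Bij (carrier A)\<rparr>"

definition unitaries :: "'a cstar \<Rightarrow> 'a set" where
  "unitaries A = {w \<in> carrier A. adj A w \<otimes>\<^bsub>A\<^esub> w = \<one>\<^bsub>A\<^esub> \<and> w \<otimes>\<^bsub>A\<^esub> adj A w = \<one>\<^bsub>A\<^esub>}"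

definition Inn :: "'a cstar \<Rightarrow> ('a \<Rightarrow> 'a) set" where
  "Inn A = (\<lambda>w. \<lambda>x\<in>carrier A. w \<otimes>\<^bsub>A\<^esub> x \<otimes>\<^bsub>A\<^esub> adj A w) ` unitaries A"

definition Out :: "'a cstar \<Rightarrow> ('a \<Rightarrow> 'a) set monoid" where
  "Out A = Aut A Mod Inn A"

definition out_proj :: "'a cstar \<Rightarrow> ('a \<Rightarrow> 'a) \<Rightarrow> ('a \<Rightarrow> 'a) set" where
  "out_proj A f = Inn A #>\<^bsub>Aut A\<^esub> f"

section \<open>Cuntz algebras\<close>

definition cuntz_family :: "nat \<Rightarrow> 'a cstar \<Rightarrow> (nat \<Rightarrow> 'a) \<Rightarrow> bool" where
  "cuntz_family n A S \<longleftrightarrow>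
     (\<forall>i\<in>{1..n}. S i \<in> carrier A \<and> adj A (S i) \<otimes>\<^bsub>A\<^esub> S i = \<one>\<^bsub>A\<^esub>) \<and>
     (\<Oplus>\<^bsub>A\<^esub>i\<in>{1..n}. S i \<otimes>\<^bsub>A\<^esub> adj A (S i)) = \<one>\<^bsub>A\<^esub>"

definition universal_cuntz_family ::
    "'b itself \<Rightarrow> nat \<Rightarrow> 'a cstar \<Rightarrow> (nat \<Rightarrow> 'a) \<Rightarrow> bool" where
  "universal_cuntz_family _ n A S \<longleftrightarrow>
     (\<forall>(B :: 'b cstar) T. cstar_algebra B \<and> cuntz_family n B T \<longrightarrow>
        (\<exists>!f. f \<in> star_hom A B \<inter> extensional (carrier A) \<and> (\<forall>i\<in>{1..n}. f (S i) = T i)))"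

text \<open>
  \<open>cuntz_algebra n A S\<close> says that \<open>A\<close> is the Cuntz algebra \<open>O\<^sub>n\<close> with canonical generators
  \<open>S 1, \<dots>, S n\<close>. The universal property ranges over all C*-algebras, which HOL cannot quantify
  over in one formula. It is enough to consider targets generated by a Cuntz family; these are
  separable, hence isomorphic to an algebra of bounded operators on \<open>l\<^sup>2(\<nat>)\<close>, that is, to one whose
  carrier consists of maps \<open>(\<nat> \<Rightarrow> \<complex>) \<Rightarrow> (\<nat> \<Rightarrow> \<complex>)\<close>. Thus the last clause is already the full
  universal property, and the one before it, for targets of the type of \<open>A\<close> (such as \<open>A\<close> itself),
  follows from it.
\<close>

definition cuntz_algebra :: "nat \<Rightarrow> 'a cstar \<Rightarrow> (nat \<Rightarrow> 'a) \<Rightarrow> bool" where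
  "cuntz_algebra n A S \<longleftrightarrow>
     2 \<le> n \<and> cstar_algebra A \<and> cuntz_family n A S \<and>
     (\<forall>B. cstar_subalgebra B A \<and> S ` {1..n} \<subseteq> B \<longrightarrow> B = carrier A) \<and>
     universal_cuntz_family TYPE('a) n A S \<and>
     universal_cuntz_family TYPE((nat \<Rightarrow> complex) \<Rightarrow> nat \<Rightarrow> complex) n A S"

definition cuntz_endo :: "nat \<Rightarrow> 'a cstar \<Rightarrow> (nat \<Rightarrow> 'a) \<Rightarrow> 'a \<Rightarrow> 'a \<Rightarrow> 'a" where
  "cuntz_endo n A S u =
     (THE f. f \<in> star_hom A A \<inter> extensional (carrier A) \<and>
        (\<forall>i\<in>{1..n}. f (S i) = u \<otimes>\<^bsub>A\<^esub> S i))"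

definition words :: "nat \<Rightarrow> nat \<Rightarrow> nat list set" where
  "words n t = {\<alpha>. set \<alpha> \<subseteq> {1..n} \<and> length \<alpha> = t}"

definition word_isometry :: "'a cstar \<Rightarrow> (nat \<Rightarrow> 'a) \<Rightarrow> nat list \<Rightarrow> 'a" where
  "word_isometry A S \<alpha> = foldr (\<lambda>i x. S i \<otimes>\<^bsub>A\<^esub> x) \<alpha> \<one>\<^bsub>A\<^esub>"

definition perm_unitary ::
    "nat \<Rightarrow> nat \<Rightarrow> 'a cstar \<Rightarrow> (nat \<Rightarrow> 'a) \<Rightarrow> (nat list \<Rightarrow> nat list) \<Rightarrow> 'a" where
  "perm_unitary n t A S u =
     (\<Oplus>\<^bsub>A\<^esub>\<alpha>\<in>words n t. word_isometry A S (u \<alpha>) \<otimes>\<^bsub>A\<^esub> adj A (word_isometry A S \<alpha>))"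

definition perm_unitaries :: "nat \<Rightarrow> nat \<Rightarrow> 'a cstar \<Rightarrow> (nat \<Rightarrow> 'a) \<Rightarrow> 'a set" where
  "perm_unitaries n t A S = perm_unitary n t A S ` {u. u permutes words n t}"

definition perm_endo ::
    "nat \<Rightarrow> nat \<Rightarrow> 'a cstar \<Rightarrow> (nat \<Rightarrow> 'a) \<Rightarrow> (nat list \<Rightarrow> nat list) \<Rightarrow> 'a \<Rightarrow> 'a" where
  "perm_endo n t A S u = cuntz_endo n A S (perm_unitary n t A S u)"

text \<open>The set written \<open>\<lambda>\<^sup>-\<^sup>1(P\<^sub>n\<^sup>t)\<close>; despite the notation, its elements are automorphisms.\<close>

definition lambda_inv :: "nat \<Rightarrow> nat \<Rightarrow> 'a cstar \<Rightarrow> (nat \<Rightarrow> 'a) \<Rightarrow> ('a \<Rightarrow> 'a) set" where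
  "lambda_inv n t A S = cuntz_endo n A S ` perm_unitaries n t A S \<inter> carrier (Aut A)"

section \<open>The groups in question\<close>

definition Sym :: "'a set \<Rightarrow> ('a \<Rightarrow> 'a) monoid" where
  "Sym Y = \<lparr>carrier = {p. p permutes Y}, monoid.mult = (\<circ>), one = id\<rparr>"

text \<open>
  The pair \<open>(a, b)\<close> is the word \<open>[a, b]\<close>, and \<open>cycle_of_list [x, y, \<dots>, z]\<close> is the cycle
  \<open>x \<mapsto> y \<mapsto> \<dots> \<mapsto> z \<mapsto> x\<close>. Below, \<open>h\<close> and \<open>k\<close> are the smaller and the larger
  element of \<open>[4] - {i, j}\<close>.
\<close>

definition M_perm :: "nat \<Rightarrow> nat \<Rightarrow> (nat list \<Rightarrow> nat list) set" where
  "M_perm i j =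
    (let h = Min ({1..4} - {i, j}); k = Max ({1..4} - {i, j});
         w0' = cycle_of_list [[i,h], [j,h]];
         x0 = cycle_of_list [[i,i], [j,i]] \<circ> cycle_of_list [[i,j], [j,j]];
         y0 = cycle_of_list [[h,h], [h,k]] \<circ> cycle_of_list [[k,h], [k,k]];
         u0' = cycle_of_list [[h,i], [h,j]];
         v0' = cycle_of_list [[k,i], [k,j]];
         c0 = cycle_of_list [[i,h], [i,k], [j,h], [j,k]]
     in generate (Sym (words 4 2)) {c0, w0', x0, y0, u0' \<circ> v0'})"

definition M'_perm :: "nat \<Rightarrow> nat \<Rightarrow> (nat list \<Rightarrow> nat list) set" where
  "M'_perm i j =
    (let h = Min ({1..4} - {i, j}); k = Max ({1..4} - {i, j});
         v0 = cycle_of_list [[j,h], [j,k]];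
         x0 = cycle_of_list [[i,i], [j,i]] \<circ> cycle_of_list [[i,j], [j,j]];
         y0 = cycle_of_list [[h,h], [h,k]] \<circ> cycle_of_list [[k,h], [k,k]];
         w0 = cycle_of_list [[h,i], [k,i]];
         z0 = cycle_of_list [[h,j], [k,j]];
         c0' = cycle_of_list [[i,h], [j,k], [i,k], [j,h]]
     in generate (Sym (words 4 2)) {c0', v0, x0, y0, w0 \<circ> z0})"

definition M_grp :: "'a cstar \<Rightarrow> (nat \<Rightarrow> 'a) \<Rightarrow> nat \<Rightarrow> nat \<Rightarrow> ('a \<Rightarrow> 'a) set" where
  "M_grp A S i j = generate (Aut A) (perm_endo 4 2 A S ` M_perm i j)"

definition M'_grp :: "'a cstar \<Rightarrow> (nat \<Rightarrow> 'a) \<Rightarrow> nat \<Rightarrow> nat \<Rightarrow> ('a \<Rightarrow> 'a) set" where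
  "M'_grp A S i j = generate (Aut A) (perm_endo 4 2 A S ` M'_perm i j)"

text \<open>
  The dihedral group of order \<open>2 * n\<close>; the pair \<open>(a, s)\<close> is the rotation \<open>r\<^sup>a\<close>, followed on the
  right by the reflection \<open>f\<close> if \<open>s\<close> holds, and \<open>f r\<^sup>b = r\<^sup>-\<^sup>b f\<close>.
\<close>

definition dihedral_group :: "nat \<Rightarrow> (int \<times> bool) monoid" where
  "dihedral_group n =
     \<lparr>carrier = {0..<int n} \<times> UNIV,
      monoid.mult = (\<lambda>(a, s) (b, t). ((a + (if s then - b else b)) mod int n, s \<noteq> t)),
      one = (0, False)\<rparr>"

lemma group_dihedral_group: "n > 0 \<Longrightarrow> group (dihedral_group n)"
proof (rule groupI)
  fix x assume "n > 0" "x \<in> carrier (dihedral_group n)"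
  then obtain a s where x: "x = (a, s)" "0 \<le> a" "a < int n"
    by (auto simp: dihedral_group_def)
  have "(if s then a else (- a) mod int n, s) \<otimes>\<^bsub>dihedral_group n\<^esub> x = \<one>\<^bsub>dihedral_group n\<^esub>"
    using x by (auto simp: dihedral_group_def mod_simps)
  moreover have "(if s then a else (- a) mod int n, s) \<in> carrier (dihedral_group n)"
    using x \<open>n > 0\<close> by (auto simp: dihedral_group_def)
  ultimately show "\<exists>y\<in>carrier (dihedral_group n). y \<otimes>\<^bsub>dihedral_group n\<^esub> x = \<one>\<^bsub>dihedral_group n\<^esub>"
    by blast
qed (auto simp: dihedral_group_def mod_simps algebra_simps)

lemma order_dihedral_group: "order (dihedral_group n) = 2 * n"
  by (simp add: order_def dihedral_group_def card_cartesian_product)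

end

theory Submission
  imports Defs "HOL-Analysis.Infinite_Sum" "HOL-Analysis.Bounded_Linear_Function"
begin

text \<open>
  If \<open>1 \<otimes> u\<close> and \<open>v \<otimes> 1\<close> commute on words of length three, then \<open>\<lambda>\<^sub>u \<lambda>\<^sub>v = \<lambda>\<^bsub>uv\<^esub>\<close>. This holds for any two
  elements of one of the twelve permutation groups, so that \<open>\<lambda>\<close> is a homomorphism on each of them.

  To separate outer classes, represent the Cuntz algebra on \<open>l\<^sup>2(\<nat>)\<close> by a branching system, that is, by
  isometries mapping basis vectors to basis vectors. Composing with \<open>\<lambda>\<^sub>u\<close> gives the representation of another branching
  system, the twist by \<open>u\<close>. If \<open>\<lambda>\<^sub>u\<close> and \<open>\<lambda>\<^sub>v\<close> differ by an inner automorphism, the two twisted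
  representations are intertwined by a unitary, so a word \<open>\<alpha>\<close> that fixes a basis vector under the twist
  by \<open>v\<close> has a fixed vector, hence a periodic point, under the twist by \<open>u\<close>. For the branching system
  with a single cycle, labelled by a word \<open>\<beta>\<close>, both conditions can be read off from the action of \<open>u\<close>
  and \<open>v\<close> on words of length two. Words \<open>\<alpha>\<close> and \<open>\<beta>\<close> of length one and three suffice to tell
  the non-trivial elements of each group from the identity and the twelve groups from each other.
\<close>

section \<open>The Hilbert space of square-summable sequences\<close>

text \<open>The Cuntz relations only say that the range projections sum to 1. That the ranges are
  orthogonal, on which every computation with words rests, is a consequence of positivity:
  conjugating the sum by a generator leaves positive terms with sum 0.

  The twelve groups are isomorphic, so no invariant of the abstract group tells their images apart.
  What does is the set of words with a fixed vector: a unitary of the algebra becomes an invertible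
  operator in any representation, so this set depends only on the outer class. With a branching
  system all of whose shift orbits end in one finite cycle, the test becomes finite, as only the
  letters met on the cycle matter.

  All the permutations keep each letter of a word in its block {i, j} or {h, k}. Hence words of one
  letter already separate groups that belong to different partitions of [4] into blocks; words of
  length three settle the pairs of groups with a common partition. Since no element other than the
  identity becomes inner, injectivity of \<lambda> on each group comes for free.\<close>

typedef ell2 = "{f :: nat \<Rightarrow> complex. (\<lambda>n. (norm (f n))\<^sup>2) summable_on UNIV}"
  morphisms coord of_coord
  by (rule exI[of _ "\<lambda>_. 0"]) simp

lemma coord_square_summable: "(\<lambda>n. (norm (coord x n))\<^sup>2) summable_on UNIV"
  using coord[of x] by simp

lemma coord_of_coord:
  "(\<lambda>n. (norm (f n))\<^sup>2) summable_on UNIV \<Longrightarrow> coord (of_coord f) = f"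
  by (simp add: of_coord_inverse)

lemma ell2_eqI: "(\<And>n. coord x n = coord y n) \<Longrightarrow> x = y"
  by (metis coord_inject ext)

lemma square_norm_add_le: "(norm (a + b))\<^sup>2 \<le> 2 * (norm a)\<^sup>2 + 2 * (norm b)\<^sup>2"
  for a b :: "'a::real_normed_vector"
proof -
  have "(norm (a + b))\<^sup>2 \<le> (norm a + norm b)\<^sup>2"
    by (simp add: norm_triangle_ineq power_mono)
  also have "\<dots> \<le> 2 * (norm a)\<^sup>2 + 2 * (norm b)\<^sup>2"
    using sum_squares_bound[of "norm a" "norm b"] by (simp add: power2_sum)
  finally show ?thesis .
qed

lemma square_summable_add:
  fixes f g :: "nat \<Rightarrow> complex"
  assumes "(\<lambda>n. (norm (f n))\<^sup>2) summable_on UNIV" "(\<lambda>n. (norm (g n))\<^sup>2) summable_on UNIV"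
  shows "(\<lambda>n. (norm (f n + g n))\<^sup>2) summable_on UNIV"
proof (rule summable_on_comparison_test)
  show "(\<lambda>n. 2 * (norm (f n))\<^sup>2 + 2 * (norm (g n))\<^sup>2) summable_on UNIV"
    using assms by (intro summable_on_add summable_on_cmult_right)
qed (use square_norm_add_le in auto)

lemma square_summable_scale:
  fixes f :: "nat \<Rightarrow> complex"
  assumes "(\<lambda>n. (norm (f n))\<^sup>2) summable_on UNIV"
  shows "(\<lambda>n. (norm (c * f n))\<^sup>2) summable_on UNIV"
  using summable_on_cmult_right[OF assms, of "(norm c)\<^sup>2"]
  by (simp add: norm_mult power_mult_distrib)

definition cscale :: "complex \<Rightarrow> ell2 \<Rightarrow> ell2" where
  "cscale c x = of_coord (\<lambda>n. c * coord x n)"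

lemma coord_cscale [simp]: "coord (cscale c x) n = c * coord x n"
  using coord_of_coord[OF square_summable_scale[OF coord_square_summable, of c x]]
  by (simp add: cscale_def)

instantiation ell2 :: real_vector
begin

definition "zero_ell2 = of_coord (\<lambda>_. 0)"
definition "plus_ell2 x y = of_coord (\<lambda>n. coord x n + coord y n)"
definition "uminus_ell2 x = cscale (-1) x"
definition "minus_ell2 (x::ell2) y = x + cscale (-1) y"
definition "scaleR_ell2 r x = cscale (of_real r) x"

lemma coord_zero [simp]: "coord 0 n = 0"
  by (simp add: zero_ell2_def coord_of_coord)

lemma coord_add [simp]: "coord (x + y) n = coord x n + coord y n"
  using coord_of_coord[OF square_summable_add[OF coord_square_summable coord_square_summable, of x y]]
  by (simp add: plus_ell2_def)

lemma coord_uminus [simp]: "coord (- x) n = - coord x n"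
  by (simp add: uminus_ell2_def)

lemma coord_minus [simp]: "coord (x - y) n = coord x n - coord y n"
  by (simp add: minus_ell2_def)

lemma coord_scaleR [simp]: "coord (r *\<^sub>R x) n = r *\<^sub>R coord x n"
  by (simp add: scaleR_ell2_def scaleR_conv_of_real)

instance
  by standard (rule ell2_eqI, simp add: algebra_simps scaleR_add_right scaleR_add_left)+

end

lemma inner_summable:
  "(\<lambda>n. inner (coord x n) (coord y n)) summable_on UNIV"
proof (rule abs_summable_summable, rule abs_summable_on_comparison_test)
  show "(\<lambda>n. (norm (coord x n))\<^sup>2 + (norm (coord y n))\<^sup>2) abs_summable_on UNIV"
    using summable_on_add[OF coord_square_summable coord_square_summable, of x y] by simp
  fix n
  have "norm (inner (coord x n) (coord y n)) \<le> norm (coord x n) * norm (coord y n)"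
    using Cauchy_Schwarz_ineq2 by simp
  also have "\<dots> \<le> (norm (coord x n))\<^sup>2 + (norm (coord y n))\<^sup>2"
    using sum_squares_bound[of "norm (coord x n)" "norm (coord y n)"]
      mult_nonneg_nonneg[OF norm_ge_zero[of "coord x n"] norm_ge_zero[of "coord y n"]] by linarith
  finally show "norm (inner (coord x n) (coord y n)) \<le> norm ((norm (coord x n))\<^sup>2 + (norm (coord y n))\<^sup>2)"
    by simp
qed

text \<open>For complex numbers the real \<open>inner x y\<close> is Re (cnj x * y), so this is the
  real part of the usual inner product. It induces the same norm, and complex scalars enter only
  through \<open>cscale\<close>.\<close>

instantiation ell2 :: real_inner
begin

definition "inner_ell2 x y = (\<Sum>\<^sub>\<infinity>n. inner (coord x n) (coord y n))"
definition "norm_ell2 (x::ell2) = sqrt (inner x x)"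
definition "sgn_ell2 (x::ell2) = x /\<^sub>R norm x"
definition "dist_ell2 (x::ell2) y = norm (x - y)"
definition
  "(uniformity :: (ell2 \<times> ell2) filter) = (INF e\<in>{0<..}. principal {(x, y). dist x y < e})"
definition
  "open (U :: ell2 set) \<longleftrightarrow> (\<forall>x\<in>U. eventually (\<lambda>(x', y). x' = x \<longrightarrow> y \<in> U) uniformity)"

instance
proof
  fix x y z :: ell2 and r :: real
  show "inner x y = inner y x"
    by (simp add: inner_ell2_def inner_commute)
  show "inner (x + y) z = inner x z + inner y z"
    by (simp add: inner_ell2_def inner_add_left infsum_add inner_summable)
  show "inner (r *\<^sub>R x) y = r * inner x y"
    by (simp add: inner_ell2_def infsum_cmult_right' del: inner_complex_def)
  show "0 \<le> inner x x"
    by (simp add: inner_ell2_def infsum_nonneg)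
  show "inner x x = 0 \<longleftrightarrow> x = 0"
  proof
    assume "inner x x = 0"
    then have "coord x n = 0" for n
      using nonneg_infsum_le_0D[OF _ inner_summable[of x x], of n] by (simp add: inner_ell2_def)
    then show "x = 0"
      by (intro ell2_eqI) simp
  qed (simp add: inner_ell2_def)
qed (simp_all add: norm_ell2_def sgn_ell2_def dist_ell2_def uniformity_ell2_def open_ell2_def)

end

lemma norm_ell2_square: "(norm x)\<^sup>2 = (\<Sum>\<^sub>\<infinity>n. (norm (coord x n))\<^sup>2)" for x :: ell2
  by (simp add: power2_norm_eq_inner inner_ell2_def)

lemma sum_coord_le: "finite F \<Longrightarrow> (\<Sum>n\<in>F. (norm (coord x n))\<^sup>2) \<le> (norm x)\<^sup>2"
  unfolding norm_ell2_square by (rule finite_sum_le_infsum[OF coord_square_summable]) auto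

lemma norm_coord_le: "norm (coord x n) \<le> norm x"
  using sum_coord_le[of "{n}" x] by (simp add: power2_le_iff_abs_le)

text \<open>Limits and operators below arise as raw sequences whose finite partial sums are bounded;
  such a bound gives membership in the space and a norm estimate at once.\<close>

lemma square_summable_bounded:
  assumes "\<And>F. finite F \<Longrightarrow> (\<Sum>n\<in>F. (norm (f n))\<^sup>2) \<le> e\<^sup>2" "0 \<le> e"
  shows "(\<lambda>n. (norm (f n))\<^sup>2) summable_on UNIV" "norm (of_coord f) \<le> e"
proof -
  show s: "(\<lambda>n. (norm (f n))\<^sup>2) summable_on UNIV"
    by (rule nonneg_bdd_above_summable_on) (use assms in \<open>auto intro!: bdd_aboveI[of _ "e\<^sup>2"]\<close>)
  have "(norm (of_coord f))\<^sup>2 \<le> e\<^sup>2"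
    unfolding norm_ell2_square coord_of_coord[OF s]
    by (rule infsum_le_finite_sums[OF s]) (use assms in auto)
  then show "norm (of_coord f) \<le> e"
    using assms(2) by (rule power2_le_imp_le)
qed

instance ell2 :: banach
proof
  fix X :: "nat \<Rightarrow> ell2"
  assume X: "Cauchy X"
  have "Cauchy (\<lambda>k. coord (X k) n)" for n
  proof (rule metric_CauchyI)
    fix e :: real
    assume "0 < e"
    then obtain M where "\<forall>m\<ge>M. \<forall>k\<ge>M. dist (X m) (X k) < e"
      using metric_CauchyD[OF X] by blast
    moreover have "dist (coord (X m) n) (coord (X k) n) \<le> dist (X m) (X k)" for m k
      using norm_coord_le[of "X m - X k" n] by (simp add: dist_norm)
    ultimately show "\<exists>M. \<forall>m\<ge>M. \<forall>k\<ge>M. dist (coord (X m) n) (coord (X k) n) < e"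
      by (meson le_less_trans)
  qed
  then have "convergent (\<lambda>k. coord (X k) n)" for n
    by (rule Cauchy_convergent)
  then have "(\<lambda>k. coord (X k) n) \<longlonglongrightarrow> lim (\<lambda>k. coord (X k) n)" for n
    by (simp add: convergent_LIMSEQ_iff)
  then obtain g where g: "\<And>n. (\<lambda>k. coord (X k) n) \<longlonglongrightarrow> g n"
    by (rule that)
  \<comment> \<open>Summability is part of the claim, since \<open>g\<close> is only a
    coordinatewise limit and not yet known to be square-summable.\<close>
  have close: "\<exists>M. \<forall>k\<ge>M. (\<lambda>n. (norm (g n - coord (X k) n))\<^sup>2) summable_on UNIV \<and>
      norm (of_coord (\<lambda>n. g n - coord (X k) n)) \<le> e" if "0 < e" for e
  proof -
    obtain M where M: "\<forall>m\<ge>M. \<forall>k\<ge>M. dist (X m) (X k) < e"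
      using metric_CauchyD[OF X \<open>0 < e\<close>] by blast
    \<comment> \<open>Only finite \<open>F\<close>, so that the limit in \<open>m\<close> passes
      through the sum.\<close>
    have le: "(\<Sum>n\<in>F. (norm (g n - coord (X k) n))\<^sup>2) \<le> e\<^sup>2" if "M \<le> k" "finite F" for k F
    proof (rule tendsto_upperbound)
      show "(\<lambda>m. \<Sum>n\<in>F. (norm (coord (X m) n - coord (X k) n))\<^sup>2)
          \<longlonglongrightarrow> (\<Sum>n\<in>F. (norm (g n - coord (X k) n))\<^sup>2)"
        by (intro tendsto_intros g)
      have "(\<Sum>n\<in>F. (norm (coord (X m) n - coord (X k) n))\<^sup>2) \<le> e\<^sup>2" if "M \<le> m" for m
      proof -
        have "(\<Sum>n\<in>F. (norm (coord (X m) n - coord (X k) n))\<^sup>2) \<le> (norm (X m - X k))\<^sup>2"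
          using sum_coord_le[OF \<open>finite F\<close>, of "X m - X k"] by simp
        also have "\<dots> \<le> e\<^sup>2"
          using M \<open>M \<le> k\<close> \<open>M \<le> m\<close> by (intro power_mono) (auto simp: dist_norm less_imp_le)
        finally show ?thesis .
      qed
      then show "\<forall>\<^sub>F m in sequentially. (\<Sum>n\<in>F. (norm (coord (X m) n - coord (X k) n))\<^sup>2) \<le> e\<^sup>2"
        using eventually_sequentially by blast
    qed simp
    show ?thesis
    proof (intro exI[of _ M] allI impI)
      fix k assume "M \<le> k"
      from square_summable_bounded[OF le[OF this] less_imp_le[OF \<open>0 < e\<close>]]
      show "(\<lambda>n. (norm (g n - coord (X k) n))\<^sup>2) summable_on UNIV \<and>
          norm (of_coord (\<lambda>n. g n - coord (X k) n)) \<le> e"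
        by blast
    qed
  qed
  obtain k where "(\<lambda>n. (norm (g n - coord (X k) n))\<^sup>2) summable_on UNIV"
    using close[of 1] by auto
  from square_summable_add[OF this coord_square_summable[of "X k"]]
  have sg: "(\<lambda>n. (norm (g n))\<^sup>2) summable_on UNIV"
    by simp
  have "X \<longlonglongrightarrow> of_coord g"
  proof (rule metric_LIMSEQ_I)
    fix e :: real
    assume "0 < e"
    then obtain M where M: "\<forall>k\<ge>M. (\<lambda>n. (norm (g n - coord (X k) n))\<^sup>2) summable_on UNIV \<and>
      norm (of_coord (\<lambda>n. g n - coord (X k) n)) \<le> e / 2"
      using close[of "e / 2"] by auto
    have "dist (X k) (of_coord g) < e" if "M \<le> k" for k
    proof -
      have "of_coord (\<lambda>n. g n - coord (X k) n) = of_coord g - X k"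
        using M that by (intro ell2_eqI) (simp add: coord_of_coord sg)
      then have "dist (X k) (of_coord g) \<le> e / 2"
        using M[rule_format, OF that] by (simp add: dist_norm norm_minus_commute)
      then show ?thesis
        using \<open>0 < e\<close> by simp
    qed
    then show "\<exists>M. \<forall>k\<ge>M. dist (X k) (of_coord g) < e"
      by blast
  qed
  then show "convergent X"
    by (rule convergentI)
qed

lemma cscale_add: "cscale c (x + y) = cscale c x + cscale c y"
  by (rule ell2_eqI) (simp add: algebra_simps)

lemma cscale_scaleR: "cscale c (r *\<^sub>R x) = r *\<^sub>R cscale c x"
  by (rule ell2_eqI) (simp add: algebra_simps)

lemma norm_cscale: "norm (cscale c x) = cmod c * norm x"
proof -
  have "(norm (cscale c x))\<^sup>2 = (cmod c * norm x)\<^sup>2"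
    by (simp add: norm_ell2_square power_mult_distrib norm_mult infsum_cmult_right')
  then show ?thesis
    by (simp add: power2_eq_iff_nonneg)
qed

lemma inner_cscale: "inner (cscale c x) y = inner x (cscale (cnj c) y)"
  by (simp add: inner_ell2_def inner_complex_def algebra_simps)

definition cscaleL :: "complex \<Rightarrow> ell2 \<Rightarrow>\<^sub>L ell2" where
  "cscaleL c = Blinfun (cscale c)"

lemma cscaleL_apply [simp]: "cscaleL c x = cscale c x"
  unfolding cscaleL_def
  by (subst bounded_linear_Blinfun_apply)
     (auto intro!: bounded_linear_intro[of _ "cmod c"] simp: cscale_add cscale_scaleR norm_cscale mult.commute)

section \<open>The C*-algebra of operators on the Hilbert space\<close>

definition is_adjoint :: "(ell2 \<Rightarrow>\<^sub>L ell2) \<Rightarrow> (ell2 \<Rightarrow>\<^sub>L ell2) \<Rightarrow> bool" where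
  "is_adjoint T U \<longleftrightarrow> (\<forall>x y. inner (T x) y = inner x (U y))"

definition adjoint_op :: "(ell2 \<Rightarrow>\<^sub>L ell2) \<Rightarrow> ell2 \<Rightarrow>\<^sub>L ell2" where
  "adjoint_op T = (THE U. is_adjoint T U)"

text \<open>The inner product is the real one; for complex linear operators, real and complex adjoints
  agree. Existence of adjoints is part of the definition, which spares the Riesz theorem.\<close>

definition ell2_ops :: "(ell2 \<Rightarrow>\<^sub>L ell2) set" where
  "ell2_ops = {T. (\<forall>c x. blinfun_apply T (cscale c x) = cscale c (T x)) \<and> (\<exists>U. is_adjoint T U)}"

lemma is_adjoint_unique: "is_adjoint T U \<Longrightarrow> is_adjoint T V \<Longrightarrow> U = V"
  unfolding is_adjoint_def by (metis blinfun_eqI vector_eq_ldot)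

lemma adjoint_op_eq: "is_adjoint T U \<Longrightarrow> adjoint_op T = U"
  unfolding adjoint_op_def by (blast intro: the_equality is_adjoint_unique)

lemma is_adjoint_sym: "is_adjoint T U \<Longrightarrow> is_adjoint U T"
  by (metis is_adjoint_def inner_commute)

lemma is_adjoint_adjoint_op: "T \<in> ell2_ops \<Longrightarrow> is_adjoint T (adjoint_op T)"
  unfolding ell2_ops_def using adjoint_op_eq by auto

lemma ell2_ops_cscale: "T \<in> ell2_ops \<Longrightarrow> T (cscale c x) = cscale c (T x)"
  by (simp add: ell2_ops_def)

lemma ell2_opsI:
  fixes T :: "ell2 \<Rightarrow>\<^sub>L ell2"
  shows "\<lbrakk>\<And>c x. T (cscale c x) = cscale c (T x); is_adjoint T U\<rbrakk> \<Longrightarrow> T \<in> ell2_ops"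
  by (auto simp: ell2_ops_def)

lemma is_adjoint_compose:
  "is_adjoint T T' \<Longrightarrow> is_adjoint U U' \<Longrightarrow> is_adjoint (T o\<^sub>L U) (U' o\<^sub>L T')"
  by (simp add: is_adjoint_def)

lemma is_adjoint_add:
  "is_adjoint T T' \<Longrightarrow> is_adjoint U U' \<Longrightarrow> is_adjoint (T + U) (T' + U')"
  by (simp add: is_adjoint_def blinfun.add_left inner_add_left inner_add_right)

lemma is_adjoint_cscaleL: "is_adjoint (cscaleL c) (cscaleL (cnj c))"
  by (simp add: is_adjoint_def inner_cscale)

lemma is_adjoint_id: "is_adjoint id_blinfun id_blinfun"
  by (simp add: is_adjoint_def)

lemma is_adjoint_zero: "is_adjoint 0 0"
  by (simp add: is_adjoint_def)

lemma cscale_zero [simp]: "cscale c 0 = 0"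
  by (rule ell2_eqI) simp

lemma cscale_cscale: "cscale c (cscale d x) = cscale d (cscale c x)"
  by (rule ell2_eqI) simp

lemma ell2_ops_closed:
  "id_blinfun \<in> ell2_ops" "0 \<in> ell2_ops" "cscaleL c \<in> ell2_ops"
  "T \<in> ell2_ops \<Longrightarrow> U \<in> ell2_ops \<Longrightarrow> T o\<^sub>L U \<in> ell2_ops"
  "T \<in> ell2_ops \<Longrightarrow> U \<in> ell2_ops \<Longrightarrow> T + U \<in> ell2_ops"
proof -
  show "id_blinfun \<in> ell2_ops"
    by (rule ell2_opsI[OF _ is_adjoint_id]) simp
  show "0 \<in> ell2_ops"
    by (rule ell2_opsI[OF _ is_adjoint_zero]) simp
  show "cscaleL c \<in> ell2_ops"
    by (rule ell2_opsI[OF _ is_adjoint_cscaleL]) (simp add: cscale_cscale)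
  assume T: "T \<in> ell2_ops" and U: "U \<in> ell2_ops"
  show "T o\<^sub>L U \<in> ell2_ops"
    by (rule ell2_opsI[OF _ is_adjoint_compose[OF is_adjoint_adjoint_op[OF T] is_adjoint_adjoint_op[OF U]]])
       (simp add: ell2_ops_cscale T U)
  show "T + U \<in> ell2_ops"
    by (rule ell2_opsI[OF _ is_adjoint_add[OF is_adjoint_adjoint_op[OF T] is_adjoint_adjoint_op[OF U]]])
       (simp add: ell2_ops_cscale T U blinfun.add_left cscale_add)
qed

lemma adjoint_op_closed:
  assumes T: "T \<in> ell2_ops"
  shows "adjoint_op T \<in> ell2_ops"
proof (rule ell2_opsI)
  show "is_adjoint (adjoint_op T) T"
    by (rule is_adjoint_sym[OF is_adjoint_adjoint_op[OF T]])
  fix c x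
  have "inner y (adjoint_op T (cscale c x)) = inner y (cscale c (adjoint_op T x))" for y
    using is_adjoint_adjoint_op[OF T] inner_cscale[of "cnj c"]
    by (metis is_adjoint_def complex_cnj_cnj ell2_ops_cscale[OF T])
  then show "adjoint_op T (cscale c x) = cscale c (adjoint_op T x)"
    using vector_eq_ldot by blast
qed

text \<open>The half of the C*-identity that submultiplicativity does not give: the squared norm of
  \<open>T x\<close> is the inner product of \<open>x\<close> with \<open>U (T x)\<close>, and
  Cauchy-Schwarz applies.\<close>

lemma norm_square_le_norm_adjoint_compose:
  assumes "is_adjoint T U"
  shows "(norm T)\<^sup>2 \<le> norm (U o\<^sub>L T)"
proof -
  have "norm (T x) \<le> sqrt (norm (U o\<^sub>L T)) * norm x" for x
  proof -
    have "(norm (T x))\<^sup>2 = inner x (U (T x))"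
      using assms by (simp add: is_adjoint_def power2_norm_eq_inner)
    also have "\<dots> \<le> norm x * norm ((U o\<^sub>L T) x)"
      using norm_cauchy_schwarz by simp
    also have "\<dots> \<le> norm x * (norm (U o\<^sub>L T) * norm x)"
      by (intro mult_left_mono norm_blinfun) simp
    also have "\<dots> = (sqrt (norm (U o\<^sub>L T)) * norm x)\<^sup>2"
      by (simp add: power2_eq_square)
    finally show ?thesis
      by (rule power2_le_imp_le) simp
  qed
  then have "norm T \<le> sqrt (norm (U o\<^sub>L T))"
    by (intro norm_blinfun_bound) auto
  then show ?thesis
    using power_mono[of "norm T" "sqrt (norm (U o\<^sub>L T))" 2] by simp
qed

lemma norm_adjoint_le: "is_adjoint T U \<Longrightarrow> norm T \<le> norm U"
proof -
  assume "is_adjoint T U"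
  from norm_square_le_norm_adjoint_compose[OF this]
  have "(norm T)\<^sup>2 \<le> norm U * norm T"
    using norm_blinfun_compose[of U T] by linarith
  then show ?thesis
    by (cases "T = 0") (simp_all add: power2_eq_square)
qed

lemma norm_adjoint: "is_adjoint T U \<Longrightarrow> norm U = norm T"
  by (simp add: norm_adjoint_le is_adjoint_sym eq_iff)

lemma norm_adjoint_compose:
  assumes "is_adjoint T U"
  shows "norm (U o\<^sub>L T) = (norm T)\<^sup>2"
proof (rule antisym)
  show "norm (U o\<^sub>L T) \<le> (norm T)\<^sup>2"
    using norm_blinfun_compose[of U T] norm_adjoint[OF assms] by (simp add: power2_eq_square)
qed (rule norm_square_le_norm_adjoint_compose[OF assms])

lemma norm_cscaleL_compose: "norm (cscaleL c o\<^sub>L T) = cmod c * norm T"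
proof (rule antisym)
  have "norm ((cscaleL c o\<^sub>L T) x) \<le> (cmod c * norm T) * norm x" for x
    using mult_left_mono[OF norm_blinfun[of T x], of "cmod c"] by (simp add: norm_cscale mult.assoc)
  then show "norm (cscaleL c o\<^sub>L T) \<le> cmod c * norm T"
    by (intro norm_blinfun_bound) simp_all
  show "cmod c * norm T \<le> norm (cscaleL c o\<^sub>L T)"
  proof (cases "c = 0")
    case False
    have "norm (T x) \<le> (norm (cscaleL c o\<^sub>L T) / cmod c) * norm x" for x
      using norm_blinfun[of "cscaleL c o\<^sub>L T" x] False by (simp add: norm_cscale field_simps)
    then have "norm T \<le> norm (cscaleL c o\<^sub>L T) / cmod c"
      by (intro norm_blinfun_bound) simp_all
    with False show ?thesis
      by (simp add: field_simps)
  qed simp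
qed

text \<open>Passing to the adjoint is isometric, so the adjoints of a convergent sequence are
  Cauchy, and their limit is an adjoint of the limit. Completeness of the operator algebra rests on
  this, as having an adjoint is part of membership.\<close>

lemma ell2_ops_closed_limit:
  assumes "\<And>k. Z k \<in> ell2_ops" "Z \<longlonglongrightarrow> T"
  shows "T \<in> ell2_ops"
proof -
  have adj: "is_adjoint (Z k) (adjoint_op (Z k))" for k
    by (rule is_adjoint_adjoint_op[OF assms(1)])
  have "Cauchy (\<lambda>k. adjoint_op (Z k))"
  proof (rule metric_CauchyI)
    fix e :: real
    assume "0 < e"
    then obtain M where M: "\<forall>m\<ge>M. \<forall>n\<ge>M. dist (Z m) (Z n) < e"
      using metric_CauchyD[OF LIMSEQ_imp_Cauchy[OF assms(2)]] by blast
    have "is_adjoint (Z m - Z n) (adjoint_op (Z m) - adjoint_op (Z n))" for m n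
      using adj[of m] adj[of n]
      by (simp add: is_adjoint_def blinfun.diff_left inner_diff_left inner_diff_right)
    from norm_adjoint[OF this] M
    show "\<exists>M. \<forall>m\<ge>M. \<forall>n\<ge>M. dist (adjoint_op (Z m)) (adjoint_op (Z n)) < e"
      by (auto simp: dist_norm)
  qed
  then obtain U where U: "(\<lambda>k. adjoint_op (Z k)) \<longlonglongrightarrow> U"
    using Cauchy_convergent convergent_def by blast
  have lim: "(\<lambda>k. Z k x) \<longlonglongrightarrow> T x" "(\<lambda>k. adjoint_op (Z k) x) \<longlonglongrightarrow> U x" for x
    using assms(2) U by (auto intro!: tendsto_intros)
  show ?thesis
  proof (rule ell2_opsI)
    show "is_adjoint T U"
      unfolding is_adjoint_def
    proof (intro allI)
      fix x y
      have "(\<lambda>k. inner (Z k x) y) \<longlonglongrightarrow> inner (T x) y"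
        by (intro tendsto_intros lim)
      moreover have "(\<lambda>k. inner (Z k x) y) = (\<lambda>k. inner x (adjoint_op (Z k) y))"
        using adj by (auto simp: is_adjoint_def)
      moreover have "(\<lambda>k. inner x (adjoint_op (Z k) y)) \<longlonglongrightarrow> inner x (U y)"
        by (intro tendsto_intros lim)
      ultimately show "inner (T x) y = inner x (U y)"
        using LIMSEQ_unique by metis
    qed
    fix c x
    have "(\<lambda>k. cscaleL c (Z k x)) \<longlonglongrightarrow> cscaleL c (T x)"
      by (intro tendsto_intros lim)
    moreover have "(\<lambda>k. cscaleL c (Z k x)) = (\<lambda>k. Z k (cscale c x))"
      using assms(1) by (simp add: ell2_ops_cscale)
    ultimately show "T (cscale c x) = cscale c (T x)"
      using lim(1)[of "cscale c x"] LIMSEQ_unique by (metis cscaleL_apply)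
  qed
qed

text \<open>Operators are transported to the type of maps that the universal property in
  \<open>cuntz_algebra\<close> refers to.\<close>

definition encode_op :: "(ell2 \<Rightarrow>\<^sub>L ell2) \<Rightarrow> (nat \<Rightarrow> complex) \<Rightarrow> nat \<Rightarrow> complex" where
  "encode_op T = (\<lambda>f. coord (T (of_coord f)))"

definition decode_op :: "((nat \<Rightarrow> complex) \<Rightarrow> nat \<Rightarrow> complex) \<Rightarrow> ell2 \<Rightarrow>\<^sub>L ell2" where
  "decode_op = inv_into UNIV encode_op"

lemma inj_encode_op: "inj encode_op"
proof
  fix T U assume "encode_op T = encode_op U"
  then have "T x = U x" for x
    by (metis encode_op_def coord_inject coord_inverse)
  then show "T = U"
    by (rule blinfun_eqI)
qed

lemma decode_encode_op [simp]: "decode_op (encode_op T) = T"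
  by (simp add: decode_op_def inj_encode_op)

lemma encode_op_eq_iff [simp]: "encode_op T = encode_op U \<longleftrightarrow> T = U"
  using inj_encode_op by (auto dest: injD)

definition ell2_algebra :: "((nat \<Rightarrow> complex) \<Rightarrow> nat \<Rightarrow> complex) cstar" where
  "ell2_algebra =
     \<lparr>carrier = encode_op ` ell2_ops,
      monoid.mult = (\<lambda>a b. encode_op (decode_op a o\<^sub>L decode_op b)),
      one = encode_op id_blinfun,
      ring.zero = encode_op 0,
      ring.add = (\<lambda>a b. encode_op (decode_op a + decode_op b)),
      smult = (\<lambda>c a. encode_op (cscaleL c o\<^sub>L decode_op a)),
      adj = (\<lambda>a. encode_op (adjoint_op (decode_op a))),
      cnorm = (\<lambda>a. norm (decode_op a))\<rparr>"

lemma ell2_algebra_simps [simp]: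
  "carrier ell2_algebra = encode_op ` ell2_ops"
  "encode_op T \<otimes>\<^bsub>ell2_algebra\<^esub> encode_op U = encode_op (T o\<^sub>L U)"
  "\<one>\<^bsub>ell2_algebra\<^esub> = encode_op id_blinfun"
  "\<zero>\<^bsub>ell2_algebra\<^esub> = encode_op 0"
  "encode_op T \<oplus>\<^bsub>ell2_algebra\<^esub> encode_op U = encode_op (T + U)"
  "c \<odot>\<^bsub>ell2_algebra\<^esub> encode_op T = encode_op (cscaleL c o\<^sub>L T)"
  "adj ell2_algebra (encode_op T) = encode_op (adjoint_op T)"
  "cnorm ell2_algebra (encode_op T) = norm T"
  by (simp_all add: ell2_algebra_def)

lemma cring_complex_ring: "cring complex_ring"
proof (rule cringI)
  show "abelian_group complex_ring"
    by (rule abelian_groupI) (auto simp: complex_ring_def intro: exI[of _ "- _"])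
  show "comm_monoid complex_ring"
    by (rule comm_monoidI) (auto simp: complex_ring_def)
qed (simp add: complex_ring_def algebra_simps)

lemma blinfun_compose_assoc: "(T o\<^sub>L U) o\<^sub>L V = T o\<^sub>L (U o\<^sub>L V)"
  by (rule blinfun_eqI) simp

lemma blinfun_compose_id [simp]: "T o\<^sub>L id_blinfun = T" "id_blinfun o\<^sub>L T = T"
  by (rule blinfun_eqI, simp)+

lemma ring_ell2_algebra: "ring ell2_algebra"
proof (rule ringI)
  show "abelian_group ell2_algebra"
  proof (rule abelian_groupI)
    fix a assume "a \<in> carrier ell2_algebra"
    then obtain T where T: "T \<in> ell2_ops" "a = encode_op T"
      by auto
    have "(cscaleL (-1) o\<^sub>L T) + T = 0"
      by (rule blinfun_eqI, rule ell2_eqI) (simp add: blinfun.add_left)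
    then show "\<exists>b\<in>carrier ell2_algebra. b \<oplus>\<^bsub>ell2_algebra\<^esub> a = \<zero>\<^bsub>ell2_algebra\<^esub>"
      using T by (intro bexI[of _ "encode_op (cscaleL (-1) o\<^sub>L T)"]) (auto simp: ell2_ops_closed)
  qed (auto simp: ell2_ops_closed algebra_simps)
  show "monoid ell2_algebra"
    by (rule monoidI) (auto simp: ell2_ops_closed blinfun_compose_assoc)
qed (auto simp: blinfun.add_left blinfun.add_right intro!: blinfun_eqI)

lemma a_minus_ell2_algebra:
  assumes "T \<in> ell2_ops" "U \<in> ell2_ops"
  shows "encode_op T \<ominus>\<^bsub>ell2_algebra\<^esub> encode_op U = encode_op (T - U)"
proof -
  interpret ring ell2_algebra
    by (rule ring_ell2_algebra)
  have "cscaleL (-1) o\<^sub>L U = - U"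
    by (rule blinfun_eqI, rule ell2_eqI) (simp add: blinfun.minus_left)
  then have U: "- U \<in> ell2_ops"
    using ell2_ops_closed(3,4) assms(2) by metis
  have "\<ominus>\<^bsub>ell2_algebra\<^esub> encode_op U = encode_op (- U)"
    by (rule minus_equality) (use assms U in auto)
  then show ?thesis
    by (simp add: a_minus_def)
qed

lemma cstar_algebra_ell2: "cstar_algebra ell2_algebra"
proof -
  interpret ring ell2_algebra
    by (rule ring_ell2_algebra)
  interpret C: cring complex_ring
    by (rule cring_complex_ring)
  have m: "module complex_ring ell2_algebra"
  proof (rule moduleI)
    show "cring complex_ring" ..
    show "abelian_group ell2_algebra" ..
  qed (auto simp: ell2_ops_closed complex_ring_def intro!: blinfun_eqI ell2_eqI
         simp: blinfun.add_left blinfun.add_right algebra_simps)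
  show ?thesis
  proof (rule cstar_algebra.intro[OF m ring_ell2_algebra], unfold_locales)
    fix Z
    assume Z: "\<And>k::nat. Z k \<in> carrier ell2_algebra"
      and cauchy: "\<forall>e>0. \<exists>N. \<forall>k\<ge>N. \<forall>m\<ge>N. cnorm ell2_algebra (Z k \<ominus>\<^bsub>ell2_algebra\<^esub> Z m) < e"
    define T where "T k = decode_op (Z k)" for k
    have T: "T k \<in> ell2_ops" "Z k = encode_op (T k)" for k
      using Z[of k] by (auto simp: T_def)
    have "Cauchy T"
      using cauchy by (intro metric_CauchyI) (simp add: T a_minus_ell2_algebra dist_norm)
    then obtain L where L: "T \<longlonglongrightarrow> L"
      using Cauchy_convergent convergent_def by blast
    then have "L \<in> ell2_ops"
      using T(1) ell2_ops_closed_limit by blast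
    moreover have "(\<lambda>k. norm (T k - L)) \<longlonglongrightarrow> 0"
      using L by (simp add: LIM_zero tendsto_norm_zero)
    ultimately show "\<exists>x\<in>carrier ell2_algebra.
        (\<lambda>k. cnorm ell2_algebra (Z k \<ominus>\<^bsub>ell2_algebra\<^esub> x)) \<longlonglongrightarrow> 0"
      by (intro bexI[of _ "encode_op L"]) (auto simp: T a_minus_ell2_algebra)
  next
    fix x y assume "x \<in> carrier ell2_algebra" "y \<in> carrier ell2_algebra"
    then obtain T U where T: "T \<in> ell2_ops" "U \<in> ell2_ops" "x = encode_op T" "y = encode_op U"
      by auto
    show "cnorm ell2_algebra (x \<oplus>\<^bsub>ell2_algebra\<^esub> y) \<le> cnorm ell2_algebra x + cnorm ell2_algebra y"
      and "cnorm ell2_algebra (x \<otimes>\<^bsub>ell2_algebra\<^esub> y) \<le> cnorm ell2_algebra x * cnorm ell2_algebra y"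
      by (simp_all add: T norm_triangle_ineq norm_blinfun_compose)
    note adj = is_adjoint_adjoint_op[OF T(1)] is_adjoint_adjoint_op[OF T(2)]
    show "adj ell2_algebra (x \<oplus>\<^bsub>ell2_algebra\<^esub> y) = adj ell2_algebra x \<oplus>\<^bsub>ell2_algebra\<^esub> adj ell2_algebra y"
      and "adj ell2_algebra (x \<otimes>\<^bsub>ell2_algebra\<^esub> y) = adj ell2_algebra y \<otimes>\<^bsub>ell2_algebra\<^esub> adj ell2_algebra x"
      by (simp_all add: T adjoint_op_eq[OF is_adjoint_add[OF adj]] adjoint_op_eq[OF is_adjoint_compose[OF adj]])
  next
    fix x c assume "x \<in> carrier ell2_algebra"
    then obtain T where T: "T \<in> ell2_ops" "x = encode_op T"
      by auto
    note adj = is_adjoint_adjoint_op[OF T(1)]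
    show "adj ell2_algebra x \<in> carrier ell2_algebra"
      and "adj ell2_algebra (adj ell2_algebra x) = x"
      by (simp_all add: T adjoint_op_closed adjoint_op_eq[OF is_adjoint_sym[OF adj]])
    show "cnorm ell2_algebra (adj ell2_algebra x \<otimes>\<^bsub>ell2_algebra\<^esub> x) = (cnorm ell2_algebra x)\<^sup>2"
      by (simp add: T norm_adjoint_compose[OF adj])
    show "cnorm ell2_algebra x = 0 \<longleftrightarrow> x = \<zero>\<^bsub>ell2_algebra\<^esub>"
      and "cnorm ell2_algebra (c \<odot>\<^bsub>ell2_algebra\<^esub> x) = cmod c * cnorm ell2_algebra x"
      by (simp_all add: T norm_cscaleL_compose)
    have "adjoint_op T o\<^sub>L cscaleL (cnj c) = cscaleL (cnj c) o\<^sub>L adjoint_op T"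
      by (rule blinfun_eqI) (simp add: ell2_ops_cscale adjoint_op_closed T)
    then show "adj ell2_algebra (c \<odot>\<^bsub>ell2_algebra\<^esub> x) = cnj c \<odot>\<^bsub>ell2_algebra\<^esub> adj ell2_algebra x"
      by (simp add: T adjoint_op_eq[OF is_adjoint_compose[OF is_adjoint_cscaleL adj]])
  qed (auto simp: ell2_ops_cscale intro!: blinfun_eqI)
qed

section \<open>Branching systems\<close>

text \<open>Coordinates are pulled back along the partial injection \<open>t\<close>; on basis
  vectors the operator is therefore the inverse of \<open>t\<close>, sending the vector at
  \<open>t m\<close> to the one at \<open>m\<close> and killing those outside the image of
  \<open>D\<close>. So the shift on the points with one label yields an isometry, and
  \<open>pre\<close> its adjoint.\<close>

definition pinj_op :: "nat set \<Rightarrow> (nat \<Rightarrow> nat) \<Rightarrow> ell2 \<Rightarrow>\<^sub>L ell2" where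
  "pinj_op D t = Blinfun (\<lambda>x. of_coord (\<lambda>m. if m \<in> D then coord x (t m) else 0))"

lemma coord_pinj_op:
  assumes "inj_on t D"
  shows "coord (pinj_op D t x) m = (if m \<in> D then coord x (t m) else 0)"
proof -
  let ?f = "\<lambda>x m. if m \<in> D then coord x (t m) else 0"
  have le: "(\<Sum>m\<in>F. (norm (?f x m))\<^sup>2) \<le> (norm x)\<^sup>2" if "finite F" for F x
  proof -
    have "(\<Sum>m\<in>F. (norm (?f x m))\<^sup>2) = (\<Sum>m\<in>F. if m \<in> D then (norm (coord x (t m)))\<^sup>2 else 0)"
      by (rule sum.cong) simp_all
    also have "\<dots> = (\<Sum>m\<in>F \<inter> D. (norm (coord x (t m)))\<^sup>2)"
      using that by (simp add: sum.inter_restrict)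
    also have "\<dots> = (\<Sum>m\<in>t ` (F \<inter> D). (norm (coord x m))\<^sup>2)"
      using inj_on_subset[OF assms, of "F \<inter> D"] by (simp add: sum.reindex)
    also have "\<dots> \<le> (norm x)\<^sup>2"
      using that by (intro sum_coord_le) simp
    finally show ?thesis .
  qed
  have "(\<lambda>m. (norm (?f x m))\<^sup>2) summable_on UNIV" for x
    by (rule square_summable_bounded(1)[where e = "norm x", OF le]) simp_all
  then have c: "coord (of_coord (?f x)) m = ?f x m" for x m
    by (simp add: coord_of_coord)
  have "norm (of_coord (?f x)) \<le> norm x" for x
    by (rule square_summable_bounded(2)[where e = "norm x", OF le]) simp_all
  then have "bounded_linear (\<lambda>x. of_coord (?f x))"
    by (intro bounded_linear_intro[of _ 1]) (auto intro!: ell2_eqI simp: c)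
  then show ?thesis
    by (simp add: pinj_op_def bounded_linear_Blinfun_apply c)
qed

lemma is_adjoint_pinj_op:
  assumes "bij_betw t D E" "\<And>m. m \<in> D \<Longrightarrow> s (t m) = m"
  shows "is_adjoint (pinj_op D t) (pinj_op E s)"
  unfolding is_adjoint_def
proof (intro allI)
  fix x y
  have t: "inj_on t D" and s: "inj_on s E"
    using assms by (auto simp: bij_betw_def inj_on_def)
  have "inner (pinj_op D t x) y = (\<Sum>\<^sub>\<infinity>m\<in>D. inner (coord x (t m)) (coord y (s (t m))))"
    unfolding inner_ell2_def
    by (rule infsum_cong_neutral) (auto simp: coord_pinj_op[OF t] assms(2))
  also have "\<dots> = (\<Sum>\<^sub>\<infinity>m\<in>E. inner (coord x m) (coord y (s m)))"
    by (rule infsum_reindex_bij_betw[OF assms(1)])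
  also have "\<dots> = inner x (pinj_op E s y)"
    unfolding inner_ell2_def
    by (rule infsum_cong_neutral) (auto simp: coord_pinj_op[OF s])
  finally show "inner (pinj_op D t x) y = inner x (pinj_op E s y)" .
qed

lemma pinj_op_in_ell2_ops:
  assumes "inj_on t D"
  shows "pinj_op D t \<in> ell2_ops"
proof (rule ell2_opsI)
  show "is_adjoint (pinj_op D t) (pinj_op (t ` D) (inv_into D t))"
    using assms by (intro is_adjoint_pinj_op) (auto simp: inj_on_imp_bij_betw)
qed (auto intro!: ell2_eqI simp: coord_pinj_op[OF assms])

text \<open>A bijection of {1..n} \<times> \<nat> with \<nat>: \<open>pre\<close> is the map and
  (\<open>lab\<close>, \<open>shift\<close>) its inverse. It gives a Cuntz family in which S_i sends
  the basis vector at \<open>m\<close> to the one at \<open>pre i m\<close>.\<close>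

locale branching =
  fixes n :: nat and pre :: "nat \<Rightarrow> nat \<Rightarrow> nat" and lab shift :: "nat \<Rightarrow> nat"
  assumes lab_range: "lab m \<in> {1..n}"
    and pre_lab_shift: "pre (lab m) (shift m) = m"
    and lab_pre: "i \<in> {1..n} \<Longrightarrow> lab (pre i m) = i"
    and shift_pre: "i \<in> {1..n} \<Longrightarrow> shift (pre i m) = m"
begin

definition isom :: "nat \<Rightarrow> ell2 \<Rightarrow>\<^sub>L ell2" where
  "isom i = pinj_op {m. lab m = i} shift"

definition coisom :: "nat \<Rightarrow> ell2 \<Rightarrow>\<^sub>L ell2" where
  "coisom i = pinj_op UNIV (pre i)"

lemma inj_shift: "inj_on shift {m. lab m = i}"
proof (rule inj_onI)
  fix k m assume "k \<in> {m. lab m = i}" "m \<in> {m. lab m = i}" "shift k = shift m"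
  then show "k = m"
    using pre_lab_shift[of k] pre_lab_shift[of m] by simp
qed

lemma inj_pre: "i \<in> {1..n} \<Longrightarrow> inj (pre i)"
  by (rule inj_on_inverseI[where g = shift]) (rule shift_pre)

lemma coord_isom: "coord (isom i x) m = (if lab m = i then coord x (shift m) else 0)"
  by (simp add: isom_def coord_pinj_op[OF inj_shift])

lemma coord_coisom: "i \<in> {1..n} \<Longrightarrow> coord (coisom i x) m = coord x (pre i m)"
  by (simp add: coisom_def coord_pinj_op[OF inj_pre])

lemma isom_in_ell2_ops: "isom i \<in> ell2_ops"
  unfolding isom_def by (rule pinj_op_in_ell2_ops[OF inj_shift])

lemma adjoint_op_isom:
  assumes "i \<in> {1..n}"
  shows "adjoint_op (isom i) = coisom i"
proof -
  have "bij_betw shift {m. lab m = i} UNIV"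
  proof (rule bij_betwI)
    show "pre i \<in> UNIV \<rightarrow> {m. lab m = i}"
      by (simp add: lab_pre[OF assms])
    show "pre i (shift m) = m" if "m \<in> {m. lab m = i}" for m
      using that pre_lab_shift[of m] by simp
  qed (simp_all add: shift_pre[OF assms])
  then have "is_adjoint (isom i) (coisom i)"
    unfolding isom_def coisom_def
  proof (rule is_adjoint_pinj_op)
    show "pre i (shift m) = m" if "m \<in> {m. lab m = i}" for m
      using that pre_lab_shift[of m] by simp
  qed
  then show ?thesis
    by (rule adjoint_op_eq)
qed

lemma coisom_isom: "i \<in> {1..n} \<Longrightarrow> coisom i o\<^sub>L isom i = id_blinfun"
  by (intro blinfun_eqI ell2_eqI) (simp add: coord_coisom coord_isom lab_pre shift_pre)

lemma coord_sum: "coord (\<Sum>i\<in>I. g i) m = (\<Sum>i\<in>I. coord (g i) m)"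
  by (induction I rule: infinite_finite_induct) auto

lemma sum_isom_coisom: "(\<Sum>i\<in>{1..n}. isom i o\<^sub>L coisom i) = id_blinfun"
proof (intro blinfun_eqI ell2_eqI)
  fix x m
  have "coord ((\<Sum>i\<in>{1..n}. isom i o\<^sub>L coisom i) x) m
      = (\<Sum>i\<in>{1..n}. coord (isom i (coisom i x)) m)"
    by (simp add: blinfun.sum_left coord_sum)
  also have "\<dots> = (\<Sum>i\<in>{1..n}. if lab m = i then coord x (pre i (shift m)) else 0)"
    by (rule sum.cong) (simp_all add: coord_isom coord_coisom)
  also have "\<dots> = coord x m"
    using lab_range[of m] by (simp add: pre_lab_shift)
  finally show "coord ((\<Sum>i\<in>{1..n}. isom i o\<^sub>L coisom i) x) m = coord (id_blinfun x) m"
    by simp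
qed

text \<open>Multiply on the right by 1, written as the sum of the range projections.\<close>

lemma eq_if_eq_on_isoms:
  assumes "\<And>i. i \<in> {1..n} \<Longrightarrow> U o\<^sub>L isom i = V o\<^sub>L isom i"
  shows "U = V"
proof -
  have "X = (\<Sum>i\<in>{1..n}. (X o\<^sub>L isom i) o\<^sub>L coisom i)" for X
  proof -
    have "X = X o\<^sub>L (\<Sum>i\<in>{1..n}. isom i o\<^sub>L coisom i)"
      unfolding sum_isom_coisom by simp
    also have "\<dots> = (\<Sum>i\<in>{1..n}. (X o\<^sub>L isom i) o\<^sub>L coisom i)"
      by (rule blinfun_eqI) (simp add: blinfun.sum_left blinfun.sum_right)
    finally show ?thesis .
  qed
  from this[of U] this[of V] show ?thesis
    using assms by simp
qed

lemma finsum_ell2_algebra: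
  assumes "finite I" "\<And>i. i \<in> I \<Longrightarrow> g i \<in> ell2_ops"
  shows "(\<Oplus>\<^bsub>ell2_algebra\<^esub>i\<in>I. encode_op (g i)) = encode_op (\<Sum>i\<in>I. g i) \<and> (\<Sum>i\<in>I. g i) \<in> ell2_ops"
proof -
  interpret ring ell2_algebra
    by (rule ring_ell2_algebra)
  show ?thesis
    using assms
  proof (induction I rule: finite_induct)
    case (insert i I)
    have "(\<lambda>i. encode_op (g i)) \<in> I \<rightarrow> carrier ell2_algebra" "encode_op (g i) \<in> carrier ell2_algebra"
      using insert.prems by auto
    from finsum_insert[OF insert.hyps this] insert show ?case
      by (auto intro: ell2_ops_closed)
  qed (simp add: ell2_ops_closed)
qed

lemma cuntz_family_isom: "cuntz_family n ell2_algebra (\<lambda>i. encode_op (isom i))"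
proof -
  interpret ring ell2_algebra
    by (rule ring_ell2_algebra)
  have c: "coisom i \<in> ell2_ops" if "i \<in> {1..n}" for i
    using adjoint_op_closed[OF isom_in_ell2_ops] adjoint_op_isom[OF that] by metis
  have "(\<Oplus>\<^bsub>ell2_algebra\<^esub>i\<in>{1..n}. encode_op (isom i) \<otimes>\<^bsub>ell2_algebra\<^esub> adj ell2_algebra (encode_op (isom i)))
      = (\<Oplus>\<^bsub>ell2_algebra\<^esub>i\<in>{1..n}. encode_op (isom i o\<^sub>L coisom i))"
    by (rule finsum_cong') (auto simp: adjoint_op_isom c isom_in_ell2_ops intro!: ell2_ops_closed)
  also have "\<dots> = encode_op id_blinfun"
    using finsum_ell2_algebra[of "{1..n}" "\<lambda>i. isom i o\<^sub>L coisom i"] c isom_in_ell2_ops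
    unfolding sum_isom_coisom by (simp add: ell2_ops_closed)
  finally show ?thesis
    using isom_in_ell2_ops by (auto simp: cuntz_family_def adjoint_op_isom coisom_isom)
qed

text \<open>The universal property with target \<open>ell2_algebra\<close>. The intertwining
  argument below uses only products, the unit and the values at the generators.\<close>

lemma representation:
  fixes A (structure)
  assumes "cuntz_algebra n A S"
  obtains \<rho> where "\<And>x y. x \<in> carrier A \<Longrightarrow> y \<in> carrier A \<Longrightarrow> \<rho> (x \<otimes> y) = \<rho> x o\<^sub>L \<rho> y"
    "\<rho> \<one> = id_blinfun" "\<And>i. i \<in> {1..n} \<Longrightarrow> \<rho> (S i) = isom i"
proof -
  have "universal_cuntz_family TYPE((nat \<Rightarrow> complex) \<Rightarrow> nat \<Rightarrow> complex) n A S"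
    using assms by (simp add: cuntz_algebra_def)
  then have "\<exists>!f. f \<in> star_hom A ell2_algebra \<inter> extensional (carrier A) \<and>
      (\<forall>i\<in>{1..n}. f (S i) = encode_op (isom i))"
    unfolding universal_cuntz_family_def
    by (rule allE[where x = ell2_algebra], elim allE[where x = "\<lambda>i. encode_op (isom i)"])
       (simp only: cstar_algebra_ell2 cuntz_family_isom simp_thms)
  then obtain f where f: "f \<in> star_hom A ell2_algebra" "\<forall>i\<in>{1..n}. f (S i) = encode_op (isom i)"
    by (elim ex1E conjE IntE)
  then have hom: "f \<in> ring_hom A ell2_algebra"
    by (simp add: star_hom_def)
  show thesis
  proof (rule that[of "\<lambda>x. decode_op (f x)"])
    fix x y assume xy: "x \<in> carrier A" "y \<in> carrier A"
    then obtain T U where "f x = encode_op T" "f y = encode_op U"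
      using ring_hom_closed[OF hom] by fastforce
    then show "decode_op (f (x \<otimes> y)) = decode_op (f x) o\<^sub>L decode_op (f y)"
      using ring_hom_mult[OF hom xy] by simp
  qed (simp_all add: f ring_hom_one[OF hom])
qed

end

section \<open>Positivity and orthogonality of ranges\<close>

context cstar_algebra
begin

lemma smult_carrier [simp]: "x \<in> carrier A \<Longrightarrow> c \<odot> x \<in> carrier A"
  using smult_closed by (simp add: complex_ring_def)

lemma smult_add_left: "x \<in> carrier A \<Longrightarrow> (c + d) \<odot> x = c \<odot> x \<oplus> d \<odot> x"
  using smult_l_distr[of c d x] by (simp add: complex_ring_def)

lemma smult_add_right:
  "x \<in> carrier A \<Longrightarrow> y \<in> carrier A \<Longrightarrow> c \<odot> (x \<oplus> y) = c \<odot> x \<oplus> c \<odot> y"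
  using smult_r_distr[of c x y] by (simp add: complex_ring_def)

lemma smult_smult: "x \<in> carrier A \<Longrightarrow> c \<odot> (d \<odot> x) = (c * d) \<odot> x"
  using smult_assoc1[of c d x] by (simp add: complex_ring_def)

lemma smult_1 [simp]: "x \<in> carrier A \<Longrightarrow> 1 \<odot> x = x"
  using smult_one[of x] by (simp add: complex_ring_def)

lemma smult_0 [simp]: "x \<in> carrier A \<Longrightarrow> 0 \<odot> x = \<zero>"
  using smult_l_null[of x] by (simp add: complex_ring_def)

lemma smult_zero [simp]: "c \<odot> \<zero> = \<zero>"
  using smult_r_null[of c] by (simp add: complex_ring_def)

lemma smult_minus_one: "x \<in> carrier A \<Longrightarrow> (-1) \<odot> x = \<ominus> x"
  using smult_add_left[of x "-1" 1] by (simp add: minus_equality)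

lemma cnorm_zero [simp]: "cnorm A \<zero> = 0"
  using cnorm_eq_zero by simp

lemma cnorm_nonneg: "x \<in> carrier A \<Longrightarrow> 0 \<le> cnorm A x"
  using cnorm_triangle[of x "(-1) \<odot> x"] cnorm_smult[of x "-1"] by (simp add: smult_minus_one r_neg)

lemma adj_one [simp]: "adj A \<one> = \<one>"
  using adj_mult[of \<one> "adj A \<one>"] adj_adj[of \<one>] adj_closed[of \<one>] by simp

lemma cnorm_one_le: "cnorm A \<one> \<le> 1"
  using cstar_identity[of \<one>] by (auto simp: power2_eq_square)

lemma cnorm_le_cnorm_adj:
  assumes "x \<in> carrier A"
  shows "cnorm A x \<le> cnorm A (adj A x)"
proof (cases "cnorm A x = 0")
  case False
  have "cnorm A x * cnorm A x \<le> cnorm A (adj A x) * cnorm A x"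
    using cstar_identity[OF assms] cnorm_mult[OF adj_closed[OF assms] assms]
    by (simp add: power2_eq_square)
  then show ?thesis
    using False cnorm_nonneg[OF assms] by (simp add: mult_le_cancel_right)
qed (simp add: cnorm_nonneg adj_closed assms)

lemma cnorm_adj: "x \<in> carrier A \<Longrightarrow> cnorm A (adj A x) = cnorm A x"
  using cnorm_le_cnorm_adj[of x] cnorm_le_cnorm_adj[of "adj A x"] by (simp add: adj_closed adj_adj)

lemma one_add_square:
  assumes "x \<in> carrier A"
  shows "(\<one> \<oplus> c \<odot> x) \<otimes> (\<one> \<oplus> d \<odot> x) = \<one> \<oplus> ((c + d) \<odot> x \<oplus> (c * d) \<odot> (x \<otimes> x))"
  using assms
  by (simp add: l_distr r_distr smult_mult_left smult_mult_right smult_smult smult_add_left smult_add_right a_ac mult.commute)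

lemma cnorm_one_add_square_le:
  assumes "x \<in> carrier A" "cnorm A (\<one> \<oplus> c \<odot> x) \<le> 1"
  shows "cnorm A ((\<one> \<oplus> c \<odot> x) \<otimes> (\<one> \<oplus> c \<odot> x)) \<le> 1"
proof -
  have "cnorm A ((\<one> \<oplus> c \<odot> x) \<otimes> (\<one> \<oplus> c \<odot> x)) \<le> cnorm A (\<one> \<oplus> c \<odot> x) * cnorm A (\<one> \<oplus> c \<odot> x)"
    using assms(1) by (intro cnorm_mult) simp_all
  also have "\<dots> \<le> 1"
    using assms by (intro mult_le_one cnorm_nonneg) simp_all
  finally show ?thesis .
qed

lemma cnorm_half_le:
  assumes "x \<in> carrier A" "y \<in> carrier A" "cnorm A x \<le> 1" "cnorm A y \<le> 1"
  shows "cnorm A ((1/2) \<odot> (x \<oplus> y)) \<le> 1"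
  using assms cnorm_triangle[of x y] by (simp add: cnorm_smult)

lemma cmod_add_one_ii: "cmod (1 + \<i>) = sqrt 2"
  by (simp add: cmod_def)

text \<open>The average of \<open>(1 + cx)\<^sup>2\<close> and \<open>(1 + \<i>cx)\<^sup>2\<close> is \<open>1 + (1 + \<i>)cx\<close>. Iterating this, all
  \<open>1 + (1 + \<i>)\<^sup>mx\<close> are contractions, and so \<open>x = 0\<close>.\<close>

lemma eq_zero_if_cnorm_one_add_le:
  assumes x: "x \<in> carrier A"
    and le: "\<And>c. c \<in> {1, -1, \<i>, -\<i>} \<Longrightarrow> cnorm A (\<one> \<oplus> c \<odot> x) \<le> 1"
  shows "x = \<zero>"
proof (rule ccontr)
  assume "x \<noteq> \<zero>"
  then have pos: "0 < cnorm A x"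
    using x cnorm_nonneg[OF x] cnorm_eq_zero[OF x] by simp
  have avg: "\<one> \<oplus> ((1 + \<i>) * c) \<odot> x = (1/2) \<odot> ((\<one> \<oplus> c \<odot> x) \<otimes> (\<one> \<oplus> c \<odot> x) \<oplus>
      (\<one> \<oplus> (\<i> * c) \<odot> x) \<otimes> (\<one> \<oplus> (\<i> * c) \<odot> x))" for c
  proof -
    have "(\<one> \<oplus> (a \<oplus> b)) \<oplus> (\<one> \<oplus> (a' \<oplus> b')) = (\<one> \<oplus> \<one>) \<oplus> ((a \<oplus> a') \<oplus> (b \<oplus> b'))"
      if "a \<in> carrier A" "b \<in> carrier A" "a' \<in> carrier A" "b' \<in> carrier A" for a b a' b'
      using that by (simp add: a_ac)
    then have "(\<one> \<oplus> c \<odot> x) \<otimes> (\<one> \<oplus> c \<odot> x) \<oplus> (\<one> \<oplus> (\<i> * c) \<odot> x) \<otimes> (\<one> \<oplus> (\<i> * c) \<odot> x)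
        = (\<one> \<oplus> \<one>) \<oplus> (((c + c) \<odot> x \<oplus> (\<i> * c + \<i> * c) \<odot> x)
            \<oplus> ((c * c) \<odot> (x \<otimes> x) \<oplus> (\<i> * c * (\<i> * c)) \<odot> (x \<otimes> x)))"
      using x by (simp add: one_add_square)
    also have "\<one> \<oplus> \<one> = 2 \<odot> \<one>"
      using smult_add_left[of \<one> 1 1] by simp
    also have "(c + c) \<odot> x \<oplus> (\<i> * c + \<i> * c) \<odot> x = (2 * ((1 + \<i>) * c)) \<odot> x"
      using x by (simp add: smult_add_left[symmetric] algebra_simps)
    also have "(c * c) \<odot> (x \<otimes> x) \<oplus> (\<i> * c * (\<i> * c)) \<odot> (x \<otimes> x) = \<zero>"
      using smult_add_left[of "x \<otimes> x" "c * c" "\<i> * c * (\<i> * c)"] x by (simp add: algebra_simps)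
    finally show ?thesis
      using x by (simp add: smult_add_right smult_smult)
  qed
  have step: "cnorm A (\<one> \<oplus> ((1 + \<i>) * c) \<odot> x) \<le> 1"
    if "cnorm A (\<one> \<oplus> c \<odot> x) \<le> 1" "cnorm A (\<one> \<oplus> (\<i> * c) \<odot> x) \<le> 1" for c
    unfolding avg using x that by (intro cnorm_half_le cnorm_one_add_square_le) simp_all
  \<comment> \<open>All four units are treated at once, because the step for \<open>c\<close> also
    uses the hypothesis for \<open>\<i> * c\<close>.\<close>
  have "cnorm A (\<one> \<oplus> (c * (1 + \<i>) ^ m) \<odot> x) \<le> 1" if "c \<in> {1, -1, \<i>, -\<i>}" for m c
    using that
  proof (induction m arbitrary: c)
    case (Suc m)
    have "\<i> * c \<in> {1, -1, \<i>, -\<i>}"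
      using Suc.prems by auto
    from step[of "c * (1 + \<i>) ^ m"] Suc.IH[OF Suc.prems] Suc.IH[OF this]
    show ?case
      by (simp add: ac_simps)
  qed (use le in simp)
  from this[of 1] have le1: "cnorm A (\<one> \<oplus> (1 + \<i>) ^ m \<odot> x) \<le> 1" for m
    by simp
  have "sqrt 2 ^ m * cnorm A x \<le> 2" for m
  proof -
    let ?y = "(1 + \<i>) ^ m \<odot> x"
    have "?y = (\<one> \<oplus> ?y) \<oplus> (-1) \<odot> \<one>"
      using x by (simp add: smult_minus_one a_comm[of \<one> ?y] a_assoc r_neg)
    then have "cnorm A ?y \<le> cnorm A (\<one> \<oplus> ?y) + cnorm A ((-1) \<odot> \<one>)"
      using cnorm_triangle[of "\<one> \<oplus> ?y" "(-1) \<odot> \<one>"] x by simp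
    also have "\<dots> \<le> 2"
      using le1[of m] cnorm_one_le by (simp add: cnorm_smult)
    finally show ?thesis
      using x cmod_add_one_ii by (simp add: cnorm_smult norm_power)
  qed
  moreover obtain m where "2 / cnorm A x < sqrt 2 ^ m"
    using real_arch_pow[of "sqrt 2" "2 / cnorm A x"] by auto
  ultimately show False
    using pos by (simp add: field_simps not_le[symmetric])
qed

text \<open>This description of the positive elements by the norm makes sums and antisymmetry accessible
  without spectral theory.\<close>

definition positive :: "'a \<Rightarrow> bool" where
  "positive x \<longleftrightarrow> x \<in> carrier A \<and> adj A x = x \<and>
     (\<exists>t\<ge>0. cnorm A (complex_of_real t \<odot> \<one> \<oplus> (-1) \<odot> x) \<le> t)"

text \<open>The witness \<open>t\<close> of positivity may be enlarged, so that two elements can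
  share one.\<close>

lemma cnorm_shift_mono:
  assumes "x \<in> carrier A" "cnorm A (complex_of_real t \<odot> \<one> \<oplus> x) \<le> t" "t \<le> s"
  shows "cnorm A (complex_of_real s \<odot> \<one> \<oplus> x) \<le> s"
proof -
  have "complex_of_real s \<odot> \<one> = complex_of_real (s - t) \<odot> \<one> \<oplus> complex_of_real t \<odot> \<one>"
    by (simp add: smult_add_left[symmetric])
  then have "complex_of_real s \<odot> \<one> \<oplus> x = complex_of_real (s - t) \<odot> \<one> \<oplus> (complex_of_real t \<odot> \<one> \<oplus> x)"
    using assms(1) by (simp add: a_assoc)
  then have "cnorm A (complex_of_real s \<odot> \<one> \<oplus> x)
      \<le> cnorm A (complex_of_real (s - t) \<odot> \<one>) + cnorm A (complex_of_real t \<odot> \<one> \<oplus> x)"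
    using assms(1) cnorm_triangle by simp
  also have "cnorm A (complex_of_real (s - t) \<odot> \<one>) = (s - t) * cnorm A \<one>"
    using assms(3) by (simp only: cnorm_smult one_closed norm_of_real abs_of_nonneg diff_ge_0_iff_ge)
  also have "(s - t) * cnorm A \<one> + cnorm A (complex_of_real t \<odot> \<one> \<oplus> x) \<le> (s - t) * 1 + t"
    using assms(2,3) cnorm_one_le by (intro add_mono mult_left_mono) simp_all
  finally show ?thesis
    by simp
qed

lemma positive_zero: "positive \<zero>"
  using adj_smult[of \<zero> 0] by (auto simp: positive_def adj_closed intro!: exI[of _ 0])

lemma positive_add:
  assumes "positive x" "positive y"
  shows "positive (x \<oplus> y)"
proof -
  obtain t s where ts: "0 \<le> t" "0 \<le> s"
    "cnorm A (complex_of_real t \<odot> \<one> \<oplus> (-1) \<odot> x) \<le> t"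
    "cnorm A (complex_of_real s \<odot> \<one> \<oplus> (-1) \<odot> y) \<le> s"
    using assms by (auto simp: positive_def)
  have c: "x \<in> carrier A" "y \<in> carrier A"
    using assms by (simp_all add: positive_def)
  have "complex_of_real (t + s) \<odot> \<one> \<oplus> (-1) \<odot> (x \<oplus> y)
      = (complex_of_real t \<odot> \<one> \<oplus> (-1) \<odot> x) \<oplus> (complex_of_real s \<odot> \<one> \<oplus> (-1) \<odot> y)"
    using c by (simp add: smult_add_left smult_add_right a_ac)
  then have "cnorm A (complex_of_real (t + s) \<odot> \<one> \<oplus> (-1) \<odot> (x \<oplus> y)) \<le> t + s"
    using cnorm_triangle[of "complex_of_real t \<odot> \<one> \<oplus> (-1) \<odot> x" "complex_of_real s \<odot> \<one> \<oplus> (-1) \<odot> y"]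
      ts c by simp
  then show ?thesis
    using assms ts by (auto simp: positive_def adj_add intro!: exI[of _ "t + s"])
qed

lemma positive_finsum:
  "finite I \<Longrightarrow> (\<And>i. i \<in> I \<Longrightarrow> positive (f i)) \<Longrightarrow> positive (\<Oplus>i\<in>I. f i)"
proof (induction I rule: finite_induct)
  case (insert i I)
  then have "f \<in> I \<rightarrow> carrier A" "f i \<in> carrier A"
    by (auto simp: positive_def)
  with insert show ?case
    by (simp add: positive_add)
qed (simp add: positive_zero)

text \<open>If \<open>y\<close> is self-adjoint and \<open>1 + y\<close>, \<open>1 - y\<close> are contractions, then so is \<open>1 + y\<^sup>2\<close>, the average of
  their squares. As \<open>\<parallel>1 \<plusminus> \<i>y\<parallel>\<^sup>2 = \<parallel>1 + y\<^sup>2\<parallel>\<close>, also \<open>1 + \<i>y\<close> and \<open>1 - \<i>y\<close> are contractions.\<close>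

lemma positive_antisym:
  assumes "positive x" "positive ((-1) \<odot> x)"
  shows "x = \<zero>"
proof -
  have x: "x \<in> carrier A" and sa: "adj A x = x"
    using assms by (simp_all add: positive_def)
  obtain r where r: "cnorm A (complex_of_real r \<odot> \<one> \<oplus> (-1) \<odot> x) \<le> r"
    using assms(1) unfolding positive_def by blast
  obtain s where s: "cnorm A (complex_of_real s \<odot> \<one> \<oplus> (-1) \<odot> ((-1) \<odot> x)) \<le> s"
    using assms(2) unfolding positive_def by blast
  then have s': "cnorm A (complex_of_real s \<odot> \<one> \<oplus> 1 \<odot> x) \<le> s"
    using x by (simp add: smult_smult)
  \<comment> \<open>The bound 1 makes \<open>t\<close> positive, as \<open>x\<close> is divided by
    it next.\<close>
  define t where "t = max (max r s) 1"
  have t: "0 < t" and "r \<le> t" "s \<le> t"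
    by (auto simp: t_def)
  have t1: "cnorm A (complex_of_real t \<odot> \<one> \<oplus> (-1) \<odot> x) \<le> t"
    by (rule cnorm_shift_mono[OF _ r \<open>r \<le> t\<close>]) (simp add: x)
  have t2: "cnorm A (complex_of_real t \<odot> \<one> \<oplus> 1 \<odot> x) \<le> t"
    by (rule cnorm_shift_mono[OF _ s' \<open>s \<le> t\<close>]) (simp add: x)
  define y where "y = complex_of_real (1/t) \<odot> x"
  have y: "y \<in> carrier A" and say: "adj A y = y"
    using x sa by (simp_all add: y_def adj_smult)
  have inv_t: "complex_of_real (1/t) * complex_of_real t = 1" "complex_of_real t * complex_of_real (1/t) = 1"
    using t by simp_all
  have "complex_of_real (1/t) \<odot> (complex_of_real t \<odot> \<one> \<oplus> c \<odot> x) = \<one> \<oplus> c \<odot> y" for c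
    using x by (simp only: smult_add_right smult_smult y_def smult_carrier one_closed inv_t smult_1
        mult.commute[of c])
  then have "cnorm A (\<one> \<oplus> c \<odot> y) = cnorm A (complex_of_real t \<odot> \<one> \<oplus> c \<odot> x) / t" for c
    using cnorm_smult[of "complex_of_real t \<odot> \<one> \<oplus> c \<odot> x" "complex_of_real (1/t)"] x t
    by (simp add: norm_divide)
  then have le: "cnorm A (\<one> \<oplus> c \<odot> y) \<le> 1" if "c = 1 \<or> c = -1" for c
    using that t1 t2 t by auto
  have sum: "\<one> \<oplus> y \<otimes> y = (1/2) \<odot> ((\<one> \<oplus> 1 \<odot> y) \<otimes> (\<one> \<oplus> 1 \<odot> y) \<oplus> (\<one> \<oplus> (-1) \<odot> y) \<otimes> (\<one> \<oplus> (-1) \<odot> y))"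
  proof -
    have "(\<one> \<oplus> (a \<oplus> b)) \<oplus> (\<one> \<oplus> (a' \<oplus> b)) = (\<one> \<oplus> \<one>) \<oplus> ((a \<oplus> a') \<oplus> (b \<oplus> b))"
      if "a \<in> carrier A" "b \<in> carrier A" "a' \<in> carrier A" for a b a'
      using that by (simp add: a_ac)
    then have "(\<one> \<oplus> 1 \<odot> y) \<otimes> (\<one> \<oplus> 1 \<odot> y) \<oplus> (\<one> \<oplus> (-1) \<odot> y) \<otimes> (\<one> \<oplus> (-1) \<odot> y)
        = (\<one> \<oplus> \<one>) \<oplus> ((2 \<odot> y \<oplus> (-2) \<odot> y) \<oplus> (y \<otimes> y \<oplus> y \<otimes> y))"
      using y unfolding one_add_square[OF y] by simp
    also have "\<dots> = 2 \<odot> \<one> \<oplus> 2 \<odot> (y \<otimes> y)"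
      using y smult_add_left[of \<one> 1 1] smult_add_left[of "y \<otimes> y" 1 1]
        smult_add_left[of y 2 "-2", symmetric] by simp
    finally show ?thesis
      using y by (simp add: smult_add_right smult_smult)
  qed
  have sq: "cnorm A (\<one> \<oplus> y \<otimes> y) \<le> 1"
    unfolding sum
    by (intro cnorm_half_le cnorm_one_add_square_le m_closed a_closed smult_carrier one_closed y le) simp_all
  have "cnorm A (\<one> \<oplus> c \<odot> y) \<le> 1" if "c = \<i> \<or> c = -\<i>" for c
  proof -
    have "adj A (\<one> \<oplus> c \<odot> y) \<otimes> (\<one> \<oplus> c \<odot> y) = (\<one> \<oplus> (cnj c) \<odot> y) \<otimes> (\<one> \<oplus> c \<odot> y)"
      using y say by (simp add: adj_add adj_smult)
    also have "\<dots> = \<one> \<oplus> y \<otimes> y"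
      using y that by (auto simp: one_add_square)
    finally have "(cnorm A (\<one> \<oplus> c \<odot> y))\<^sup>2 \<le> 1"
      using sq cstar_identity[of "\<one> \<oplus> c \<odot> y"] y by simp
    then show ?thesis
      using power2_le_imp_le[of "cnorm A (\<one> \<oplus> c \<odot> y)" 1] by simp
  qed
  with le have "y = \<zero>"
    using y by (intro eq_zero_if_cnorm_one_add_le) auto
  then have "complex_of_real t \<odot> y = \<zero>"
    by simp
  then show ?thesis
    using x by (simp only: y_def smult_smult inv_t smult_1)
qed

text \<open>The element 1 - 2p is a self-adjoint unitary, hence a contraction; conjugated by the
  isometry \<open>s\<close> it stays one and becomes 1 - 2q, where q is the element in question. So
  1/2 witnesses that q is positive.\<close>

lemma positive_conjugate_projection:
  assumes p: "p \<in> carrier A" "adj A p = p" "p \<otimes> p = p"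
    and s: "s \<in> carrier A" "adj A s \<otimes> s = \<one>"
  shows "positive (adj A s \<otimes> p \<otimes> s)"
proof -
  let ?q = "adj A s \<otimes> p \<otimes> s"
  have as: "adj A s \<in> carrier A"
    using s adj_closed by simp
  have "cnorm A s \<le> 1"
    using cstar_identity[OF s(1)] s(2) cnorm_one_le power2_le_imp_le[of "cnorm A s" 1] by simp
  note ns = this cnorm_nonneg[OF s(1)]
  have "(\<one> \<oplus> (-2) \<odot> p) \<otimes> (\<one> \<oplus> (-2) \<odot> p) = \<one>"
    using p smult_add_left[of p "-4" 4] by (simp add: one_add_square)
  moreover have "adj A (\<one> \<oplus> (-2) \<odot> p) = \<one> \<oplus> (-2) \<odot> p"
    using p by (simp add: adj_add adj_smult)
  ultimately have "cnorm A (\<one> \<oplus> (-2) \<odot> p) \<le> 1"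
    using cstar_identity[of "\<one> \<oplus> (-2) \<odot> p"] p cnorm_one_le power2_le_imp_le[of "cnorm A (\<one> \<oplus> (-2) \<odot> p)" 1]
    by simp
  note np = this cnorm_nonneg[of "\<one> \<oplus> (-2) \<odot> p"]
  have "adj A s \<otimes> (\<one> \<oplus> (-2) \<odot> p) \<otimes> s = \<one> \<oplus> (-2) \<odot> ?q"
    using p s as by (simp add: l_distr r_distr smult_mult_left smult_mult_right)
  moreover have "cnorm A (adj A s \<otimes> (\<one> \<oplus> (-2) \<odot> p) \<otimes> s) \<le> 1"
  proof -
    have "cnorm A (adj A s \<otimes> (\<one> \<oplus> (-2) \<odot> p) \<otimes> s)
        \<le> cnorm A (adj A s \<otimes> (\<one> \<oplus> (-2) \<odot> p)) * cnorm A s"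
      using p s as by (intro cnorm_mult) simp_all
    also have "\<dots> \<le> (cnorm A (adj A s) * cnorm A (\<one> \<oplus> (-2) \<odot> p)) * cnorm A s"
      using p s as ns by (intro mult_right_mono cnorm_mult) simp_all
    also have "\<dots> \<le> 1"
      using p s as ns np by (intro mult_le_one mult_nonneg_nonneg cnorm_nonneg) (simp_all add: cnorm_adj)
    finally show ?thesis .
  qed
  ultimately have le: "cnorm A (\<one> \<oplus> (-2) \<odot> ?q) \<le> 1"
    by simp
  have "complex_of_real (1/2) \<odot> \<one> \<oplus> (-1) \<odot> ?q = (1/2) \<odot> (\<one> \<oplus> (-2) \<odot> ?q)"
    using p s as by (simp add: smult_add_right smult_smult)
  then have "cnorm A (complex_of_real (1/2) \<odot> \<one> \<oplus> (-1) \<odot> ?q) \<le> 1/2"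
    using le p s as by (simp add: cnorm_smult)
  moreover have "adj A ?q = ?q"
    using p s as by (simp add: adj_mult adj_adj m_assoc)
  ultimately show ?thesis
    using p s as by (auto simp: positive_def intro!: exI[of _ "1/2"])
qed

end

section \<open>Permutation unitaries and their endomorphisms\<close>

lemma words_0 [simp]: "words n 0 = {[]}"
  by (auto simp: words_def)

lemma words_Suc: "words n (Suc t) = (\<Union>i\<in>{1..n}. (#) i ` words n t)"
  by (auto simp: words_def length_Suc_conv)

lemma finite_words [simp]: "finite (words n t)"
  by (induction t) (simp_all add: words_Suc)

lemma Cons_in_words [simp]: "i # \<alpha> \<in> words n (Suc t) \<longleftrightarrow> i \<in> {1..n} \<and> \<alpha> \<in> words n t"
  by (auto simp: words_def)

lemma words_2_cases:
  assumes "\<alpha> \<in> words n 2"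
  obtains a b where "\<alpha> = [a, b]" "a \<in> {1..n}" "b \<in> {1..n}"
  using assms by (auto simp: words_Suc numeral_2_eq_2)

lemma in_words_2 [simp]: "[a, b] \<in> words n 2 \<longleftrightarrow> a \<in> {1..n} \<and> b \<in> {1..n}"
  by (auto simp: words_def)

locale cuntz = cstar_algebra A for A :: "'a cstar" (structure) +
  fixes n :: nat and S :: "nat \<Rightarrow> 'a"
  assumes cuntz_family: "cuntz_family n A S"
begin

lemma S_closed [simp]: "i \<in> {1..n} \<Longrightarrow> S i \<in> carrier A"
  using cuntz_family by (simp add: cuntz_family_def)

lemma adj_S_S: "i \<in> {1..n} \<Longrightarrow> adj A (S i) \<otimes> S i = \<one>"
  using cuntz_family by (simp add: cuntz_family_def)

lemma sum_S_adj_S: "(\<Oplus>i\<in>{1..n}. S i \<otimes> adj A (S i)) = \<one>"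
  using cuntz_family by (simp add: cuntz_family_def)

declare adj_closed [simp]

lemma eq_if_eq_on_S:
  assumes "x \<in> carrier A" "y \<in> carrier A" "\<And>i. i \<in> {1..n} \<Longrightarrow> x \<otimes> S i = y \<otimes> S i"
  shows "x = y"
proof -
  have exp: "z = (\<Oplus>i\<in>{1..n}. z \<otimes> S i \<otimes> adj A (S i))" if "z \<in> carrier A" for z
  proof -
    have "z = z \<otimes> (\<Oplus>i\<in>{1..n}. S i \<otimes> adj A (S i))"
      unfolding sum_S_adj_S using that by simp
    also have "\<dots> = (\<Oplus>i\<in>{1..n}. z \<otimes> (S i \<otimes> adj A (S i)))"
      using that by (intro finsum_rdistr) auto
    also have "\<dots> = (\<Oplus>i\<in>{1..n}. z \<otimes> S i \<otimes> adj A (S i))"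
      using that by (intro finsum_cong') (auto simp: m_assoc)
    finally show ?thesis .
  qed
  have "(\<Oplus>i\<in>{1..n}. x \<otimes> S i \<otimes> adj A (S i)) = (\<Oplus>i\<in>{1..n}. y \<otimes> S i \<otimes> adj A (S i))"
    using assms by (intro finsum_cong') auto
  then show ?thesis
    using exp[OF assms(1)] exp[OF assms(2)] by simp
qed

text \<open>Conjugating the sum of the range projections by \<open>S i\<close> gives 1. The term of
  \<open>i\<close> is itself 1, so the other terms, all positive, sum to 0; the term of
  \<open>k\<close> then vanishes, and it is x*x for the product x in question.\<close>

lemma adj_S_S_orthogonal:
  assumes i: "i \<in> {1..n}" and k: "k \<in> {1..n}" and "i \<noteq> k"
  shows "adj A (S k) \<otimes> S i = \<zero>"
proof -
  define q where "q j = adj A (S i) \<otimes> (S j \<otimes> adj A (S j)) \<otimes> S i" for j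
  have pos: "positive (q j)" if "j \<in> {1..n}" for j
    unfolding q_def
  proof (rule positive_conjugate_projection)
    have "S j \<otimes> adj A (S j) \<otimes> (S j \<otimes> adj A (S j)) = S j \<otimes> (adj A (S j) \<otimes> S j) \<otimes> adj A (S j)"
      using that by (simp add: m_assoc)
    then show "S j \<otimes> adj A (S j) \<otimes> (S j \<otimes> adj A (S j)) = S j \<otimes> adj A (S j)"
      using that by (simp add: adj_S_S)
  qed (use that i in \<open>simp_all add: adj_mult adj_adj adj_S_S\<close>)
  then have cl: "q j \<in> carrier A" if "j \<in> {1..n}" for j
    using that by (simp add: positive_def)
  have "(\<Oplus>j\<in>{1..n}. q j) = \<one>"
  proof -
    have "(\<Oplus>j\<in>{1..n}. q j) = (\<Oplus>j\<in>{1..n}. adj A (S i) \<otimes> (S j \<otimes> adj A (S j))) \<otimes> S i"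
      unfolding q_def using i by (intro finsum_ldistr[symmetric]) auto
    also have "(\<Oplus>j\<in>{1..n}. adj A (S i) \<otimes> (S j \<otimes> adj A (S j)))
        = adj A (S i) \<otimes> (\<Oplus>j\<in>{1..n}. S j \<otimes> adj A (S j))"
      using i by (intro finsum_rdistr[symmetric]) auto
    finally show ?thesis
      unfolding sum_S_adj_S using i by (simp add: adj_S_S)
  qed
  moreover have "(\<Oplus>j\<in>{1..n}. q j) = q i \<oplus> (q k \<oplus> (\<Oplus>j\<in>{1..n} - {i, k}. q j))"
  proof -
    have "{1..n} = insert i (insert k ({1..n} - {i, k}))"
      using i k by auto
    then have "(\<Oplus>j\<in>{1..n}. q j) = (\<Oplus>j\<in>insert i (insert k ({1..n} - {i, k})). q j)"
      by simp
    also have "\<dots> = q i \<oplus> (\<Oplus>j\<in>insert k ({1..n} - {i, k}). q j)"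
      using cl i k \<open>i \<noteq> k\<close> by (intro finsum_insert) auto
    also have "(\<Oplus>j\<in>insert k ({1..n} - {i, k}). q j) = q k \<oplus> (\<Oplus>j\<in>{1..n} - {i, k}. q j)"
      using cl k by (intro finsum_insert) auto
    finally show ?thesis .
  qed
  moreover have "q i = \<one>"
  proof -
    have "q i = (adj A (S i) \<otimes> S i) \<otimes> (adj A (S i) \<otimes> S i)"
      using i by (simp add: q_def m_assoc)
    then show ?thesis
      using i by (simp add: adj_S_S)
  qed
  moreover define r where "r = (\<Oplus>j\<in>{1..n} - {i, k}. q j)"
  moreover have "positive r"
    unfolding r_def using pos by (intro positive_finsum) auto
  moreover from this have "r \<in> carrier A"
    by (simp add: positive_def)
  ultimately have "\<one> \<oplus> (q k \<oplus> r) = \<one> \<oplus> \<zero>" and r: "positive r" "r \<in> carrier A"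
    by simp_all
  moreover have "q k \<oplus> r = \<ominus> \<one> \<oplus> (\<one> \<oplus> (q k \<oplus> r))"
    using cl[OF k] r by (simp add: r_neg1)
  ultimately have "q k \<oplus> r = \<zero>"
    by (simp add: l_neg)
  then have "r \<oplus> q k = \<zero>"
    using cl[OF k] r by (simp add: a_comm)
  \<comment> \<open>So \<open>q k\<close> and its negative \<open>r\<close> are both
    positive.\<close>
  then have "r = (-1) \<odot> q k"
    using minus_equality[of r "q k"] cl[OF k] r by (simp add: smult_minus_one)
  then have "q k = \<zero>"
    using positive_antisym[OF pos[OF k]] r by simp
  moreover have "q k = adj A (adj A (S k) \<otimes> S i) \<otimes> (adj A (S k) \<otimes> S i)"
    using i k by (simp add: q_def adj_mult adj_adj m_assoc)
  ultimately have "(cnorm A (adj A (S k) \<otimes> S i))\<^sup>2 = 0"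
    using cstar_identity[of "adj A (S k) \<otimes> S i"] i k by simp
  then show ?thesis
    using i k cnorm_eq_zero[of "adj A (S k) \<otimes> S i"] by simp
qed

abbreviation W :: "nat list \<Rightarrow> 'a" where
  "W \<equiv> word_isometry A S"

lemma W_Nil [simp]: "W [] = \<one>"
  by (simp add: word_isometry_def)

lemma W_Cons [simp]: "W (i # \<alpha>) = S i \<otimes> W \<alpha>"
  by (simp add: word_isometry_def)

lemma W_closed [simp]: "\<alpha> \<in> words n t \<Longrightarrow> W \<alpha> \<in> carrier A"
  by (induction \<alpha> arbitrary: t) (auto simp: words_def)

lemma W_append: "\<alpha> \<in> words n t \<Longrightarrow> \<beta> \<in> words n s \<Longrightarrow> W (\<alpha> @ \<beta>) = W \<alpha> \<otimes> W \<beta>"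
proof (induction \<alpha> arbitrary: t)
  case (Cons i \<alpha>)
  then have "\<alpha> \<in> words n (length \<alpha>)" "i \<in> {1..n}"
    by (auto simp: words_def)
  with Cons.IH[OF this(1) Cons.prems(2)] Cons.prems(2) show ?case
    by (simp add: m_assoc)
qed simp

lemma adj_W_W:
  "\<alpha> \<in> words n t \<Longrightarrow> \<beta> \<in> words n t \<Longrightarrow> adj A (W \<alpha>) \<otimes> W \<beta> = (if \<alpha> = \<beta> then \<one> else \<zero>)"
proof (induction t arbitrary: \<alpha> \<beta>)
  case (Suc t)
  then obtain i \<alpha>' j \<beta>' where ab: "\<alpha> = i # \<alpha>'" "\<beta> = j # \<beta>'" "i \<in> {1..n}" "j \<in> {1..n}"
    "\<alpha>' \<in> words n t" "\<beta>' \<in> words n t"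
    by (auto simp: words_Suc)
  have "adj A (W \<alpha>) \<otimes> W \<beta> = adj A (W \<alpha>') \<otimes> (adj A (S i) \<otimes> S j) \<otimes> W \<beta>'"
    using ab by (simp add: adj_mult m_assoc)
  also have "\<dots> = (if i = j then adj A (W \<alpha>') \<otimes> W \<beta>' else \<zero>)"
    using ab by (simp add: adj_S_S adj_S_S_orthogonal)
  finally show ?case
    using Suc.IH ab by simp
qed simp

lemma eq_if_eq_on_W:
  assumes "x \<in> carrier A" "y \<in> carrier A" "\<And>\<alpha>. \<alpha> \<in> words n t \<Longrightarrow> x \<otimes> W \<alpha> = y \<otimes> W \<alpha>"
  shows "x = y"
  using assms
proof (induction t arbitrary: x y)
  case (Suc t)
  have "x \<otimes> S i = y \<otimes> S i" if "i \<in> {1..n}" for i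
  proof (rule Suc.IH)
    fix \<alpha> assume "\<alpha> \<in> words n t"
    then show "x \<otimes> S i \<otimes> W \<alpha> = y \<otimes> S i \<otimes> W \<alpha>"
      using Suc.prems(1,2) Suc.prems(3)[of "i # \<alpha>"] that by (simp add: m_assoc)
  qed (use Suc.prems(1,2) that in simp_all)
  then show ?case
    by (rule eq_if_eq_on_S[OF Suc.prems(1,2)])
qed simp

text \<open>Two maps \<open>g\<close> and \<open>h\<close>, so that the permutation unitary
  (\<open>h\<close> the identity) and its adjoint (\<open>g\<close> the identity) are both
  covered.\<close>

lemma sum_W_adj_W_mult_W:
  assumes "g \<in> words n t \<rightarrow> words n t" "h \<in> words n t \<rightarrow> words n t" "inj_on h (words n t)"
    and "\<beta> \<in> words n t"
  shows "(\<Oplus>\<alpha>\<in>words n t. W (g \<alpha>) \<otimes> adj A (W (h \<alpha>))) \<otimes> W (h \<beta>) = W (g \<beta>)"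
proof -
  have g: "W (g \<alpha>) \<in> carrier A" if "\<alpha> \<in> words n t" for \<alpha>
    using W_closed[of "g \<alpha>" t] assms(1) that by blast
  have h: "W (h \<alpha>) \<in> carrier A" if "\<alpha> \<in> words n t" for \<alpha>
    using W_closed[of "h \<alpha>" t] assms(2) that by blast
  have "(\<Oplus>\<alpha>\<in>words n t. W (g \<alpha>) \<otimes> adj A (W (h \<alpha>))) \<otimes> W (h \<beta>)
      = (\<Oplus>\<alpha>\<in>words n t. W (g \<alpha>) \<otimes> adj A (W (h \<alpha>)) \<otimes> W (h \<beta>))"
    using assms g h by (intro finsum_ldistr) auto
  also have "\<dots> = (\<Oplus>\<alpha>\<in>words n t. if \<beta> = \<alpha> then W (g \<alpha>) else \<zero>)"
  proof (rule finsum_cong')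
    fix \<alpha> assume \<alpha>: "\<alpha> \<in> words n t"
    then have "h \<alpha> = h \<beta> \<longleftrightarrow> \<beta> = \<alpha>"
      using assms by (auto simp: inj_on_def)
    moreover have "h \<alpha> \<in> words n t" "h \<beta> \<in> words n t"
      using assms \<alpha> by auto
    ultimately show "W (g \<alpha>) \<otimes> adj A (W (h \<alpha>)) \<otimes> W (h \<beta>) = (if \<beta> = \<alpha> then W (g \<alpha>) else \<zero>)"
      using g[OF \<alpha>] h[OF \<alpha>] h[OF assms(4)] by (simp add: m_assoc adj_W_W)
  qed (use g in auto)
  also have "\<dots> = W (g \<beta>)"
    using assms g by (intro add.finprod_singleton) auto
  finally show ?thesis .
qed

context
  fixes t :: nat and u :: "nat list \<Rightarrow> nat list"
  assumes u: "u permutes words n t"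
begin

lemma u_words: "u \<alpha> \<in> words n t \<longleftrightarrow> \<alpha> \<in> words n t"
  using u by (simp add: permutes_in_image)

lemma W_u_closed: "\<alpha> \<in> words n t \<Longrightarrow> W (u \<alpha>) \<in> carrier A"
  using W_closed[of "u \<alpha>" t] u_words by simp

lemma perm_unitary_closed [simp]: "perm_unitary n t A S u \<in> carrier A"
  unfolding perm_unitary_def using W_u_closed by (intro finsum_closed) auto

lemma perm_unitary_mult_W:
  "\<beta> \<in> words n t \<Longrightarrow> perm_unitary n t A S u \<otimes> W \<beta> = W (u \<beta>)"
  using sum_W_adj_W_mult_W[of u t id \<beta>] u_words by (simp add: perm_unitary_def)

lemma adj_perm_unitary_mult_W:
  assumes "\<beta> \<in> words n t"
  shows "adj A (perm_unitary n t A S u) \<otimes> W (u \<beta>) = W \<beta>"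
proof -
  \<comment> \<open>\<open>adj_add\<close> is binary, hence an induction over subsets of the
    words.\<close>
  have "adj A (\<Oplus>\<alpha>\<in>I. W (u \<alpha>) \<otimes> adj A (W \<alpha>)) = (\<Oplus>\<alpha>\<in>I. W \<alpha> \<otimes> adj A (W (u \<alpha>)))"
    if "finite I" "I \<subseteq> words n t" for I
    using that
  proof (induction I rule: finite_induct)
    case (insert \<alpha> I)
    then have \<alpha>: "W \<alpha> \<in> carrier A" "W (u \<alpha>) \<in> carrier A"
      using W_u_closed by auto
    have I: "(\<lambda>\<alpha>. W (u \<alpha>) \<otimes> adj A (W \<alpha>)) \<in> I \<rightarrow> carrier A"
      "(\<lambda>\<alpha>. W \<alpha> \<otimes> adj A (W (u \<alpha>))) \<in> I \<rightarrow> carrier A"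
      using insert.prems W_u_closed by auto
    show ?case
      using insert \<alpha> I by (simp add: adj_add adj_mult adj_adj)
  next
    case empty
    show ?case
      using adj_smult[of \<zero> 0] by simp
  qed
  then have "adj A (perm_unitary n t A S u) = (\<Oplus>\<alpha>\<in>words n t. W \<alpha> \<otimes> adj A (W (u \<alpha>)))"
    by (simp add: perm_unitary_def)
  then show ?thesis
    using sum_W_adj_W_mult_W[of id t u \<beta>] u_words assms permutes_inj_on[OF u] by simp
qed

lemma perm_unitary_unitary: "perm_unitary n t A S u \<in> unitaries A"
proof -
  have "adj A (perm_unitary n t A S u) \<otimes> perm_unitary n t A S u = \<one>"
  proof (rule eq_if_eq_on_W)
    fix \<beta> assume "\<beta> \<in> words n t"
    then show "adj A (perm_unitary n t A S u) \<otimes> perm_unitary n t A S u \<otimes> W \<beta> = \<one> \<otimes> W \<beta>"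
      by (simp add: m_assoc perm_unitary_mult_W adj_perm_unitary_mult_W)
  qed simp_all
  moreover have "perm_unitary n t A S u \<otimes> adj A (perm_unitary n t A S u) = \<one>"
  proof (rule eq_if_eq_on_W)
    fix \<beta> assume \<beta>: "\<beta> \<in> words n t"
    then obtain \<gamma> where "\<gamma> \<in> words n t" "\<beta> = u \<gamma>"
      using permutes_image[OF u] by blast
    then show "perm_unitary n t A S u \<otimes> adj A (perm_unitary n t A S u) \<otimes> W \<beta> = \<one> \<otimes> W \<beta>"
      using \<beta> by (simp add: m_assoc perm_unitary_mult_W adj_perm_unitary_mult_W)
  qed simp_all
  ultimately show ?thesis
    by (simp add: unitaries_def)
qed

end

lemma perm_unitary_comp:
  assumes u: "u permutes words n t" and v: "v permutes words n t"
  shows "perm_unitary n t A S (u \<circ> v) = perm_unitary n t A S u \<otimes> perm_unitary n t A S v"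
proof (rule eq_if_eq_on_W)
  have uv: "u \<circ> v permutes words n t"
    using u v permutes_compose by blast
  show "perm_unitary n t A S (u \<circ> v) \<in> carrier A"
    by (rule perm_unitary_closed[OF uv])
  show "perm_unitary n t A S u \<otimes> perm_unitary n t A S v \<in> carrier A"
    by (simp add: perm_unitary_closed[OF u] perm_unitary_closed[OF v])
  fix \<beta> assume \<beta>: "\<beta> \<in> words n t"
  then have "v \<beta> \<in> words n t"
    using u_words[OF v] by simp
  then show "perm_unitary n t A S (u \<circ> v) \<otimes> W \<beta> = perm_unitary n t A S u \<otimes> perm_unitary n t A S v \<otimes> W \<beta>"
    using \<beta> by (simp add: m_assoc perm_unitary_closed[OF u] perm_unitary_closed[OF v]
        perm_unitary_mult_W[OF u] perm_unitary_mult_W[OF v] perm_unitary_mult_W[OF uv])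
qed

lemma perm_unitary_id: "perm_unitary n t A S id = \<one>"
proof (rule eq_if_eq_on_W[where t = t])
  fix \<alpha> assume "\<alpha> \<in> words n t"
  then show "perm_unitary n t A S id \<otimes> W \<alpha> = \<one> \<otimes> W \<alpha>"
    using perm_unitary_mult_W[OF permutes_id] by simp
qed (simp_all only: perm_unitary_closed[OF permutes_id] one_closed)

lemma cuntz_family_unitary_mult:
  assumes w: "w \<in> unitaries A"
  shows "cuntz_family n A (\<lambda>i. w \<otimes> S i)"
proof -
  have wc: "w \<in> carrier A" "adj A w \<otimes> w = \<one>" "w \<otimes> adj A w = \<one>"
    using w by (simp_all add: unitaries_def)
  have "adj A (w \<otimes> S i) \<otimes> (w \<otimes> S i) = \<one>" if "i \<in> {1..n}" for i
  proof -
    have "adj A (w \<otimes> S i) \<otimes> (w \<otimes> S i) = adj A (S i) \<otimes> (adj A w \<otimes> w) \<otimes> S i"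
      using wc(1) that by (simp add: adj_mult m_assoc)
    then show ?thesis
      using that wc by (simp add: adj_S_S)
  qed
  moreover have "(\<Oplus>i\<in>{1..n}. w \<otimes> S i \<otimes> adj A (w \<otimes> S i)) = \<one>"
  proof -
    have "(\<Oplus>i\<in>{1..n}. w \<otimes> S i \<otimes> adj A (w \<otimes> S i))
        = (\<Oplus>i\<in>{1..n}. w \<otimes> (S i \<otimes> adj A (S i)) \<otimes> adj A w)"
      using wc(1) by (intro finsum_cong') (auto simp: adj_mult m_assoc)
    also have "\<dots> = (\<Oplus>i\<in>{1..n}. w \<otimes> (S i \<otimes> adj A (S i))) \<otimes> adj A w"
      using wc(1) by (intro finsum_ldistr[symmetric]) auto
    also have "(\<Oplus>i\<in>{1..n}. w \<otimes> (S i \<otimes> adj A (S i))) = w \<otimes> (\<Oplus>i\<in>{1..n}. S i \<otimes> adj A (S i))"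
      using wc(1) by (intro finsum_rdistr[symmetric]) auto
    finally show ?thesis
      unfolding sum_S_adj_S using wc by simp
  qed
  ultimately show ?thesis
    using wc(1) by (simp add: cuntz_family_def)
qed

end

section \<open>Automorphisms, inner automorphisms and outer classes\<close>

context cstar_algebra
begin

lemma star_hom_compose:
  assumes "f \<in> star_hom A A" "g \<in> star_hom A A"
  shows "compose (carrier A) g f \<in> star_hom A A"
proof -
  have f: "f \<in> ring_hom A A" "\<And>x. x \<in> carrier A \<Longrightarrow> f (adj A x) = adj A (f x)"
    "\<And>x c. x \<in> carrier A \<Longrightarrow> f (c \<odot> x) = c \<odot> f x"
    and g: "g \<in> ring_hom A A" "\<And>x. x \<in> carrier A \<Longrightarrow> g (adj A x) = adj A (g x)"
    "\<And>x c. x \<in> carrier A \<Longrightarrow> g (c \<odot> x) = c \<odot> g x"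
    using assms by (auto simp: star_hom_def)
  note fs = ring_hom_closed[OF f(1)] ring_hom_mult[OF f(1)] ring_hom_add[OF f(1)] ring_hom_one[OF f(1)]
  note gs = ring_hom_closed[OF g(1)] ring_hom_mult[OF g(1)] ring_hom_add[OF g(1)] ring_hom_one[OF g(1)]
  have "compose (carrier A) g f \<in> ring_hom A A"
    by (rule ring_hom_memI) (simp_all add: compose_def fs gs)
  then show ?thesis
    by (simp add: star_hom_def compose_def f g fs adj_closed)
qed

lemma star_hom_inverse:
  assumes "f \<in> star_hom A A" "f \<in> Bij (carrier A)"
  shows "(\<lambda>x\<in>carrier A. inv_into (carrier A) f x) \<in> star_hom A A"
proof -
  let ?g = "\<lambda>x\<in>carrier A. inv_into (carrier A) f x"
  have f: "f \<in> ring_hom A A" "\<And>x. x \<in> carrier A \<Longrightarrow> f (adj A x) = adj A (f x)"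
    "\<And>x c. x \<in> carrier A \<Longrightarrow> f (c \<odot> x) = c \<odot> f x"
    using assms by (auto simp: star_hom_def)
  note fs = ring_hom_closed[OF f(1)] ring_hom_mult[OF f(1)] ring_hom_add[OF f(1)] ring_hom_one[OF f(1)]
  have bij: "bij_betw f (carrier A) (carrier A)"
    using assms(2) by (simp add: Bij_def)
  have g: "?g x \<in> carrier A" "f (?g x) = x" if "x \<in> carrier A" for x
    using that bij by (auto simp: bij_betw_def f_inv_into_f inv_into_into)
  have eqI: "?g y = z" if "z \<in> carrier A" "f z = y" for y z
    using that fs(1)[of z] bij by (auto simp: bij_betw_def)
  have "?g \<in> ring_hom A A"
    by (rule ring_hom_memI) (simp_all only: g fs eqI m_closed a_closed one_closed)
  moreover have "?g (adj A x) = adj A (?g x)" "?g (c \<odot> x) = c \<odot> ?g x" if "x \<in> carrier A" for x c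
    using g[OF that] f(2,3)[OF g(1)[OF that]] by (auto intro!: eqI adj_closed smult_carrier simp del: restrict_apply)
  ultimately show ?thesis
    by (simp add: star_hom_def)
qed

lemma star_hom_identity: "(\<lambda>x\<in>carrier A. x) \<in> star_hom A A"
  unfolding star_hom_def by (auto intro!: ring_hom_memI simp: adj_closed)

lemma carrier_Aut: "carrier (Aut A) = star_hom A A \<inter> Bij (carrier A)"
  by (simp add: Aut_def)

lemma mult_Aut:
  "f \<in> Bij (carrier A) \<Longrightarrow> g \<in> Bij (carrier A) \<Longrightarrow> f \<otimes>\<^bsub>Aut A\<^esub> g = compose (carrier A) f g"
  by (simp add: Aut_def BijGroup_def)

lemma one_Aut: "\<one>\<^bsub>Aut A\<^esub> = (\<lambda>x\<in>carrier A. x)"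
  by (simp add: Aut_def BijGroup_def)

lemma group_Aut: "group (Aut A)"
proof -
  interpret B: group "BijGroup (carrier A)"
    by (rule group_BijGroup)
  have "subgroup (star_hom A A \<inter> Bij (carrier A)) (BijGroup (carrier A))"
  proof
    fix f assume f: "f \<in> star_hom A A \<inter> Bij (carrier A)"
    then have "inv\<^bsub>BijGroup (carrier A)\<^esub> f = (\<lambda>x\<in>carrier A. inv_into (carrier A) f x)"
      by (simp add: inv_BijGroup)
    then show "inv\<^bsub>BijGroup (carrier A)\<^esub> f \<in> star_hom A A \<inter> Bij (carrier A)"
      using f star_hom_inverse restrict_inv_into_Bij by auto
  qed (auto simp: BijGroup_def star_hom_identity id_Bij compose_Bij star_hom_compose)
  then show ?thesis
    unfolding Aut_def by (rule B.subgroup_imp_group)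
qed

lemma Inn_subset_Bij: "Inn A \<subseteq> Bij (carrier A)"
proof
  fix f assume "f \<in> Inn A"
  then obtain w where w: "w \<in> carrier A" "adj A w \<otimes> w = \<one>" "w \<otimes> adj A w = \<one>"
    "f = (\<lambda>x\<in>carrier A. w \<otimes> x \<otimes> adj A w)"
    by (auto simp: Inn_def unitaries_def)
  have "adj A w \<otimes> (w \<otimes> x \<otimes> adj A w) \<otimes> w = x" "w \<otimes> (adj A w \<otimes> x \<otimes> w) \<otimes> adj A w = x"
    if "x \<in> carrier A" for x
  proof -
    have "adj A w \<otimes> (w \<otimes> x \<otimes> adj A w) \<otimes> w = (adj A w \<otimes> w) \<otimes> x \<otimes> (adj A w \<otimes> w)"
      "w \<otimes> (adj A w \<otimes> x \<otimes> w) \<otimes> adj A w = (w \<otimes> adj A w) \<otimes> x \<otimes> (w \<otimes> adj A w)"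
      using w(1) that by (simp_all add: m_assoc adj_closed)
    then show "adj A w \<otimes> (w \<otimes> x \<otimes> adj A w) \<otimes> w = x" "w \<otimes> (adj A w \<otimes> x \<otimes> w) \<otimes> adj A w = x"
      using w that by simp_all
  qed
  then have "bij_betw f (carrier A) (carrier A)"
    using w(1) by (intro bij_betwI[where g = "\<lambda>x. adj A w \<otimes> x \<otimes> w"]) (auto simp: w(4) adj_closed)
  then show "f \<in> Bij (carrier A)"
    by (simp add: Bij_def w(4))
qed

lemma one_unitary: "\<one> \<in> unitaries A"
  by (simp add: unitaries_def)

lemma identity_in_Inn: "\<one>\<^bsub>Aut A\<^esub> \<in> Inn A"
proof -
  have "\<one>\<^bsub>Aut A\<^esub> = (\<lambda>x\<in>carrier A. \<one> \<otimes> x \<otimes> adj A \<one>)"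
    by (auto simp: one_Aut)
  then show ?thesis
    unfolding Inn_def by (rule image_eqI[OF _ one_unitary])
qed

lemma out_proj_one: "out_proj A \<one>\<^bsub>Aut A\<^esub> = Inn A"
proof -
  interpret Aut: group "Aut A"
    by (rule group_Aut)
  have "f \<otimes>\<^bsub>Aut A\<^esub> \<one>\<^bsub>Aut A\<^esub> = f" if "f \<in> Inn A" for f
  proof -
    have "f \<in> Bij (carrier A)"
      using that Inn_subset_Bij by auto
    moreover have "\<one>\<^bsub>Aut A\<^esub> \<in> Bij (carrier A)"
      using identity_in_Inn Inn_subset_Bij by auto
    ultimately show ?thesis
      by (auto simp: mult_Aut one_Aut compose_def Bij_def extensional_def)
  qed
  then show ?thesis
    by (auto simp: out_proj_def r_coset_def)
qed

text \<open>The identity is inner, so \<open>f\<close> lies in its own coset and therefore in that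
  of \<open>g\<close>.\<close>

lemma out_proj_eqD:
  assumes f: "f \<in> carrier (Aut A)" and g: "g \<in> carrier (Aut A)"
    and eq: "out_proj A f = out_proj A g"
  obtains w where "w \<in> unitaries A" "\<And>x. x \<in> carrier A \<Longrightarrow> f x = w \<otimes> g x \<otimes> adj A w"
proof -
  interpret Aut: group "Aut A"
    by (rule group_Aut)
  have "\<one>\<^bsub>Aut A\<^esub> \<otimes>\<^bsub>Aut A\<^esub> f \<in> out_proj A f"
    using identity_in_Inn unfolding out_proj_def r_coset_def by blast
  then have "f \<in> out_proj A g"
    using f eq by simp
  then obtain h where h: "h \<in> Inn A" "f = h \<otimes>\<^bsub>Aut A\<^esub> g"
    by (auto simp: out_proj_def r_coset_def)
  then obtain w where w: "w \<in> unitaries A" "h = (\<lambda>x\<in>carrier A. w \<otimes> x \<otimes> adj A w)"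
    by (auto simp: Inn_def)
  show thesis
  proof (rule that[OF w(1)])
    fix x assume x: "x \<in> carrier A"
    have "g \<in> Bij (carrier A)" "g x \<in> carrier A"
      using g x by (auto simp: carrier_Aut Bij_def bij_betw_def)
    moreover have "h \<in> Bij (carrier A)"
      using h(1) Inn_subset_Bij by auto
    ultimately show "f x = w \<otimes> g x \<otimes> adj A w"
      using x by (simp add: h(2) mult_Aut compose_def) (simp add: w(2))
  qed
qed

end

section \<open>Composition of permutation endomorphisms\<close>

definition shifts_commute ::
    "nat \<Rightarrow> (nat list \<Rightarrow> nat list) \<Rightarrow> (nat list \<Rightarrow> nat list) \<Rightarrow> bool" where
  "shifts_commute n u v \<longleftrightarrow> (\<forall>a\<in>{1..n}. \<forall>b\<in>{1..n}. \<forall>c\<in>{1..n}.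
     v [a, u [b, c] ! 0] @ [u [b, c] ! 1] = v [a, b] ! 0 # u [v [a, b] ! 1, c])"

locale universal_cuntz = cuntz A n S for A :: "'a cstar" (structure) and n :: nat and S :: "nat \<Rightarrow> 'a" +
  assumes cuntz_algebra: "cuntz_algebra n A S"

lemma universal_cuntzI: "cuntz_algebra n A S \<Longrightarrow> universal_cuntz A n S"
  by (simp add: universal_cuntz_def universal_cuntz_axioms_def cuntz_def cuntz_axioms_def cuntz_algebra_def)

context universal_cuntz
begin

lemma ex1_cuntz_endo:
  assumes "w \<in> unitaries A"
  shows "\<exists>!f. f \<in> star_hom A A \<inter> extensional (carrier A) \<and> (\<forall>i\<in>{1..n}. f (S i) = w \<otimes> S i)"
proof -
  have "universal_cuntz_family TYPE('a) n A S"
    using cuntz_algebra by (simp add: cuntz_algebra_def)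
  then show ?thesis
    unfolding universal_cuntz_family_def
    using cuntz_family_unitary_mult[OF assms] cstar_algebra_axioms by blast
qed

lemma cuntz_endo:
  assumes "w \<in> unitaries A"
  shows "cuntz_endo n A S w \<in> star_hom A A" "cuntz_endo n A S w \<in> extensional (carrier A)"
    "i \<in> {1..n} \<Longrightarrow> cuntz_endo n A S w (S i) = w \<otimes> S i"
  using theI'[OF ex1_cuntz_endo[OF assms]] unfolding cuntz_endo_def by auto

lemma cuntz_endo_eqI:
  assumes "w \<in> unitaries A" "f \<in> star_hom A A" "f \<in> extensional (carrier A)"
    "\<And>i. i \<in> {1..n} \<Longrightarrow> f (S i) = w \<otimes> S i"
  shows "cuntz_endo n A S w = f"
  unfolding cuntz_endo_def using assms by (intro the1_equality[OF ex1_cuntz_endo]) auto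

lemmas perm_endo =
  cuntz_endo[OF perm_unitary_unitary, folded perm_endo_def]

lemma perm_endo_id: "perm_endo n t A S id = \<one>\<^bsub>Aut A\<^esub>"
  unfolding perm_endo_def one_Aut
  by (rule cuntz_endo_eqI[OF perm_unitary_unitary[OF permutes_id] star_hom_identity])
     (simp_all add: perm_unitary_id)

text \<open>Let U and V be the unitaries of \<open>u\<close> and \<open>v\<close>, and let \<phi>(x)
  be the sum of all \<open>S a \<otimes> x \<otimes> adj A (S a)\<close>, so that \<phi>(U) is the
  operator of 1 \<otimes> u. On V, a combination of words of length two and their adjoints,
  \<lambda>_u is conjugation by U \<phi>(U). As \<phi>(U) commutes with V, only conjugation by U
  remains, and \<lambda>_u(V S_i) = (U V adj U)(U S_i) = U V S_i. The proof carries this out letter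
  by letter.\<close>

lemma perm_endo_comp:
  assumes u: "u permutes words n 2" and v: "v permutes words n 2"
    and comm: "shifts_commute n u v"
  shows "compose (carrier A) (perm_endo n 2 A S u) (perm_endo n 2 A S v) = perm_endo n 2 A S (u \<circ> v)"
    (is "?f = _")
proof -
  let ?U = "perm_unitary n 2 A S u" and ?V = "perm_unitary n 2 A S v" and ?g = "perm_endo n 2 A S u"
  note [simp] = perm_unitary_closed[OF u] perm_unitary_closed[OF v]
  have uv: "u \<circ> v permutes words n 2"
    using u v permutes_compose by blast
  have g: "?g \<in> ring_hom A A"
    using perm_endo(1)[OF u] by (simp add: star_hom_def)
  \<comment> \<open>The images \<open>?U \<otimes> S j\<close> of the generators under
    \<open>?g\<close> are again a Cuntz family, so equality can be tested by multiplying with them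
    on the right.\<close>
  interpret T: cuntz A n "\<lambda>i. ?U \<otimes> S i"
    by unfold_locales (rule cuntz_family_unitary_mult[OF perm_unitary_unitary[OF u]])
  have "?f (S i) = perm_unitary n 2 A S (u \<circ> v) \<otimes> S i" if i: "i \<in> {1..n}" for i
  proof -
    have "?g (?V \<otimes> S i) = perm_unitary n 2 A S (u \<circ> v) \<otimes> S i"
    proof (rule T.eq_if_eq_on_S)
      fix j assume j: "j \<in> {1..n}"
      have "v [i, j] \<in> words n 2"
        using u_words[OF v] i j by simp
      then obtain a b where ab: "v [i, j] = [a, b]" "a \<in> {1..n}" "b \<in> {1..n}"
        by (rule words_2_cases)
      have "?g (?V \<otimes> S i) \<otimes> (?U \<otimes> S j) = ?g (?V \<otimes> W [i, j])"
        using i j perm_endo(3)[OF u j] ring_hom_mult[OF g, of "?V \<otimes> S i" "S j"] by (simp add: m_assoc)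
      also have "?V \<otimes> W [i, j] = S a \<otimes> S b"
        using perm_unitary_mult_W[OF v, of "[i, j]"] i j ab by simp
      also have "?g (S a \<otimes> S b) = ?U \<otimes> (S a \<otimes> (?U \<otimes> S b))"
        using ab perm_endo(3)[OF u] ring_hom_mult[OF g, of "S a" "S b"] by (simp add: m_assoc)
      \<comment> \<open>This is where the commutation enters; testing against a further generator
        \<open>S c\<close> produces the words of length three.\<close>
      also have "S a \<otimes> (?U \<otimes> S b) = ?V \<otimes> (S i \<otimes> (?U \<otimes> S j))"
      proof (rule eq_if_eq_on_S)
        fix c assume c: "c \<in> {1..n}"
        have "u [j, c] \<in> words n 2"
          using u_words[OF u] j c by simp
        then obtain j' c' where jc: "u [j, c] = [j', c']" "j' \<in> {1..n}" "c' \<in> {1..n}"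
          by (rule words_2_cases)
        have ubc: "u [b, c] \<in> words n 2" and vij': "v [i, j'] \<in> words n 2"
          using u_words[OF u] u_words[OF v] i ab c jc by simp_all
        have "?V \<otimes> (S i \<otimes> (?U \<otimes> S j)) \<otimes> S c = ?V \<otimes> (S i \<otimes> (?U \<otimes> W [j, c]))"
          using i j c by (simp add: m_assoc)
        also have "\<dots> = ?V \<otimes> W [i, j'] \<otimes> S c'"
          using perm_unitary_mult_W[OF u, of "[j, c]"] i j c jc by (simp add: m_assoc)
        also have "\<dots> = W (v [i, j'] @ [c'])"
          using perm_unitary_mult_W[OF v, of "[i, j']"] i jc W_append[OF vij', of "[c']" 1]
          by (simp add: words_def)
        also have "v [i, j'] @ [c'] = a # u [b, c]"
          using comm i j c jc ab unfolding shifts_commute_def by fastforce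
        also have "W (a # u [b, c]) = S a \<otimes> (?U \<otimes> W [b, c])"
          using perm_unitary_mult_W[OF u, of "[b, c]"] ab c by simp
        also have "\<dots> = S a \<otimes> (?U \<otimes> S b) \<otimes> S c"
          using ab c by (simp add: m_assoc)
        finally show "S a \<otimes> (?U \<otimes> S b) \<otimes> S c = ?V \<otimes> (S i \<otimes> (?U \<otimes> S j)) \<otimes> S c"
          by simp
      qed (use i j ab in simp_all)
      also have "?U \<otimes> (?V \<otimes> (S i \<otimes> (?U \<otimes> S j))) = perm_unitary n 2 A S (u \<circ> v) \<otimes> S i \<otimes> (?U \<otimes> S j)"
        using i j by (simp add: perm_unitary_comp[OF u v] m_assoc)
      finally show "?g (?V \<otimes> S i) \<otimes> (?U \<otimes> S j) = perm_unitary n 2 A S (u \<circ> v) \<otimes> S i \<otimes> (?U \<otimes> S j)" .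
    qed (use i perm_unitary_closed[OF uv] ring_hom_closed[OF g] in simp_all)
    then show ?thesis
      using i perm_endo(3)[OF v i] by (simp add: compose_def)
  qed
  then show ?thesis
    unfolding perm_endo_def[of n 2 A S "u \<circ> v"]
    by (intro cuntz_endo_eqI[OF perm_unitary_unitary[OF uv], symmetric] star_hom_compose
        perm_endo(1)[OF u] perm_endo(1)[OF v]) (simp_all add: compose_def)
qed

lemma perm_endo_in_Aut:
  assumes u: "u permutes words n 2" and v: "v permutes words n 2"
    and "u \<circ> v = id" "v \<circ> u = id" "shifts_commute n u v" "shifts_commute n v u"
  shows "perm_endo n 2 A S u \<in> carrier (Aut A)"
proof -
  let ?f = "perm_endo n 2 A S u" and ?g = "perm_endo n 2 A S v"
  have cl: "x \<in> carrier A \<Longrightarrow> ?f x \<in> carrier A" "x \<in> carrier A \<Longrightarrow> ?g x \<in> carrier A" for x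
    using perm_endo(1)[OF u] perm_endo(1)[OF v] by (auto simp: star_hom_def ring_hom_closed)
  have "compose (carrier A) ?f ?g = (\<lambda>x\<in>carrier A. x)" "compose (carrier A) ?g ?f = (\<lambda>x\<in>carrier A. x)"
    using perm_endo_comp[OF u v] perm_endo_comp[OF v u] assms perm_endo_id by (simp_all add: one_Aut)
  then have "?f (?g x) = x" "?g (?f x) = x" if "x \<in> carrier A" for x
    using that by (metis compose_eq restrict_apply')+
  then have "bij_betw ?f (carrier A) (carrier A)"
    using cl by (intro bij_betwI[where g = ?g]) auto
  then show ?thesis
    using perm_endo(1,2)[OF u] by (simp add: carrier_Aut Bij_def)
qed

end

section \<open>Branching systems twisted by a permutation\<close>

context branching
begin

context
  fixes u :: "nat list \<Rightarrow> nat list"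
  assumes u: "u permutes words n 2"
begin

text \<open>Forced by the operator U S_i: the basis vector at \<open>m\<close> is S_a of the one at
  \<open>shift m\<close>, with a the label of \<open>m\<close>, and U S_i S_a = S_p S_q if
  \<open>u\<close> sends [i, a] to [p, q].\<close>

definition twist_pre :: "nat \<Rightarrow> nat \<Rightarrow> nat" where
  "twist_pre i m = pre (u [i, lab m] ! 0) (pre (u [i, lab m] ! 1) (shift m))"

text \<open>Inverts \<open>u\<close> on the first two letters of \<open>m\<close>: the code [p, q]
  means that \<open>m\<close> arises by the twisted letter p from a point whose original label is
  q.\<close>

definition twist_code :: "nat \<Rightarrow> nat list" where
  "twist_code m = inv_into UNIV u [lab m, lab (shift m)]"

definition twist_lab :: "nat \<Rightarrow> nat" where
  "twist_lab m = twist_code m ! 0"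

definition twist_shift :: "nat \<Rightarrow> nat" where
  "twist_shift m = pre (twist_code m ! 1) (shift (shift m))"

lemma u_apply_cases:
  assumes "i \<in> {1..n}" "j \<in> {1..n}"
  obtains a b where "u [i, j] = [a, b]" "a \<in> {1..n}" "b \<in> {1..n}"
  using assms permutes_in_image[OF u, of "[i, j]"] words_2_cases[of "u [i, j]" n] by auto

lemma twist_code_cases:
  obtains p q where "twist_code m = [p, q]" "u [p, q] = [lab m, lab (shift m)]"
    "p \<in> {1..n}" "q \<in> {1..n}"
proof -
  have "twist_code m \<in> words n 2"
    using permutes_in_image[OF permutes_inv[OF u], of "[lab m, lab (shift m)]"]
    using lab_range[of m] lab_range[of "shift m"] unfolding twist_code_def by simp
  moreover have "u (twist_code m) = [lab m, lab (shift m)]"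
    by (simp add: twist_code_def permutes_inverses[OF u])
  ultimately show thesis
    using that words_2_cases by metis
qed

lemma twist_code_eq: "u [p, q] = [lab m, lab (shift m)] \<Longrightarrow> twist_code m = [p, q]"
  by (metis twist_code_def permutes_inverses(2)[OF u])

lemma branching_twist: "branching n twist_pre twist_lab twist_shift"
proof
  fix m i
  obtain p q where pq: "twist_code m = [p, q]" "u [p, q] = [lab m, lab (shift m)]"
    "p \<in> {1..n}" "q \<in> {1..n}"
    by (rule twist_code_cases)
  show "twist_lab m \<in> {1..n}"
    using pq by (simp add: twist_lab_def)
  show "twist_pre (twist_lab m) (twist_shift m) = m"
    using pq by (simp add: twist_pre_def twist_lab_def twist_shift_def lab_pre shift_pre pre_lab_shift)
  assume i: "i \<in> {1..n}"
  obtain a b where ab: "u [i, lab m] = [a, b]" "a \<in> {1..n}" "b \<in> {1..n}"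
    using u_apply_cases[OF i lab_range] by blast
  have "twist_code (twist_pre i m) = [i, lab m]"
    using ab by (intro twist_code_eq) (simp add: twist_pre_def lab_pre shift_pre)
  then show "twist_lab (twist_pre i m) = i" "twist_shift (twist_pre i m) = m"
    using ab by (simp_all add: twist_lab_def twist_shift_def twist_pre_def lab_pre shift_pre pre_lab_shift)
qed

lemma twist_isom_compose_isom:
  assumes "i \<in> {1..n}" "j \<in> {1..n}" "u [i, j] = [a, b]"
  shows "branching.isom twist_lab twist_shift i o\<^sub>L isom j = isom a o\<^sub>L isom b"
proof (intro blinfun_eqI ell2_eqI)
  interpret T: branching n twist_pre twist_lab twist_shift
    by (rule branching_twist)
  fix x m
  obtain p q where pq: "twist_code m = [p, q]" "u [p, q] = [lab m, lab (shift m)]"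
    "p \<in> {1..n}" "q \<in> {1..n}"
    by (rule twist_code_cases)
  have "p = i \<and> q = j \<longleftrightarrow> lab m = a \<and> lab (shift m) = b"
    using pq assms permutes_inj[OF u] by (auto dest!: injD[of u "[p, q]" "[i, j]"])
  moreover have "twist_lab m = p" "lab (twist_shift m) = q" "shift (twist_shift m) = shift (shift m)"
    using pq by (simp_all add: twist_lab_def twist_shift_def lab_pre shift_pre)
  ultimately show "coord ((T.isom i o\<^sub>L isom j) x) m = coord ((isom a o\<^sub>L isom b) x) m"
    by (auto simp: T.coord_isom coord_isom)
qed

lemma representation_perm_unitary_mult:
  fixes A (structure)
  assumes alg: "cuntz_algebra n A S" and i: "i \<in> {1..n}"
    and \<rho>: "\<And>x y. x \<in> carrier A \<Longrightarrow> y \<in> carrier A \<Longrightarrow> \<rho> (x \<otimes> y) = \<rho> x o\<^sub>L \<rho> y"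
      "\<And>i. i \<in> {1..n} \<Longrightarrow> \<rho> (S i) = isom i"
  shows "\<rho> (perm_unitary n 2 A S u \<otimes> S i) = branching.isom twist_lab twist_shift i"
proof (rule eq_if_eq_on_isoms)
  interpret universal_cuntz A n S
    using alg by (rule universal_cuntzI)
  note [simp] = perm_unitary_closed[OF u]
  fix j assume j: "j \<in> {1..n}"
  obtain a b where ab: "u [i, j] = [a, b]" "a \<in> {1..n}" "b \<in> {1..n}"
    using u_apply_cases[OF i j] by blast
  have "\<rho> (perm_unitary n 2 A S u \<otimes> S i) o\<^sub>L isom j = \<rho> (perm_unitary n 2 A S u \<otimes> W [i, j])"
    using i j by (simp add: \<rho> m_assoc[symmetric])
  also have "\<dots> = isom a o\<^sub>L isom b"
    using perm_unitary_mult_W[OF u, of "[i, j]"] i j ab by (simp add: \<rho>)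
  finally show "\<rho> (perm_unitary n 2 A S u \<otimes> S i) o\<^sub>L isom j
      = branching.isom twist_lab twist_shift i o\<^sub>L isom j"
    using twist_isom_compose_isom[OF i j ab(1)] by simp
qed

end

section \<open>Fixed vectors and periodic points\<close>

definition basis :: "nat \<Rightarrow> ell2" where
  "basis m = of_coord (\<lambda>k. if k = m then 1 else 0)"

lemma coord_basis: "coord (basis m) k = (if k = m then 1 else 0)"
proof -
  have "(\<Sum>k\<in>F. (norm (if k = m then 1 else 0 :: complex))\<^sup>2) \<le> 1\<^sup>2" if "finite F" for F
  proof -
    have "(\<Sum>k\<in>F. (norm (if k = m then 1 else 0 :: complex))\<^sup>2) = (\<Sum>k\<in>F. if k = m then 1 else 0)"
      by (rule sum.cong) simp_all
    then show ?thesis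
      using that by simp
  qed
  then have "(\<lambda>k. (norm (if k = m then 1 else 0 :: complex))\<^sup>2) summable_on UNIV"
    by (rule square_summable_bounded(1)) simp_all
  then show ?thesis
    unfolding basis_def by (simp add: coord_of_coord)
qed

lemma isom_basis: "i \<in> {1..n} \<Longrightarrow> isom i (basis m) = basis (pre i m)"
  by (rule ell2_eqI) (auto simp: coord_isom coord_basis lab_pre shift_pre pre_lab_shift)

definition path :: "nat list \<Rightarrow> nat \<Rightarrow> nat" where
  "path \<alpha> m = foldr pre \<alpha> m"

definition isom_word :: "nat list \<Rightarrow> ell2 \<Rightarrow> ell2" where
  "isom_word \<alpha> x = foldr (\<lambda>i. isom i) \<alpha> x"

lemma isom_word_basis: "set \<alpha> \<subseteq> {1..n} \<Longrightarrow> isom_word \<alpha> (basis m) = basis (path \<alpha> m)"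
  by (induction \<alpha>) (auto simp: isom_word_def path_def isom_basis)

lemma coord_isom_word_path:
  "set \<alpha> \<subseteq> {1..n} \<Longrightarrow> coord (isom_word \<alpha> x) (path \<alpha> m) = coord x m"
  by (induction \<alpha>) (auto simp: isom_word_def path_def coord_isom lab_pre shift_pre)

lemma inj_path: "set \<alpha> \<subseteq> {1..n} \<Longrightarrow> inj (path \<alpha>)"
proof (induction \<alpha>)
  case (Cons i \<alpha>)
  then have "inj (pre i \<circ> path \<alpha>)"
    by (intro inj_compose inj_pre) auto
  then show ?case
    by (simp add: path_def comp_def)
qed (simp add: path_def inj_on_def)

text \<open>A fixed vector has the same coordinate all along an orbit, so a fixed vector other than 0 is
  supported on finite orbits.\<close>

lemma periodic_point_if_fixed_vector:
  assumes \<alpha>: "set \<alpha> \<subseteq> {1..n}" and y: "isom_word \<alpha> y = y" "y \<noteq> 0"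
  obtains m N where "0 < N" "(path \<alpha> ^^ N) m = m"
proof (rule ccontr)
  assume "\<not> thesis"
  then have np: "(path \<alpha> ^^ N) m \<noteq> m" if "0 < N" for N m
    using \<open>\<not> thesis\<close> that \<open>\<And>N m. 0 < N \<Longrightarrow> (path \<alpha> ^^ N) m = m \<Longrightarrow> thesis\<close> by blast
  obtain m where m: "coord y m \<noteq> 0"
    using y(2) ell2_eqI[of y 0] by auto
  let ?o = "\<lambda>N. (path \<alpha> ^^ N) m"
  have coord: "coord y (?o N) = coord y m" for N
  proof (induction N)
    case (Suc N)
    then show ?case
      using coord_isom_word_path[OF \<alpha>, of y "?o N"] y(1) by simp
  qed simp
  have "inj ?o"
  proof (rule linorder_injI)
    fix K L :: nat assume "K < L"
    then have "?o L = (path \<alpha> ^^ K) ((path \<alpha> ^^ (L - K)) m)"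
      by (metis funpow_add less_imp_le le_add_diff_inverse comp_apply)
    moreover have "(path \<alpha> ^^ (L - K)) m \<noteq> m"
      using np \<open>K < L\<close> by simp
    ultimately show "?o K \<noteq> ?o L"
      using inj_fn[OF inj_path[OF \<alpha>], of K] by (metis injD)
  qed
  have "real M * (norm (coord y m))\<^sup>2 \<le> (norm y)\<^sup>2" for M
  proof -
    have "(\<Sum>k\<in>?o ` {..<M}. (norm (coord y k))\<^sup>2) = (\<Sum>N<M. (norm (coord y (?o N)))\<^sup>2)"
      using inj_on_subset[OF \<open>inj ?o\<close>] by (subst sum.reindex) auto
    then show ?thesis
      using sum_coord_le[of "?o ` {..<M}" y] by (simp add: coord)
  qed
  moreover obtain M where "(norm y)\<^sup>2 / (norm (coord y m))\<^sup>2 < real M"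
    using reals_Archimedean2 by blast
  ultimately show False
    using m by (simp add: divide_simps not_le[symmetric] mult.commute)
qed

end

section \<open>An obstruction to being conjugate by an inner automorphism\<close>

lemma (in universal_cuntz) out_proj_perm_endo_neq:
  assumes sys: "branching n pre lab shift"
    and u: "u permutes words n 2" "perm_endo n 2 A S u \<in> carrier (Aut A)"
    and v: "v permutes words n 2" "perm_endo n 2 A S v \<in> carrier (Aut A)"
    and \<alpha>: "set \<alpha> \<subseteq> {1..n}"
    and fixed: "branching.path (branching.twist_pre pre lab shift v) \<alpha> m = m"
    and aperiodic: "\<And>k N. 0 < N \<Longrightarrow>
      (branching.path (branching.twist_pre pre lab shift u) \<alpha> ^^ N) k \<noteq> k"
  shows "out_proj A (perm_endo n 2 A S u) \<noteq> out_proj A (perm_endo n 2 A S v)"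
proof
  assume "out_proj A (perm_endo n 2 A S u) = out_proj A (perm_endo n 2 A S v)"
  then obtain w where w: "w \<in> unitaries A"
    "\<And>x. x \<in> carrier A \<Longrightarrow> perm_endo n 2 A S u x = w \<otimes> perm_endo n 2 A S v x \<otimes> adj A w"
    using out_proj_eqD[OF u(2) v(2)] by blast
  have wc: "w \<in> carrier A" "adj A w \<otimes> w = \<one>"
    using w(1) by (simp_all add: unitaries_def)
  interpret B: branching n pre lab shift
    by (rule sys)
  obtain \<rho> where \<rho>: "\<And>x y. x \<in> carrier A \<Longrightarrow> y \<in> carrier A \<Longrightarrow> \<rho> (x \<otimes> y) = \<rho> x o\<^sub>L \<rho> y"
    "\<rho> \<one> = id_blinfun" "\<And>i. i \<in> {1..n} \<Longrightarrow> \<rho> (S i) = B.isom i"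
    using B.representation[OF cuntz_algebra] by blast
  interpret U: branching n "B.twist_pre u" "B.twist_lab u" "B.twist_shift u"
    by (rule B.branching_twist[OF u(1)])
  interpret V: branching n "B.twist_pre v" "B.twist_lab v" "B.twist_shift v"
    by (rule B.branching_twist[OF v(1)])
  note U = B.representation_perm_unitary_mult[where \<rho> = \<rho>, OF u(1) cuntz_algebra _ \<rho>(1,3)]
  note V = B.representation_perm_unitary_mult[where \<rho> = \<rho>, OF v(1) cuntz_algebra _ \<rho>(1,3)]
  have intertwine: "U.isom i o\<^sub>L \<rho> w = \<rho> w o\<^sub>L V.isom i" if i: "i \<in> {1..n}" for i
  proof -
    let ?v = "perm_unitary n 2 A S v" and ?u = "perm_unitary n 2 A S u"
    have cl: "?v \<in> carrier A" "?u \<in> carrier A"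
      by (rule perm_unitary_closed[OF v(1)], rule perm_unitary_closed[OF u(1)])
    have "?u \<otimes> S i = w \<otimes> (?v \<otimes> S i) \<otimes> adj A w"
      using w(2)[of "S i"] i perm_endo(3)[OF u(1) i] perm_endo(3)[OF v(1) i] by simp
    then have "?u \<otimes> S i \<otimes> w = w \<otimes> (?v \<otimes> S i)"
      using i wc cl by (simp add: m_assoc)
    then have "\<rho> (?u \<otimes> S i \<otimes> w) = \<rho> (w \<otimes> (?v \<otimes> S i))"
      by simp
    moreover have "\<rho> (?u \<otimes> S i \<otimes> w) = \<rho> (?u \<otimes> S i) o\<^sub>L \<rho> w"
      "\<rho> (w \<otimes> (?v \<otimes> S i)) = \<rho> w o\<^sub>L \<rho> (?v \<otimes> S i)"
      using i wc cl by (intro \<rho>(1); simp)+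
    moreover have "\<rho> (?u \<otimes> S i) = U.isom i"
      by (rule U[OF i])
    moreover have "\<rho> (?v \<otimes> S i) = V.isom i"
      by (rule V[OF i])
    ultimately show ?thesis
      by simp
  qed
  define y where "y = \<rho> w (V.basis m)"
  have word: "U.isom_word \<gamma> (\<rho> w x) = \<rho> w (V.isom_word \<gamma> x)" if "set \<gamma> \<subseteq> {1..n}" for \<gamma> x
    using that
  proof (induction \<gamma>)
    case (Cons i \<gamma>)
    then have "(U.isom i o\<^sub>L \<rho> w) z = (\<rho> w o\<^sub>L V.isom i) z" for z
      using intertwine[of i] by simp
    then have "U.isom i (\<rho> w z) = \<rho> w (V.isom i z)" for z
      by simp
    with Cons show ?case
      by (simp add: U.isom_word_def V.isom_word_def)
  qed (simp add: U.isom_word_def V.isom_word_def)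
  have "U.isom_word \<alpha> y = y"
    using word[OF \<alpha>, of "V.basis m"] V.isom_word_basis[OF \<alpha>, of m] fixed by (simp add: y_def)
  moreover have "y \<noteq> 0"
  proof
    assume "y = 0"
    moreover have "\<rho> (adj A w) o\<^sub>L \<rho> w = id_blinfun"
      using \<rho>(1)[of "adj A w" w] \<rho>(2) wc by simp
    then have "(\<rho> (adj A w) o\<^sub>L \<rho> w) (V.basis m) = V.basis m"
      by simp
    then have "\<rho> (adj A w) y = V.basis m"
      by (simp add: y_def)
    ultimately have "coord (V.basis m) m = 0"
      by simp
    then show False
      by (simp add: V.coord_basis)
  qed
  ultimately show False
    using U.periodic_point_if_fixed_vector[OF \<alpha>] aperiodic by blast
qed

section \<open>Branching systems with one prescribed cycle\<close>

lemma permutes_extension: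
  assumes "finite X" "B \<subseteq> X" "inj_on f B" "f ` B \<subseteq> X"
  obtains p where "p permutes X" "\<And>b. b \<in> B \<Longrightarrow> p b = f b"
proof -
  have "card (X - B) = card (X - f ` B)"
    using assms by (simp add: card_Diff_subset finite_subset card_image)
  then obtain g where g: "bij_betw g (X - B) (X - f ` B)"
    using assms(1) by (metis finite_Diff finite_same_card_bij)
  define p where "p x = (if x \<in> B then f x else if x \<in> X then g x else x)" for x
  have "bij_betw p B (f ` B)"
    using assms(3) by (subst bij_betw_cong[of B p f]) (auto simp: p_def inj_on_imp_bij_betw)
  moreover have "bij_betw p (X - B) (X - f ` B)"
    using g by (subst bij_betw_cong[of "X - B" p g]) (auto simp: p_def)
  ultimately have "bij_betw p (B \<union> (X - B)) (f ` B \<union> (X - f ` B))"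
    by (rule bij_betw_combine) auto
  then have "bij_betw p X X"
    using assms by (simp add: Un_absorb1 Un_Diff_cancel)
  then have "p permutes X"
    by (rule bij_imp_permutes) (use assms(2) in \<open>auto simp: p_def\<close>)
  then show thesis
    using that p_def by simp
qed

text \<open>The points of the cycle are the numbers below \<open>length \<beta>\<close>, and reading
  from \<open>c\<close> gives \<beta> rotated by \<open>c\<close>. The descent condition drives
  every other point into the cycle and excludes further cycles.\<close>

locale cycle_branching = branching +
  fixes \<beta> :: "nat list"
  assumes word_nonempty: "\<beta> \<noteq> []"
    and lab_cycle: "c < length \<beta> \<Longrightarrow> lab c = \<beta> ! c"
    and shift_cycle: "c < length \<beta> \<Longrightarrow> shift c = Suc c mod length \<beta>"
    and shift_less: "length \<beta> \<le> m \<Longrightarrow> shift m < m"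

text \<open>Start from the system that sends \<open>m\<close> to \<open>nm, \<dots>, nm + n - 1\<close> and permute the points below
  \<open>n * length \<beta>\<close> so that the cycle arises on the points below \<open>length \<beta>\<close>. The rest of the permutation
  does not matter, since the successors of all permuted points are less than \<open>length \<beta>\<close>.\<close>

lemma cycle_branching_exists:
  assumes \<beta>: "\<beta> \<noteq> []" "set \<beta> \<subseteq> {1..n}" and n: "2 \<le> n"
  obtains pre lab shift where "cycle_branching n pre lab shift \<beta>"
proof -
  define l where "l = length \<beta>"
  \<comment> \<open>In the unpermuted system \<open>m\<close> has label \<open>Suc (m mod n)\<close>
    and successor \<open>m div n\<close>; thus \<open>q c\<close> is the point there with the label
    and the successor that \<open>c\<close> is to receive.\<close>
  define q where "q c = n * (Suc c mod l) + (\<beta> ! c - 1)" for c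
  have l: "0 < l"
    using \<beta> by (simp add: l_def)
  have letter: "\<beta> ! c \<in> {1..n}" if "c < l" for c
    using subsetD[OF \<beta>(2) nth_mem[of c \<beta>]] that by (simp add: l_def)
  have q_div: "q c div n = Suc c mod l" and q_mod: "Suc (q c mod n) = \<beta> ! c" if c: "c < l" for c
  proof -
    obtain b where "\<beta> ! c = Suc b" "b < n"
      using letter[OF c] by (cases "\<beta> ! c") auto
    then show "q c div n = Suc c mod l" "Suc (q c mod n) = \<beta> ! c"
      by (simp_all add: q_def)
  qed
  have inj: "inj_on q {..<l}"
  proof (rule inj_onI)
    fix c d assume cd: "c \<in> {..<l}" "d \<in> {..<l}" "q c = q d"
    then have "Suc c mod l = Suc d mod l"
      using q_div by (metis lessThan_iff)
    then show "c = d"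
      using cd by (auto simp: mod_Suc split: if_splits)
  qed
  have q_less: "q c < n * l" if "c < l" for c
  proof -
    have "Suc c mod l < l"
      using l by simp
    then have "q c div n < l"
      using q_div[OF that] by simp
    then show ?thesis
      using n by (simp add: div_less_iff_less_mult mult.commute)
  qed
  have ll: "l \<le> n * l"
    using n by simp
  obtain p where p: "p permutes {..<n * l}" "\<And>c. c \<in> {..<l} \<Longrightarrow> p c = q c"
  proof (rule permutes_extension[of "{..<n * l}" "{..<l}" q])
    show "{..<l} \<subseteq> {..<n * l}" "q ` {..<l} \<subseteq> {..<n * l}"
      using ll q_less by auto
  qed (use inj in auto)
  define lab where "lab m = Suc (p m mod n)" for m
  define shift where "shift m = p m div n" for m
  define pre where "pre i m = inv_into UNIV p (n * m + (i - 1))" for i m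
  show thesis
  proof (rule that[of pre lab shift], unfold_locales)
    fix m
    show "lab m \<in> {1..n}"
      using n by (simp add: lab_def Suc_leI)
    show "pre (lab m) (shift m) = m"
      using permutes_inverses(2)[OF p(1)] by (simp add: lab_def shift_def pre_def)
  next
    fix i m assume i: "i \<in> {1..n}"
    have "p (pre i m) = n * m + (i - 1)"
      unfolding pre_def by (rule permutes_inverses(1)[OF p(1)])
    moreover obtain b where "i = Suc b" "b < n"
      using i by (cases i) auto
    ultimately show "lab (pre i m) = i" "shift (pre i m) = m"
      by (simp_all add: lab_def shift_def)
  next
    fix c assume "c < length \<beta>"
    then show "lab c = \<beta> ! c" "shift c = Suc c mod length \<beta>"
      using p(2)[of c] q_div[of c] q_mod[of c] by (simp_all add: l_def lab_def shift_def)
  next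
    fix m assume m: "length \<beta> \<le> m"
    show "shift m < m"
    proof (cases "m < n * l")
      case True
      then have "p m < n * l"
        using permutes_in_image[OF p(1), of m] by simp
      then have "shift m < l"
        by (simp add: shift_def less_mult_imp_div_less mult.commute)
      then show ?thesis
        using m by (simp add: l_def)
    next
      case False
      then have "p m = m"
        using permutes_not_in[OF p(1), of m] by simp
      moreover have "0 < m"
        using m l unfolding l_def by linarith
      ultimately show ?thesis
        using n by (simp add: shift_def)
    qed
  qed (rule \<beta>(1))
qed

section \<open>Spelling and reading words\<close>

context branching
begin

text \<open>The same map as \<open>path\<close>; \<open>spell\<close> is used with the letters of
  the original system, \<open>path\<close> with those of the twisted ones.\<close>

definition spell :: "nat list \<Rightarrow> nat \<Rightarrow> nat" where
  "spell w m = foldr pre w m"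

definition read :: "nat \<Rightarrow> nat \<Rightarrow> nat list" where
  "read l m = map (\<lambda>t. lab ((shift ^^ t) m)) [0..<l]"

lemma read_Suc: "read (Suc l) m = lab m # read l (shift m)"
proof -
  have "read (Suc l) m = lab m # map (\<lambda>t. lab ((shift ^^ Suc t) m)) [0..<l]"
    by (simp only: read_def upt_conv_Cons zero_less_Suc map_Suc_upt[symmetric] list.map map_map
        funpow_0 comp_def)
  then show ?thesis
    by (simp add: read_def funpow_swap1 del: funpow.simps(2)) (simp add: funpow_swap1)
qed

lemma read_spell: "set w \<subseteq> {1..n} \<Longrightarrow> read (length w) (spell w m) = w"
  by (induction w) (simp_all add: read_Suc spell_def lab_pre shift_pre, simp add: read_def)

lemma shift_spell: "set w \<subseteq> {1..n} \<Longrightarrow> (shift ^^ length w) (spell w m) = m"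
  by (induction w) (simp_all add: spell_def shift_pre funpow_Suc_right del: funpow.simps(2))

lemma spell_read: "spell (read l m) ((shift ^^ l) m) = m"
  by (induction l arbitrary: m)
     (simp add: read_def spell_def, simp add: read_Suc spell_def pre_lab_shift funpow_Suc_right del: funpow.simps(2))

end

text \<open>Twisting by a permutation \<open>u\<close> of words of length two turns the path \<open>\<alpha>\<close> into an automaton
  that looks only at the first letter of the code of a point.\<close>

fun out_word :: "('l list \<Rightarrow> 'l list) \<Rightarrow> 'l list \<Rightarrow> 'l \<Rightarrow> 'l list" where
  "out_word u [] a = [a]"
| "out_word u (i # \<alpha>) a = (let w = out_word u \<alpha> a in u [i, hd w] @ tl w)"

lemma out_word_closed:
  assumes u: "u permutes words n 2" and "set \<alpha> \<subseteq> {1..n}" "a \<in> {1..n}"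
  shows "length (out_word u \<alpha> a) = Suc (length \<alpha>) \<and> set (out_word u \<alpha> a) \<subseteq> {1..n}"
  using assms(2)
proof (induction \<alpha>)
  case (Cons i \<alpha>)
  then obtain b w where w: "out_word u \<alpha> a = b # w" "length w = length \<alpha>" "b \<in> {1..n}" "set w \<subseteq> {1..n}"
    by (cases "out_word u \<alpha> a") auto
  have "u [i, b] \<in> words n 2"
    using permutes_in_image[OF u] Cons.prems w by simp
  then obtain p q where "u [i, b] = [p, q]" "p \<in> {1..n}" "q \<in> {1..n}"
    by (rule words_2_cases)
  then show ?case
    using w by simp
qed (use assms(3) in simp)

lemma (in branching) path_twist:
  assumes u: "u permutes words n 2" and \<alpha>: "set \<alpha> \<subseteq> {1..n}"
  shows "branching.path (twist_pre u) \<alpha> m = spell (out_word u \<alpha> (lab m)) (shift m)"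
proof -
  interpret U: branching n "twist_pre u" "twist_lab u" "twist_shift u"
    by (rule branching_twist[OF u])
  show ?thesis
    using \<alpha>
  proof (induction \<alpha>)
    case Nil
    show ?case
      by (simp add: U.path_def spell_def pre_lab_shift)
  next
    case (Cons i \<alpha>)
    then have IH: "U.path \<alpha> m = spell (out_word u \<alpha> (lab m)) (shift m)"
      by simp
    obtain b w where w: "out_word u \<alpha> (lab m) = b # w" "b \<in> {1..n}"
      using out_word_closed[OF u _ lab_range, of \<alpha> m] Cons.prems by (cases "out_word u \<alpha> (lab m)") auto
    obtain p q where pq: "u [i, b] = [p, q]"
      by (rule u_apply_cases[OF u, of i b]) (use Cons.prems w(2) in auto)
    have "U.path (i # \<alpha>) m = twist_pre u i (U.path \<alpha> m)"
      by (simp add: U.path_def)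
    also have "\<dots> = pre p (pre q (spell w (shift m)))"
      using w pq by (simp add: IH twist_pre_def[OF u] spell_def lab_pre shift_pre)
    also have "\<dots> = spell (out_word u (i # \<alpha>) (lab m)) (shift m)"
      using w pq by (simp add: spell_def)
    finally show ?case .
  qed
qed

text \<open>In the system with cycle \<open>\<beta>\<close>, a periodic point of the path \<open>\<alpha>\<close> and all its images have the same
  successor on the cycle, at which the automaton spells a rotation of \<open>\<beta>\<close>. Looking at two consecutive
  steps is enough to exclude this in all cases below.\<close>

definition attracts :: "'l set \<Rightarrow> ('l list \<Rightarrow> 'l list) \<Rightarrow> 'l list \<Rightarrow> 'l list \<Rightarrow> bool" where
  "attracts L u \<alpha> \<beta> \<longleftrightarrow> (\<exists>a\<in>L. \<exists>c<length \<beta>. out_word u \<alpha> a = a # rotate c \<beta>)"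

definition repels :: "'l set \<Rightarrow> ('l list \<Rightarrow> 'l list) \<Rightarrow> 'l list \<Rightarrow> 'l list \<Rightarrow> bool" where
  "repels L u \<alpha> \<beta> \<longleftrightarrow> (\<forall>a\<in>L. \<forall>c<length \<beta>. tl (out_word u \<alpha> a) = rotate c \<beta> \<longrightarrow>
     tl (out_word u \<alpha> (hd (out_word u \<alpha> a))) \<noteq> rotate c \<beta>)"

section \<open>Fixed and periodic points in the system with a cycle\<close>

context cycle_branching
begin

lemma shift_funpow_cycle: "c < length \<beta> \<Longrightarrow> (shift ^^ t) c = (c + t) mod length \<beta>"
proof (induction t)
  case (Suc t)
  then show ?case
    using shift_cycle[of "(c + t) mod length \<beta>"] word_nonempty by (simp add: mod_Suc_eq)
qed simp

lemma read_cycle: "c < length \<beta> \<Longrightarrow> read (length \<beta>) c = rotate c \<beta>"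
  by (rule nth_equalityI)
     (simp_all add: read_def shift_funpow_cycle lab_cycle nth_rotate word_nonempty add.commute)

lemma shift_less_cycle: "m < length \<beta> \<Longrightarrow> shift m < length \<beta>"
  by (simp add: shift_cycle word_nonempty)

text \<open>Off the cycle the shift strictly decreases, and once in the cycle it stays below
  \<open>length \<beta>\<close>; a point outside is never reached again.\<close>

lemma periodic_in_cycle:
  assumes "0 < t" "(shift ^^ t) m = m"
  shows "m < length \<beta>"
proof (rule ccontr)
  assume m: "\<not> m < length \<beta>"
  have "(shift ^^ Suc t) m < m" for t
  proof (induction t)
    case (Suc t)
    show ?case
    proof (cases "(shift ^^ Suc t) m < length \<beta>")
      case True
      from shift_less_cycle[OF this] show ?thesis
        using m by simp
    next
      case False
      then show ?thesis
        using shift_less[of "(shift ^^ Suc t) m"] Suc by simp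
    qed
  qed (use m shift_less in simp)
  from this[of "t - 1"] show False
    using assms by simp
qed

context
  fixes u \<alpha>
  assumes u: "u permutes words n 2" and \<alpha>: "set \<alpha> \<subseteq> {1..n}" "length \<alpha> = length \<beta>"
begin

text \<open>The fixed point is \<open>pre a c\<close>: spelling \<beta> rotated by \<open>c\<close>
  on top of \<open>c\<close> runs once round the cycle back to \<open>c\<close>, and then
  \<open>a\<close> is put in front.\<close>

lemma path_fixed_point:
  assumes "attracts {1..n} u \<alpha> \<beta>"
  shows "\<exists>m. branching.path (twist_pre u) \<alpha> m = m"
proof -
  obtain a c where ac: "a \<in> {1..n}" "c < length \<beta>" "out_word u \<alpha> a = a # rotate c \<beta>"
    using assms by (auto simp: attracts_def)
  have "spell (rotate c \<beta>) c = c"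
    using spell_read[of "length \<beta>" c] ac(2) by (simp add: read_cycle shift_funpow_cycle)
  then have "branching.path (twist_pre u) \<alpha> (pre a c) = pre a c"
    using path_twist[OF u \<alpha>(1), of "pre a c"] ac by (simp add: lab_pre shift_pre spell_def)
  then show ?thesis ..
qed

lemma no_periodic_point:
  assumes "repels {1..n} u \<alpha> \<beta>" "0 < N"
  shows "(branching.path (twist_pre u) \<alpha> ^^ N) m \<noteq> m"
proof
  let ?f = "branching.path (twist_pre u) \<alpha>"
  assume per: "(?f ^^ N) m = m"
  let ?w = "\<lambda>k. out_word u \<alpha> (lab k)"
  have walk: "lab (?f k) = hd (?w k) \<and> shift (?f k) = spell (tl (?w k)) (shift k) \<and>
    length (tl (?w k)) = length \<beta> \<and> set (tl (?w k)) \<subseteq> {1..n}" for k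
  proof -
    obtain b w where w: "?w k = b # w" "b \<in> {1..n}" "length w = length \<beta>" "set w \<subseteq> {1..n}"
      using out_word_closed[OF u \<alpha>(1) lab_range, of k] \<alpha>(2) by (cases "?w k") auto
    then show ?thesis
      by (simp add: path_twist[OF u \<alpha>(1)] spell_def lab_pre shift_pre)
  qed
  then have step: "lab (?f k) = hd (?w k)" "shift (?f k) = spell (tl (?w k)) (shift k)"
    and tl_w: "length (tl (?w k)) = length \<beta>" "set (tl (?w k)) \<subseteq> {1..n}" for k
    by blast+
  \<comment> \<open>The tail of the emitted word has the length of \<beta>, so one application of
    \<open>?f\<close> is undone, behind the first letter, by that many shifts. A periodic
    \<open>k\<close> therefore has its successor on the cycle.\<close>
  have rewind: "(shift ^^ (length \<beta> * t)) (shift ((?f ^^ t) k)) = shift k" for t k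
  proof (induction t arbitrary: k)
    case (Suc t)
    have "(shift ^^ (length \<beta> * Suc t)) (shift ((?f ^^ Suc t) k))
        = (shift ^^ length \<beta>) ((shift ^^ (length \<beta> * t)) (shift ((?f ^^ t) (?f k))))"
      by (simp add: funpow_add funpow_swap1)
    also have "\<dots> = (shift ^^ length \<beta>) (shift (?f k))"
      by (simp only: Suc.IH)
    also have "\<dots> = shift k"
      using shift_spell[OF tl_w(2)[of k], of "shift k"] tl_w(1)[of k] step(2)[of k] by simp
    finally show ?case .
  qed simp
  have cycle: "shift k < length \<beta>" if "(?f ^^ N) k = k" for k
    using rewind[of N k] that periodic_in_cycle[of "length \<beta> * N" "shift k"] \<open>0 < N\<close> word_nonempty by simp
  \<comment> \<open>On the cycle \<open>length \<beta>\<close> shifts are the identity, so rewinding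
    once shows that the successor does not move; the tail then has to be what the cycle spells
    there.\<close>
  have stable: "shift (?f k) = shift k \<and> tl (?w k) = rotate (shift k) \<beta>" if k: "(?f ^^ N) k = k" for k
  proof -
    have "(?f ^^ N) (?f k) = ?f k"
      using k by (simp add: funpow_swap1[symmetric])
    then have c: "shift (?f k) < length \<beta>"
      by (rule cycle)
    have "(shift ^^ length \<beta>) (shift (?f k)) = shift k"
      using rewind[of 1 k] by simp
    with c have eq: "shift (?f k) = shift k"
      by (simp add: shift_funpow_cycle)
    have "read (length \<beta>) (spell (tl (?w k)) (shift k)) = tl (?w k)"
      using read_spell[OF tl_w(2)[of k]] tl_w(1)[of k] by simp
    then have "read (length \<beta>) (shift k) = tl (?w k)"
      using eq step(2)[of k] by simp
    then show ?thesis
      using eq read_cycle c by simp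
  qed
  have "(?f ^^ N) (?f m) = ?f m"
    using per by (simp add: funpow_swap1[symmetric])
  from stable[OF this] stable[OF per] show False
    using assms(1) lab_range[of m] cycle[OF per] step(1)[of m] unfolding repels_def by auto
qed

end

end

theorem (in universal_cuntz) out_proj_perm_endo_neqI:
  assumes u: "u permutes words n 2" "perm_endo n 2 A S u \<in> carrier (Aut A)"
    and v: "v permutes words n 2" "perm_endo n 2 A S v \<in> carrier (Aut A)"
    and \<alpha>: "set \<alpha> \<subseteq> {1..n}" "length \<alpha> = length \<beta>" and \<beta>: "set \<beta> \<subseteq> {1..n}" "\<beta> \<noteq> []"
    and "repels {1..n} u \<alpha> \<beta>" "attracts {1..n} v \<alpha> \<beta>"
  shows "out_proj A (perm_endo n 2 A S u) \<noteq> out_proj A (perm_endo n 2 A S v)"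
proof -
  have "2 \<le> n"
    using cuntz_algebra by (simp add: cuntz_algebra_def)
  then obtain pre lab shift where "cycle_branching n pre lab shift \<beta>"
    using cycle_branching_exists \<beta> by blast
  then interpret cycle_branching n pre lab shift \<beta> .
  obtain m where "branching.path (twist_pre v) \<alpha> m = m"
    using path_fixed_point[OF v(1) \<alpha>] assms by blast
  then show ?thesis
    using no_periodic_point[OF u(1) \<alpha>] assms
    by (intro out_proj_perm_endo_neq[OF branching_axioms u v \<alpha>(1)]) auto
qed

section \<open>The groups as groups of bit operations\<close>

text \<open>The letters \<open>i, j, h, k\<close> are encoded as pairs of bits: the first bit tells \<open>{i, j}\<close> from
  \<open>{h, k}\<close>, the second one the larger from the smaller element. On bits, the dihedral group of
  order 8 acts on the square by \<open>(x, y) \<mapsto> (x + sy' + e + dy, y + d)\<close>, where \<open>y' = 1 + y\<close>; with \<open>s = 0\<close>,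
  this is the rotation by \<open>2e + d\<close> steps. The remaining three bits are the exponents of \<open>x\<^sub>0\<close>, \<open>y\<^sub>0\<close>
  and \<open>u\<^sub>0' v\<^sub>0'\<close> or \<open>w\<^sub>0 z\<^sub>0\<close>. The argument \<open>b\<close> holds for the primed groups.\<close>

type_synonym letter = "bool \<times> bool"
type_synonym flags = "bool \<times> bool \<times> bool \<times> bool \<times> bool \<times> bool"

fun dih :: "bool \<times> bool \<times> bool \<Rightarrow> bool \<times> bool \<Rightarrow> bool \<times> bool" where
  "dih (e, d, s) (x, y) = (x \<noteq> ((s \<and> \<not> y) \<noteq> (e \<noteq> (d \<and> y))), y \<noteq> d)"

text \<open>Words inside one block carry \<open>p\<close> and \<open>q\<close>, words from the
  second block to the first carry \<open>r\<close>, and words from the first to the second carry the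
  dihedral group. For the primed groups the coordinates of the square are exchanged and one is
  negated, which turns \<open>c0'\<close> and \<open>v0\<close> into the same rotation and
  reflection as \<open>c0\<close> and \<open>w0'\<close>. The last equation is a default for other
  lengths.\<close>

fun letter_act :: "bool \<Rightarrow> flags \<Rightarrow> letter list \<Rightarrow> letter list" where
  "letter_act b (e, d, s, p, q, r) [(False, x), (False, y)] = [(False, x \<noteq> p), (False, y)]"
| "letter_act b (e, d, s, p, q, r) [(True, x), (True, y)] = [(True, x), (True, y \<noteq> q)]"
| "letter_act b (e, d, s, p, q, r) [(True, x), (False, y)] =
    (if b then [(True, x \<noteq> r), (False, y)] else [(True, x), (False, y \<noteq> r)])"
| "letter_act b (e, d, s, p, q, r) [(False, x), (True, y)] =
    (if b then (case dih (e, d, s) (y, \<not> x) of (y', x') \<Rightarrow> [(False, \<not> x'), (True, y')])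
     else (case dih (e, d, s) (x, y) of (x', y') \<Rightarrow> [(False, x'), (True, y')]))"
| "letter_act b f w = w"

text \<open>The rotation exponent is 2e + d modulo 4. The conjunction is the carry when two
  exponents are added, or, if the left factor contains the reflection, the borrow when they are
  subtracted.\<close>

fun flags_mult :: "flags \<Rightarrow> flags \<Rightarrow> flags" where
  "flags_mult (e, d, s, p, q, r) (e', d', s', p', q', r') =
     (e \<noteq> (e' \<noteq> ((s \<noteq> d) \<and> d')), d \<noteq> d', s \<noteq> s', p \<noteq> p', q \<noteq> q', r \<noteq> r')"

definition flags_one :: flags where
  "flags_one = (False, False, False, False, False, False)"

fun flags_inv :: "flags \<Rightarrow> flags" where
  "flags_inv (e, d, s, p, q, r) = (if s then e else e \<noteq> d, d, s, p, q, r)"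

lemma flags_mult_inv: "flags_mult f (flags_inv f) = flags_one" "flags_mult (flags_inv f) f = flags_one"
  by (cases f; auto simp: flags_one_def)+

lemma letter_act_pair: "\<exists>x' y'. letter_act b f [x, y] = [(fst x, x'), (fst y, y')]"
  by (cases f; cases x; cases y; cases "fst x"; cases "fst y"; cases b) auto

lemma letter_act_one: "letter_act b flags_one w = w"
  by (cases "(b, flags_one, w)" rule: letter_act.cases) (auto simp: flags_one_def)

lemma letter_act_mult:
  "letter_act b (flags_mult f g) [x, y] = letter_act b f (letter_act b g [x, y])"
proof -
  obtain e d s p q r e' d' s' p' q' r' where "f = (e, d, s, p, q, r)" "g = (e', d', s', p', q', r')"
    using prod_cases6 by metis
  then show ?thesis
    by (cases x; cases y; cases "fst x"; cases "fst y"; cases b) auto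
qed

text \<open>The two actions overlap in the middle letter. Whatever they add to its bit is
  independent of that bit, and where one action lets its effect on the other letter depend on the
  bit, the other action leaves the bit alone.\<close>

lemma letter_act_shifts_commute:
  "letter_act b g [x, letter_act b f [y, z] ! 0] @ [letter_act b f [y, z] ! 1] =
   letter_act b g [x, y] ! 0 # letter_act b f [letter_act b g [x, y] ! 1, z]"
proof -
  obtain e d s p q r e' d' s' p' q' r' where "f = (e, d, s, p, q, r)" "g = (e', d', s', p', q', r')"
    using prod_cases6 by metis
  then show ?thesis
    by (cases x; cases y; cases z; cases "fst x"; cases "fst y"; cases "fst z"; cases b) auto
qed

text \<open>Listed explicitly, so that bounded quantifiers unfold into finitely many cases.\<close>

definition letters :: "letter set" where
  "letters = {(False, False), (False, True), (True, False), (True, True)}"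

lemma letters_UNIV: "letters = UNIV"
  by (auto simp: letters_def)

lemma bounded_length:
  "(\<forall>c<length [x]. P c) \<longleftrightarrow> P 0" "(\<forall>c<length [x, y, z]. P c) \<longleftrightarrow> P 0 \<and> P 1 \<and> P 2"
  "(\<exists>c<length [x]. P c) \<longleftrightarrow> P 0" "(\<exists>c<length [x, y, z]. P c) \<longleftrightarrow> P 0 \<or> P 1 \<or> P 2"
  by (auto simp: less_Suc_eq numeral_eq_Suc)

lemma rotate_triple:
  "rotate 0 w = w" "rotate 1 [x, y, z] = [y, z, x]" "rotate 2 [x, y, z] = [z, x, y]"
  by (simp_all add: numeral_eq_Suc)

lemmas repels_unfold = repels_def attracts_def bounded_length rotate_triple

abbreviation (input) "I \<equiv> (False, False)"
abbreviation (input) "J \<equiv> (False, True)"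
abbreviation (input) "H \<equiv> (True, False)"
abbreviation (input) "K \<equiv> (True, True)"

text \<open>The word \<open>[I]\<close> sees the exponent \<open>p\<close> and \<open>[H]\<close>
  sees \<open>q\<close>. The remaining bits act only where the two blocks meet, hence the mixed
  words of length three.\<close>

lemma repels_if_not_one:
  assumes "f \<noteq> flags_one"
  shows "\<exists>\<beta>\<in>{[I], [H], [I, I, H], [I, K, H], [J, H, H]}. repels letters (letter_act b f) \<beta> \<beta>"
proof -
  obtain e d s p q r where f: "f = (e, d, s, p, q, r)"
    using prod_cases6 by metis
  have "repels letters (letter_act b f) [I] [I]" if p
    using that unfolding f repels_unfold letters_def by simp
  moreover have "repels letters (letter_act b f) [H] [H]" if q
    using that unfolding f repels_unfold letters_def by auto
  moreover have "\<exists>\<beta>\<in>{[I, I, H], [I, K, H], [J, H, H]}. repels letters (letter_act b f) \<beta> \<beta>"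
    if pq: "\<not> p" "\<not> q"
    using assms pq unfolding f flags_one_def bex_simps repels_unfold letters_def
    by (cases b; simp; blast)
  ultimately show ?thesis
    by blast
qed

text \<open>A single step emits a first letter in the block of \<open>x\<close> and a tail in the
  block of the current letter. If the tail is \<open>y\<close> once, the next current letter lies in
  the block of \<open>x\<close>, and so does the next tail.\<close>

lemma repels_if_blocks_differ:
  assumes "fst x \<noteq> fst y"
  shows "repels letters (letter_act b f) [x] [y]"
  unfolding repels_unfold
proof (intro ballI impI notI)
  fix a
  let ?Y = "out_word (letter_act b f) [x]"
  assume Y: "tl (?Y a) = [y]" "tl (?Y (hd (?Y a))) = [y]"
  have fst: "fst (hd (?Y c)) = fst x \<and> fst (hd (tl (?Y c))) = fst c" for c
    using letter_act_pair[of b f x c] by auto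
  from fst[of a] fst[of "hd (?Y a)"] show False
    using assms unfolding Y by simp
qed

text \<open>Conjugation by the exchange of the blocks: the action of the group of the complementary
  pair, written in the letters of the original pair.\<close>

definition swap_blocks :: "(letter list \<Rightarrow> letter list) \<Rightarrow> letter list \<Rightarrow> letter list" where
  "swap_blocks g w = map (map_prod Not id) (g (map (map_prod Not id) w))"

text \<open>The elements and test words were found by computing the induced actions on cyclic words of
  length at most three.\<close>

fun special_flags :: "bool \<Rightarrow> flags" where
  "special_flags b = (\<not> b, False, True, False, False, False)"

definition special_tests :: "bool \<Rightarrow> (letter list \<times> letter list) set" where
  "special_tests b = (if b then {([I, I, H], [I, I, H]), ([I, J, H], [I, J, K])}
     else {([I, I, J], [I, I, J]), ([I, I, H], [I, I, H]), ([I, I, K], [I, J, K])})"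

lemma attracts_special:
  assumes "(\<alpha>, \<beta>) \<in> special_tests b"
  shows "attracts letters (letter_act b (special_flags b)) \<alpha> \<beta>"
proof -
  have "attracts letters (letter_act b (special_flags b)) \<alpha> \<beta>"
    if "b" "(\<alpha>, \<beta>) \<in> {([I, I, H], [I, I, H]), ([I, J, H], [I, J, K])}"
    using that unfolding insert_iff prod.inject
    by (elim disjE conjE emptyE; hypsubst; unfold repels_unfold letters_def; simp)
  moreover have "attracts letters (letter_act b (special_flags b)) \<alpha> \<beta>"
    if "\<not> b" "(\<alpha>, \<beta>) \<in> {([I, I, J], [I, I, J]), ([I, I, H], [I, I, H]), ([I, I, K], [I, J, K])}"
    using that unfolding insert_iff prod.inject
    by (elim disjE conjE emptyE; hypsubst; unfold repels_unfold letters_def; simp)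
  ultimately show ?thesis
    using assms by (simp add: special_tests_def split: if_splits)
qed

text \<open>Covers the other group of the same pair and both groups of the complementary pair. The
  special element is fixed, while the test may depend on the competitor \<open>f\<close>.\<close>

lemma repels_special:
  assumes "b \<noteq> b' \<or> sw"
  shows "\<exists>(\<alpha>, \<beta>)\<in>special_tests b. repels letters
    (if sw then swap_blocks (letter_act b' f) else letter_act b' f) \<alpha> \<beta>"
proof -
  obtain e d s p q r where f: "f = (e, d, s, p, q, r)"
    using prod_cases6 by metis
  consider "\<not> b" "\<not> b'" sw | "\<not> b" b' "\<not> sw" | "\<not> b" b' sw | b "\<not> b'" sw | b "\<not> b'" "\<not> sw" | b b' sw
    using assms by blast
  then show ?thesis
    by cases (simp_all only: special_tests_def if_True if_False simp_thms bex_simps prod.case,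
      unfold f repels_unfold letters_def, simp_all add: swap_blocks_def, auto)
qed

section \<open>Labelled words\<close>

definition lift :: "(letter \<Rightarrow> nat) \<Rightarrow> (letter list \<Rightarrow> letter list) \<Rightarrow> nat list \<Rightarrow> nat list" where
  "lift l g w = (if w \<in> words 4 2 then map l (g (map (inv_into UNIV l) w)) else w)"

text \<open>The hypothesis on \<open>g\<close> keeps the emitted words nonempty, so that
  \<open>hd\<close> commutes with relabelling.\<close>

lemma out_word_lift:
  assumes l: "bij_betw l UNIV {1..4::nat}"
    and pair: "\<And>x y. \<exists>x' y'. g [x, y] = [x', y']"
  shows "out_word (lift l g) (map l \<alpha>) (l a) = map l (out_word g \<alpha> a)"
proof (induction \<alpha>)
  case (Cons i \<alpha>)
  have "out_word g \<alpha> a \<noteq> []"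
  proof (induction \<alpha>)
    case (Cons i \<alpha>)
    then show ?case
      using pair[of i "hd (out_word g \<alpha> a)"] by (auto simp: Let_def)
  qed simp
  moreover have "l x \<in> {1..4}" "inv_into UNIV l (l x) = x" for x
    using l by (auto simp: bij_betw_def)
  ultimately show ?case
    using Cons by (simp add: Let_def lift_def hd_map map_tl)
qed simp

locale labelling =
  fixes l :: "letter \<Rightarrow> nat"
  assumes bij_label: "bij_betw l UNIV {1..4}"
begin

lemma label_range: "l x \<in> {1..4}"
  using bij_label by (auto simp: bij_betw_def)

lemma inv_label [simp]: "inv_into UNIV l (l x) = x"
  using bij_label by (auto simp: bij_betw_def)

lemma label_cases:
  assumes "a \<in> {1..4}"
  obtains x where "a = l x"
  using assms bij_label by (metis bij_betw_imp_surj_on imageE)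

lemma lift_pair: "lift l g [l x, l y] = map l (g [x, y])"
  using label_range by (simp add: lift_def del: atLeastAtMost_iff)

lemma word_cases:
  assumes "w \<in> words 4 2"
  obtains x y where "w = [l x, l y]"
  using assms by (metis label_cases words_2_cases)

lemma lift_eqI:
  assumes "\<And>x y. u [l x, l y] = map l (g [x, y])" "\<And>w. w \<notin> words 4 2 \<Longrightarrow> u w = w"
  shows "u = lift l g"
proof
  fix w
  show "u w = lift l g w"
  proof (cases "w \<in> words 4 2")
    case True
    then obtain x y where "w = [l x, l y]"
      by (rule word_cases)
    then show ?thesis
      using assms(1) by (simp only: lift_pair)
  next
    case False
    then show ?thesis
      using assms(2) by (simp add: lift_def)
  qed
qed

lemma attracts_lift:
  assumes "\<And>x y. \<exists>x' y'. g [x, y] = [x', y']" "attracts letters g \<alpha> \<beta>"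
  shows "attracts {1..4} (lift l g) (map l \<alpha>) (map l \<beta>)"
proof -
  obtain a c where "c < length \<beta>" "out_word g \<alpha> a = a # rotate c \<beta>"
    using assms(2) by (auto simp: attracts_def)
  then show ?thesis
    unfolding attracts_def using out_word_lift[where g = g, OF bij_label assms(1), of \<alpha> a] label_range[of a]
    by (intro bexI[of _ "l a"] exI[of _ c]) (auto simp: rotate_map)
qed

lemma map_label_eq_iff: "map l v = map l w \<longleftrightarrow> v = w"
  using bij_label by (simp add: bij_betw_def inj_map_eq_map)

lemma repels_lift:
  assumes pair: "\<And>x y. \<exists>x' y'. g [x, y] = [x', y']" and "repels letters g \<alpha> \<beta>"
  shows "repels {1..4} (lift l g) (map l \<alpha>) (map l \<beta>)"
  unfolding repels_def
proof (intro ballI allI impI)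
  fix a c assume a: "a \<in> {1..4}" and c: "c < length (map l \<beta>)"
    and eq: "tl (out_word (lift l g) (map l \<alpha>) a) = rotate c (map l \<beta>)"
  note ow = out_word_lift[where g = g, OF bij_label pair]
  obtain x where x: "a = l x"
    using a by (rule label_cases)
  have ne: "out_word g \<alpha> x \<noteq> []"
  proof (cases \<alpha>)
    case (Cons i \<alpha>')
    then show ?thesis
      using pair[of i "hd (out_word g \<alpha>' x)"] by (auto simp: Let_def)
  qed simp
  have "tl (out_word g \<alpha> x) = rotate c \<beta>"
    using eq by (simp add: x ow rotate_map map_tl[symmetric] map_label_eq_iff)
  then have "tl (out_word g \<alpha> (hd (out_word g \<alpha> x))) \<noteq> rotate c \<beta>"
    using assms(2) c unfolding repels_def letters_UNIV length_map by blast
  then show "tl (out_word (lift l g) (map l \<alpha>) (hd (out_word (lift l g) (map l \<alpha>) a))) \<noteq> rotate c (map l \<beta>)"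
    using ne by (simp add: x ow hd_map rotate_map map_tl[symmetric] map_label_eq_iff)
qed

definition perm :: "bool \<Rightarrow> flags \<Rightarrow> nat list \<Rightarrow> nat list" where
  "perm b f = lift l (letter_act b f)"

lemma letter_act_pair': "\<exists>x' y'. letter_act b f [x, y] = [x', y']"
  using letter_act_pair[of b f x y] by auto

lemma perm_pair: "perm b f [l x, l y] = map l (letter_act b f [x, y])"
  by (simp add: perm_def lift_pair)

lemma attracts_perm:
  "attracts letters (letter_act b f) \<alpha> \<beta> \<Longrightarrow> attracts {1..4} (perm b f) (map l \<alpha>) (map l \<beta>)"
  unfolding perm_def by (rule attracts_lift[where g = "letter_act b f", OF letter_act_pair'])

lemma repels_perm:
  "repels letters (letter_act b f) \<alpha> \<beta> \<Longrightarrow> repels {1..4} (perm b f) (map l \<alpha>) (map l \<beta>)"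
  unfolding perm_def by (rule repels_lift[where g = "letter_act b f", OF letter_act_pair'])

lemma perm_outside: "w \<notin> words 4 2 \<Longrightarrow> perm b f w = w"
  by (simp add: perm_def lift_def)

lemma perm_mult: "perm b f \<circ> perm b g = perm b (flags_mult f g)"
  unfolding perm_def[of b "flags_mult f g"]
proof (rule lift_eqI)
  fix x y
  obtain x' y' where "letter_act b g [x, y] = [x', y']"
    using letter_act_pair' by blast
  then show "(perm b f \<circ> perm b g) [l x, l y] = map l (letter_act b (flags_mult f g) [x, y])"
    by (simp add: perm_pair letter_act_mult)
qed (simp add: perm_outside)

lemma perm_one: "perm b flags_one = id"
  unfolding perm_def by (rule lift_eqI[symmetric]) (simp_all add: letter_act_one)

lemma perm_inv: "perm b f \<circ> perm b (flags_inv f) = id" "perm b (flags_inv f) \<circ> perm b f = id"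
  by (simp_all add: perm_mult flags_mult_inv perm_one)

lemma perm_permutes: "perm b f permutes words 4 2"
  unfolding permutes_def bij_iff[symmetric]
  using o_bij[OF perm_inv(2,1)] by (simp add: perm_outside)

lemma perm_shifts_commute: "shifts_commute 4 (perm b f) (perm b g)"
  unfolding shifts_commute_def
proof (intro ballI)
  fix a1 a2 a3 assume "a1 \<in> {1..4::nat}" "a2 \<in> {1..4::nat}" "a3 \<in> {1..4::nat}"
  then obtain x y z where a: "a1 = l x" "a2 = l y" "a3 = l z"
    using label_cases by metis
  obtain y' z' where 1: "letter_act b f [y, z] = [y', z']"
    using letter_act_pair' by blast
  obtain x' y'' where 2: "letter_act b g [x, y] = [x', y'']"
    using letter_act_pair' by blast
  have "map l (letter_act b g [x, y'] @ [z']) = map l (x' # letter_act b f [y'', z])"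
    using letter_act_shifts_commute[of b g x f y z] 1 2 by simp
  then show "perm b g [a1, perm b f [a2, a3] ! 0] @ [perm b f [a2, a3] ! 1] =
      perm b g [a1, a2] ! 0 # perm b f [perm b g [a1, a2] ! 1, a3]"
    by (simp add: a perm_pair 1 2)
qed

end

lemma group_Sym: "group (Sym Y)"
proof (rule groupI)
  fix p assume "p \<in> carrier (Sym Y)"
  then have "p permutes Y"
    by (simp add: Sym_def)
  then show "\<exists>q\<in>carrier (Sym Y). q \<otimes>\<^bsub>Sym Y\<^esub> p = \<one>\<^bsub>Sym Y\<^esub>"
    by (intro bexI[of _ "inv_into UNIV p"]) (simp_all add: Sym_def permutes_inv permutes_inv_o)
qed (auto simp: Sym_def permutes_compose permutes_id comp_assoc)

definition label :: "nat \<Rightarrow> nat \<Rightarrow> nat \<Rightarrow> nat \<Rightarrow> letter \<Rightarrow> nat" where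
  "label i j h k = (\<lambda>(b, x). if b then if x then k else h else if x then j else i)"

lemma label_simps [simp]:
  "label i j h k I = i" "label i j h k J = j" "label i j h k H = h" "label i j h k K = k"
  by (simp_all add: label_def)

text \<open>No order among the letters is imposed, so that a pair and its complement can be labelled
  in the same way with exchanged blocks.\<close>

locale letters_labelled =
  fixes i j h k :: nat
  assumes distinct: "distinct [i, j, h, k]" and all_letters: "{i, j, h, k} = {1..4}"
begin

sublocale labelling "label i j h k"
proof
  have "inj (label i j h k)"
    using distinct by (auto simp: inj_on_def label_def)
  moreover have "range (label i j h k) = {i, j, h, k}"
    by (auto simp: label_def intro: rev_image_eqI[of I] rev_image_eqI[of J] rev_image_eqI[of H] rev_image_eqI[of K])
  ultimately show "bij_betw (label i j h k) UNIV {1..4}"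
    by (simp add: bij_betw_def all_letters)
qed

text \<open>All single flags except \<open>e\<close>, listed in the order of the generators in
  \<open>M_perm\<close> and \<open>M'_perm\<close>.\<close>

definition gens :: "bool \<Rightarrow> (nat list \<Rightarrow> nat list) set" where
  "gens b = {perm b (False, True, False, False, False, False), perm b (False, False, True, False, False, False),
     perm b (False, False, False, True, False, False), perm b (False, False, False, False, True, False),
     perm b (False, False, False, False, False, True)}"

lemma generate_gens: "generate (Sym (words 4 2)) (gens b) = range (perm b)"
proof (intro equalityI subsetI)
  interpret Sym: group "Sym (words 4 2)"
    by (rule group_Sym)
  have "subgroup (range (perm b)) (Sym (words 4 2))"
  proof (rule Sym.subgroupI)
    fix u assume "u \<in> range (perm b)"
    then obtain f where u: "u = perm b f"
      by auto
    have "inv\<^bsub>Sym (words 4 2)\<^esub> u = perm b (flags_inv f)"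
      by (rule Sym.inv_equality) (simp_all add: u Sym_def perm_permutes perm_inv)
    then show "inv\<^bsub>Sym (words 4 2)\<^esub> u \<in> range (perm b)"
      by simp
  qed (auto simp: Sym_def perm_permutes perm_mult)
  moreover have "gens b \<subseteq> range (perm b)"
    by (auto simp: gens_def)
  ultimately show "u \<in> range (perm b)" if "u \<in> generate (Sym (words 4 2)) (gens b)" for u
    using Sym.generate_subgroup_incl that by blast
next
  let ?G = "generate (Sym (words 4 2)) (gens b)"
  have mult: "perm b (flags_mult f g) \<in> ?G" if "perm b f \<in> ?G" "perm b g \<in> ?G" for f g
    using generate.eng[OF that] by (simp add: Sym_def perm_mult)
  have one: "perm b (False, False, False, False, False, False) \<in> ?G"
    using generate.one[of "Sym (words 4 2)" "gens b"] perm_one[of b] by (simp add: Sym_def flags_one_def)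
  have gen: "perm b (False, True, False, False, False, False) \<in> ?G"
    "perm b (False, False, True, False, False, False) \<in> ?G"
    "perm b (False, False, False, True, False, False) \<in> ?G"
    "perm b (False, False, False, False, True, False) \<in> ?G"
    "perm b (False, False, False, False, False, True) \<in> ?G"
    by (rule generate.incl, simp add: gens_def)+
  \<comment> \<open>The missing flag \<open>e\<close> is the half turn, the square of the quarter
    turn.\<close>
  have "perm b (True, False, False, False, False, False) \<in> ?G"
    using mult[OF gen(1) gen(1)] by simp
  note single = this one gen
  fix u assume "u \<in> range (perm b)"
  then obtain e d s p q r where u: "u = perm b (e, d, s, p, q, r)"
    by auto
  have "perm b (e, False, False, False, False, False) \<in> ?G" "perm b (False, d, False, False, False, False) \<in> ?G"
    "perm b (False, False, s, False, False, False) \<in> ?G" "perm b (False, False, False, p, False, False) \<in> ?G"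
    "perm b (False, False, False, False, q, False) \<in> ?G" "perm b (False, False, False, False, False, r) \<in> ?G"
    by (cases e; cases d; cases s; cases p; cases q; cases r; simp add: single)+
  \<comment> \<open>In this order of the factors no carry arises.\<close>
  from mult[OF this(1) mult[OF this(2) mult[OF this(3) mult[OF this(4) mult[OF this(5,6)]]]]]
  show "u \<in> ?G"
    by (simp add: u)
qed

lemma cycle_eq_perm:
  assumes "\<forall>x\<in>letters. \<forall>y\<in>letters.
      u [label i j h k x, label i j h k y] = map (label i j h k) (letter_act b f [x, y])"
    "\<And>w. w \<notin> words 4 2 \<Longrightarrow> u w = w"
  shows "u = perm b f"
  unfolding perm_def by (rule lift_eqI) (use assms letters_UNIV in blast)+

lemma generators:
  "cycle_of_list [[i,h], [i,k], [j,h], [j,k]] = perm False (False, True, False, False, False, False)"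
  "cycle_of_list [[i,h], [j,k], [i,k], [j,h]] = perm True (False, True, False, False, False, False)"
  "cycle_of_list [[i,h], [j,h]] = perm False (False, False, True, False, False, False)"
  "cycle_of_list [[j,h], [j,k]] = perm True (False, False, True, False, False, False)"
  "cycle_of_list [[i,i], [j,i]] \<circ> cycle_of_list [[i,j], [j,j]] = perm b (False, False, False, True, False, False)"
  "cycle_of_list [[h,h], [h,k]] \<circ> cycle_of_list [[k,h], [k,k]] = perm b (False, False, False, False, True, False)"
  "cycle_of_list [[h,i], [h,j]] \<circ> cycle_of_list [[k,i], [k,j]] = perm False (False, False, False, False, False, True)"
  "cycle_of_list [[h,i], [k,i]] \<circ> cycle_of_list [[h,j], [k,j]] = perm True (False, False, False, False, False, True)"
proof -
  have out: "w \<noteq> [a, b]" if "w \<notin> words 4 2" "a \<in> {i, j, h, k}" "b \<in> {i, j, h, k}" for w a b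
    using that unfolding all_letters by auto
  note [simp] = transpose_def
  have d: "i \<noteq> j" "i \<noteq> h" "i \<noteq> k" "j \<noteq> h" "j \<noteq> k" "h \<noteq> k" "j \<noteq> i" "h \<noteq> i" "k \<noteq> i" "h \<noteq> j" "k \<noteq> j" "k \<noteq> h"
    using distinct by auto
  show "cycle_of_list [[i,h], [i,k], [j,h], [j,k]] = perm False (False, True, False, False, False, False)"
    "cycle_of_list [[i,h], [j,k], [i,k], [j,h]] = perm True (False, True, False, False, False, False)"
    "cycle_of_list [[i,h], [j,h]] = perm False (False, False, True, False, False, False)"
    "cycle_of_list [[j,h], [j,k]] = perm True (False, False, True, False, False, False)"
    "cycle_of_list [[i,i], [j,i]] \<circ> cycle_of_list [[i,j], [j,j]] = perm b (False, False, False, True, False, False)"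
    "cycle_of_list [[h,h], [h,k]] \<circ> cycle_of_list [[k,h], [k,k]] = perm b (False, False, False, False, True, False)"
    "cycle_of_list [[h,i], [h,j]] \<circ> cycle_of_list [[k,i], [k,j]] = perm False (False, False, False, False, False, True)"
    "cycle_of_list [[h,i], [k,i]] \<circ> cycle_of_list [[h,j], [k,j]] = perm True (False, False, False, False, False, True)"
    by (rule cycle_eq_perm; simp add: letters_def d out)+
qed

end

section \<open>The main theorem\<close>

text \<open>The first two flags are the binary digits of the rotation exponent.\<close>

fun flags_of :: "(int \<times> bool) \<times> int \<times> int \<times> int \<Rightarrow> flags" where
  "flags_of ((a, s), (p, q, r)) = (2 \<le> a, odd a, s, p = 1, q = 1, r = 1)"

abbreviation (input) D8xZ2_cubed :: "((int \<times> bool) \<times> int \<times> int \<times> int) monoid" where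
  "D8xZ2_cubed \<equiv> dihedral_group 4 \<times>\<times>
     (integer_mod_group 2 \<times>\<times> (integer_mod_group 2 \<times>\<times> integer_mod_group 2))"

lemma group_D8xZ2_cubed: "group D8xZ2_cubed"
  by (intro DirProd_group group_dihedral_group group_integer_mod_group) simp

lemma carrier_D8xZ2_cubed:
  "carrier D8xZ2_cubed = ({0, 1, 2, 3} \<times> UNIV) \<times> {0, 1} \<times> {0, 1} \<times> {0, 1}"
proof -
  have "{0..<int 4} = {0, 1, 2, 3}" "{0..<int 2} = {0, 1}"
    by auto
  then show ?thesis
    by (simp add: dihedral_group_def integer_mod_group_def)
qed

lemma flags_of_mult:
  assumes "x \<in> carrier D8xZ2_cubed" "y \<in> carrier D8xZ2_cubed"
  shows "flags_of (x \<otimes>\<^bsub>D8xZ2_cubed\<^esub> y) = flags_mult (flags_of x) (flags_of y)"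
proof -
  obtain a s p q r where x: "x = ((a, s), (p, q, r))" "a \<in> {0, 1, 2, 3}" "p \<in> {0, 1}" "q \<in> {0, 1}" "r \<in> {0, 1}"
    using assms(1) unfolding carrier_D8xZ2_cubed by auto
  obtain a' s' p' q' r' where y: "y = ((a', s'), (p', q', r'))" "a' \<in> {0, 1, 2, 3}" "p' \<in> {0, 1}" "q' \<in> {0, 1}" "r' \<in> {0, 1}"
    using assms(2) unfolding carrier_D8xZ2_cubed by auto
  have bit: "(t + t') mod 2 = 1 \<longleftrightarrow> (t = 1) \<noteq> (t' = 1)" if "t \<in> {0, 1}" "t' \<in> {0, 1}" for t t' :: int
    using that by auto
  have rot: "(2 \<le> (a + (if s then - a' else a')) mod 4) = ((2 \<le> a) \<noteq> ((2 \<le> a') \<noteq> ((s \<noteq> odd a) \<and> odd a')))"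
    "odd ((a + (if s then - a' else a')) mod 4) = (odd a \<noteq> odd a')"
    using x(2) y(2) by (cases s; auto)+
  show ?thesis
    using x y bit rot by (simp add: dihedral_group_def integer_mod_group_def)
qed

lemma bij_flags_of: "bij_betw flags_of (carrier D8xZ2_cubed) UNIV"
proof (rule bij_betw_imageI)
  show "inj_on flags_of (carrier D8xZ2_cubed)"
    unfolding carrier_D8xZ2_cubed by (auto simp: inj_on_def)
  have "f \<in> flags_of ` carrier D8xZ2_cubed" for f
  proof -
    obtain e d s p q r where f: "f = (e, d, s, p, q, r)"
      using prod_cases6 by metis
    show ?thesis
      unfolding carrier_D8xZ2_cubed
      by (rule image_eqI[of _ _ "(((if e then 2 else 0) + of_bool d, s), (of_bool p, of_bool q, of_bool r))"])
         (auto simp: f)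
  qed
  then show "flags_of ` carrier D8xZ2_cubed = UNIV"
    by blast
qed

section \<open>The groups inside the automorphism group\<close>

locale cuntz_4 = universal_cuntz A 4 S for A :: "'a cstar" (structure) and S :: "nat \<Rightarrow> 'a"
begin

definition psi :: "(letter \<Rightarrow> nat) \<Rightarrow> bool \<Rightarrow> flags \<Rightarrow> 'a \<Rightarrow> 'a" where
  "psi l b f = perm_endo 4 2 A S (labelling.perm l b f)"

text \<open>One element \<open>f\<close> whose outer class is missed by the other group is enough;
  the test words may vary with the competitor \<open>g\<close>.\<close>

lemma out_proj_image_neq:
  assumes l: "labelling l" and l': "labelling l'"
    and Aut: "\<And>g. psi l' b' g \<in> carrier (Aut A)" "psi l b f \<in> carrier (Aut A)"
    and sep: "\<And>g. \<exists>\<alpha> \<beta>. \<beta> \<noteq> [] \<and> length \<alpha> = length \<beta> \<and> set \<alpha> \<subseteq> {1..4} \<and> set \<beta> \<subseteq> {1..4} \<and>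
      repels {1..4} (labelling.perm l' b' g) \<alpha> \<beta> \<and> attracts {1..4} (labelling.perm l b f) \<alpha> \<beta>"
  shows "out_proj A ` range (psi l' b') \<noteq> out_proj A ` range (psi l b)"
proof
  assume "out_proj A ` range (psi l' b') = out_proj A ` range (psi l b)"
  then obtain g where g: "out_proj A (psi l' b' g) = out_proj A (psi l b f)"
    by (metis (no_types, lifting) image_iff rangeI)
  obtain \<alpha> \<beta> where "\<beta> \<noteq> []" "length \<alpha> = length \<beta>" "set \<alpha> \<subseteq> {1..4}" "set \<beta> \<subseteq> {1..4}"
    "repels {1..4} (labelling.perm l' b' g) \<alpha> \<beta>" "attracts {1..4} (labelling.perm l b f) \<alpha> \<beta>"
    using sep by blast
  then show False
    using out_proj_perm_endo_neqI[OF labelling.perm_permutes[OF l'] _ labelling.perm_permutes[OF l]] g Aut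
    unfolding psi_def by blast
qed

context
  fixes l
  assumes l: "labelling l"
begin

interpretation labelling l
  by (rule l)

lemma psi_in_Aut: "psi l b f \<in> carrier (Aut A)"
  unfolding psi_def
  by (rule perm_endo_in_Aut[OF perm_permutes perm_permutes perm_inv perm_shifts_commute perm_shifts_commute])

lemma psi_mult: "psi l b f \<otimes>\<^bsub>Aut A\<^esub> psi l b g = psi l b (flags_mult f g)"
proof -
  have "psi l b f \<in> Bij (carrier A)" "psi l b g \<in> Bij (carrier A)"
    using psi_in_Aut by (simp_all add: carrier_Aut)
  then show ?thesis
    using perm_endo_comp[OF perm_permutes perm_permutes perm_shifts_commute]
    by (simp add: mult_Aut psi_def perm_mult)
qed

lemma psi_one: "psi l b flags_one = \<one>\<^bsub>Aut A\<^esub>"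
  by (simp add: psi_def perm_one perm_endo_id)

lemma label_set: "set (map l w) \<subseteq> {1..4}"
  using label_range by auto

lemma psi_outer:
  assumes "f \<noteq> flags_one"
  shows "out_proj A (psi l b f) \<noteq> out_proj A \<one>\<^bsub>Aut A\<^esub>"
proof -
  obtain \<beta> where \<beta>: "\<beta> \<in> {[I], [H], [I, I, H], [I, K, H], [J, H, H]}" "repels letters (letter_act b f) \<beta> \<beta>"
    using repels_if_not_one[OF assms] by blast
  have id: "letter_act b flags_one = (\<lambda>w. w)"
    by (simp add: fun_eq_iff letter_act_one)
  \<comment> \<open>The identity emits \<beta> followed by the current letter; for the first letter
    of \<beta> this is that letter followed by a rotation of \<beta>.\<close>
  have "attracts letters (letter_act b flags_one) \<beta> \<beta>"
    using \<beta>(1) unfolding id insert_iff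
    by (elim disjE emptyE; hypsubst; unfold repels_unfold letters_def; simp)
  note sep = repels_perm[OF \<beta>(2)] attracts_perm[OF this]
  have "map l \<beta> \<noteq> []"
    using \<beta>(1) by auto
  then show ?thesis
    using out_proj_perm_endo_neqI[OF perm_permutes psi_in_Aut[unfolded psi_def] perm_permutes
        psi_in_Aut[unfolded psi_def] label_set _ label_set _ sep]
    by (simp add: psi_def[symmetric] psi_one)
qed

text \<open>Injectivity is inherited from \<open>psi_outer\<close>: two elements with the same image
  have a quotient that is sent to the identity, which is inner.\<close>

lemma psi_iso:
  "(\<lambda>x. psi l b (flags_of x)) \<in> iso D8xZ2_cubed ((Aut A)\<lparr>carrier := range (psi l b)\<rparr>)"
proof (rule isoI)
  show "(\<lambda>x. psi l b (flags_of x)) \<in> hom D8xZ2_cubed ((Aut A)\<lparr>carrier := range (psi l b)\<rparr>)"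
    by (rule homI) (simp_all only: flags_of_mult psi_mult[symmetric] partial_object.simps monoid.simps, auto)
  have "inj (psi l b)"
  proof (rule injI)
    fix f g assume eq: "psi l b f = psi l b g"
    have "psi l b (flags_mult (flags_inv g) f) = psi l b (flags_mult (flags_inv g) g)"
      by (simp add: psi_mult[symmetric] eq)
    then have "flags_mult (flags_inv g) f = flags_one"
      using psi_outer psi_one flags_mult_inv by metis
    then show "f = g"
      by (cases f; cases g) (auto simp: flags_one_def split: if_splits)
  qed
  then have "bij_betw (psi l b) UNIV (range (psi l b))"
    by (rule inj_on_imp_bij_betw)
  from bij_betw_trans[OF bij_flags_of this]
  show "bij_betw (\<lambda>x. psi l b (flags_of x)) (carrier D8xZ2_cubed) (carrier ((Aut A)\<lparr>carrier := range (psi l b)\<rparr>))"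
    by (simp add: comp_def)
qed

lemma subgroup_psi: "subgroup (range (psi l b)) (Aut A)"
proof -
  interpret Aut: group "Aut A"
    by (rule group_Aut)
  show ?thesis
  proof (rule Aut.subgroupI)
    fix x assume "x \<in> range (psi l b)"
    then obtain f where x: "x = psi l b f"
      by auto
    have "inv\<^bsub>Aut A\<^esub> x = psi l b (flags_inv f)"
      by (rule Aut.inv_equality) (simp_all add: x psi_mult flags_mult_inv psi_one psi_in_Aut)
    then show "inv\<^bsub>Aut A\<^esub> x \<in> range (psi l b)"
      by simp
  qed (auto simp: psi_in_Aut psi_mult)
qed

lemma generate_psi: "generate (Aut A) (range (psi l b)) = range (psi l b)"
proof -
  interpret Aut: group "Aut A"
    by (rule group_Aut)
  show ?thesis
    using Aut.generate_subgroup_incl[OF _ subgroup_psi] generate.incl[of _ "range (psi l b)"] by blast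
qed

lemma psi_in_lambda_inv: "psi l b f \<in> lambda_inv 4 2 A S"
  using psi_in_Aut perm_permutes
  by (auto simp: lambda_inv_def psi_def perm_endo_def perm_unitaries_def)

lemma group_psi_iso: "(Aut A)\<lparr>carrier := range (psi l b)\<rparr> \<cong> D8xZ2_cubed"
  using group.iso_sym[OF group_D8xZ2_cubed] psi_iso unfolding is_iso_def by blast

lemma kernel_out_proj:
  "kernel ((Aut A)\<lparr>carrier := range (psi l b)\<rparr>) (Out A) (out_proj A) = {\<one>\<^bsub>Aut A\<^esub>}"
proof -
  have one: "\<one>\<^bsub>Out A\<^esub> = out_proj A \<one>\<^bsub>Aut A\<^esub>"
    by (simp add: Out_def FactGroup_def out_proj_one)
  have "x = \<one>\<^bsub>Aut A\<^esub>" if x: "x \<in> range (psi l b)" "out_proj A x = out_proj A \<one>\<^bsub>Aut A\<^esub>" for x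
  proof -
    obtain f where "x = psi l b f"
      using x(1) by blast
    then show ?thesis
      using x(2) psi_outer[of f b] psi_one[of b] by (cases "f = flags_one") auto
  qed
  moreover have "\<one>\<^bsub>Aut A\<^esub> \<in> range (psi l b)"
    using rangeI[of "psi l b" flags_one] by (simp only: psi_one)
  ultimately show ?thesis
    unfolding kernel_def one by auto
qed

end

end

section \<open>The labelling attached to a pair of letters\<close>

definition cuntz_label :: "nat \<Rightarrow> nat \<Rightarrow> letter \<Rightarrow> nat" where
  "cuntz_label i j = label i j (Min ({1..4} - {i, j})) (Max ({1..4} - {i, j}))"

lemma complementary_letters:
  assumes "i \<in> {1..4::nat}" "j \<in> {1..4}" "i < j"
  obtains h k where "h < k" "letters_labelled i j h k" "{1..4} - {i, j} = {h, k}"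
proof -
  have four: "{1..4::nat} = {1, 2, 3, 4}"
    by auto
  then consider "i = 1 \<and> j = 2" | "i = 1 \<and> j = 3" | "i = 1 \<and> j = 4" | "i = 2 \<and> j = 3" | "i = 2 \<and> j = 4" | "i = 3 \<and> j = 4"
    using assms by fastforce
  then show thesis
  proof cases
    case 1
    then show ?thesis by (intro that[of 3 4]) (auto simp: letters_labelled_def four)
  next
    case 2
    then show ?thesis by (intro that[of 2 4]) (auto simp: letters_labelled_def four)
  next
    case 3
    then show ?thesis by (intro that[of 2 3]) (auto simp: letters_labelled_def four)
  next
    case 4
    then show ?thesis by (intro that[of 1 4]) (auto simp: letters_labelled_def four)
  next
    case 5
    then show ?thesis by (intro that[of 1 3]) (auto simp: letters_labelled_def four)
  next
    case 6
    then show ?thesis by (intro that[of 1 2]) (auto simp: letters_labelled_def four)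
  qed
qed

lemma cuntz_label_eq: "{1..4} - {i, j} = {h, k} \<Longrightarrow> h < k \<Longrightarrow> cuntz_label i j = label i j h k"
  by (simp add: cuntz_label_def)

lemma labelling_cuntz_label:
  assumes "i \<in> {1..4}" "j \<in> {1..4}" "i < j"
  shows "labelling (cuntz_label i j)"
proof -
  obtain h k where hk: "h < k" "letters_labelled i j h k" "{1..4} - {i, j} = {h, k}"
    using complementary_letters[OF assms] .
  interpret letters_labelled i j h k
    by (rule hk(2))
  show ?thesis
    unfolding cuntz_label_eq[OF hk(3,1)] by (rule labelling_axioms)
qed

lemma M_perm_eq:
  assumes "i \<in> {1..4}" "j \<in> {1..4}" "i < j"
  shows "M_perm i j = range (labelling.perm (cuntz_label i j) False)"
    "M'_perm i j = range (labelling.perm (cuntz_label i j) True)"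
proof -
  obtain h k where hk: "h < k" "letters_labelled i j h k" "{1..4} - {i, j} = {h, k}"
    using complementary_letters[OF assms] .
  interpret letters_labelled i j h k
    by (rule hk(2))
  have ends: "Min {h, k} = h" "Max {h, k} = k"
    using hk(1) by auto
  have "M_perm i j = generate (Sym (words 4 2)) (gens False)"
    unfolding M_perm_def gens_def hk(3) Let_def ends generators(1,3,7) generators(5,6)[where b = False]
    by (rule refl)
  moreover have "M'_perm i j = generate (Sym (words 4 2)) (gens True)"
    unfolding M'_perm_def gens_def hk(3) Let_def ends generators(2,4,8) generators(5,6)[where b = True]
    by (rule refl)
  ultimately show "M_perm i j = range (labelling.perm (cuntz_label i j) False)"
    "M'_perm i j = range (labelling.perm (cuntz_label i j) True)"
    by (simp_all only: generate_gens cuntz_label_eq[OF hk(3,1)])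
qed

context cuntz_4
begin

lemma M_grp_eq:
  assumes "i \<in> {1..4}" "j \<in> {1..4}" "i < j"
  shows "(if b then M'_grp A S i j else M_grp A S i j) = range (psi (cuntz_label i j) b)"
proof -
  have "perm_endo 4 2 A S ` range (labelling.perm l b) = range (psi l b)" for l b
    by (auto simp: psi_def)
  then show ?thesis
    using generate_psi[OF labelling_cuntz_label[OF assms]] M_perm_eq[OF assms]
    by (simp add: M_grp_def M'_grp_def)
qed

section \<open>Distinctness of the twelve images\<close>

lemma out_proj_psi_neq_same_label:
  assumes l: "labelling l" and "b \<noteq> b'"
  shows "out_proj A ` range (psi l b') \<noteq> out_proj A ` range (psi l b)"
proof (rule out_proj_image_neq[OF l l psi_in_Aut[OF l] psi_in_Aut[OF l], where f = "special_flags b"])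
  interpret labelling l
    by (rule l)
  fix g
  obtain \<alpha> \<beta> where ab: "(\<alpha>, \<beta>) \<in> special_tests b" "repels letters (letter_act b' g) \<alpha> \<beta>"
    using repels_special[of b b' False g] assms(2) by auto
  note repels_perm[OF ab(2)] attracts_perm[OF attracts_special[OF ab(1)]]
  moreover have "\<beta> \<noteq> []" "length \<alpha> = length \<beta>"
    using ab(1) by (auto simp: special_tests_def split: if_splits)
  ultimately show "\<exists>\<alpha> \<beta>. \<beta> \<noteq> [] \<and> length \<alpha> = length \<beta> \<and> set \<alpha> \<subseteq> {1..4} \<and> set \<beta> \<subseteq> {1..4} \<and>
      repels {1..4} (perm b' g) \<alpha> \<beta> \<and> attracts {1..4} (perm b (special_flags b)) \<alpha> \<beta>"
    using label_set[OF l] by (intro exI[of _ "map l \<alpha>"] exI[of _ "map l \<beta>"]) simp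
qed

lemma out_proj_psi_neq_swapped_label:
  assumes "letters_labelled i j h k" "letters_labelled h k i j"
  shows "out_proj A ` range (psi (label h k i j) b') \<noteq> out_proj A ` range (psi (label i j h k) b)"
proof -
  interpret letters_labelled i j h k
    by (rule assms(1))
  interpret L': letters_labelled h k i j
    by (rule assms(2))
  let ?l = "label i j h k"
  have label': "label h k i j x = ?l (map_prod Not id x)" for x
    by (cases x) (simp add: label_def)
  have pair: "\<exists>x' y'. swap_blocks (letter_act b' g) [x, y] = [x', y']" for x y g
    using letter_act_pair'[of b' g "map_prod Not id x" "map_prod Not id y"] by (auto simp: swap_blocks_def)
  have invol: "map_prod Not id (map_prod Not id x) = x" for x :: letter
    by (cases x) simp
  \<comment> \<open>Both groups are expressed through the first labelling, so that the tests of
    \<open>repels_special\<close> apply to them in one alphabet.\<close>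
  have perm': "L'.perm b' g = lift ?l (swap_blocks (letter_act b' g))" for g
  proof (rule lift_eqI)
    fix x y
    have "?l x = label h k i j (map_prod Not id x)" for x
      by (simp add: label' invol)
    then show "L'.perm b' g [?l x, ?l y] = map ?l (swap_blocks (letter_act b' g) [x, y])"
      using L'.perm_pair[of b' g "map_prod Not id x" "map_prod Not id y"]
      by (simp add: swap_blocks_def label' comp_def)
  qed (rule L'.perm_outside)
  show ?thesis
  proof (rule out_proj_image_neq[OF labelling_axioms L'.labelling_axioms psi_in_Aut[OF L'.labelling_axioms]
        psi_in_Aut[OF labelling_axioms], where f = "special_flags b"])
    fix g
    obtain \<alpha> \<beta> where ab: "(\<alpha>, \<beta>) \<in> special_tests b" "repels letters (swap_blocks (letter_act b' g)) \<alpha> \<beta>"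
      using repels_special[of b b' True g] by auto
    have "repels {1..4} (L'.perm b' g) (map ?l \<alpha>) (map ?l \<beta>)"
      unfolding perm' by (rule repels_lift[where g = "swap_blocks (letter_act b' g)", OF pair ab(2)])
    moreover have "attracts {1..4} (perm b (special_flags b)) (map ?l \<alpha>) (map ?l \<beta>)"
      by (rule attracts_perm[OF attracts_special[OF ab(1)]])
    moreover have "\<beta> \<noteq> []" "length \<alpha> = length \<beta>"
      using ab(1) by (auto simp: special_tests_def split: if_splits)
    ultimately show "\<exists>\<alpha> \<beta>. \<beta> \<noteq> [] \<and> length \<alpha> = length \<beta> \<and> set \<alpha> \<subseteq> {1..4} \<and> set \<beta> \<subseteq> {1..4} \<and>
        repels {1..4} (L'.perm b' g) \<alpha> \<beta> \<and> attracts {1..4} (perm b (special_flags b)) \<alpha> \<beta>"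
      using label_set[OF labelling_axioms] by (intro exI[of _ "map ?l \<alpha>"] exI[of _ "map ?l \<beta>"]) simp
  qed
qed

text \<open>The generator x_0 sends [i, j] to [j, j], so under its twist the word i has a fixed
  point in the system with loop j. In a group that puts i and j into different blocks no element
  does this.\<close>

lemma out_proj_psi_neq_if_blocks_differ:
  assumes l: "labelling l" and l': "labelling l'"
    and xy: "l' x = l I" "l' y = l J" "fst x \<noteq> fst y"
  shows "out_proj A ` range (psi l' b') \<noteq> out_proj A ` range (psi l b)"
proof (rule out_proj_image_neq[OF l l' psi_in_Aut[OF l'] psi_in_Aut[OF l],
      where f = "(False, False, False, True, False, False)"])
  fix g
  let ?f = "(False, False, False, True, False, False)"
  have "attracts letters (letter_act b ?f) [I] [J]"
    unfolding repels_unfold letters_def by simp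
  from labelling.attracts_perm[OF l this]
  have "attracts {1..4} (labelling.perm l b ?f) [l I] [l J]"
    by simp
  moreover from labelling.repels_perm[OF l' repels_if_blocks_differ[OF xy(3)]]
  have "repels {1..4} (labelling.perm l' b' g) [l I] [l J]"
    by (simp add: xy(1,2))
  ultimately show "\<exists>\<alpha> \<beta>. \<beta> \<noteq> [] \<and> length \<alpha> = length \<beta> \<and> set \<alpha> \<subseteq> {1..4} \<and> set \<beta> \<subseteq> {1..4} \<and>
      repels {1..4} (labelling.perm l' b' g) \<alpha> \<beta> \<and> attracts {1..4} (labelling.perm l b ?f) \<alpha> \<beta>"
    using label_set[OF l, of "[I, J]"] by (intro exI[of _ "[l I]"] exI[of _ "[l J]"]) simp
qed

lemma out_proj_psi_inj:
  assumes ij: "i \<in> {1..4}" "j \<in> {1..4}" "i < j" and ij': "i' \<in> {1..4}" "j' \<in> {1..4}" "i' < j'"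
    and eq: "out_proj A ` range (psi (cuntz_label i' j') b') = out_proj A ` range (psi (cuntz_label i j) b)"
  shows "i = i' \<and> j = j' \<and> b = b'"
proof -
  obtain h k where hk: "h < k" "letters_labelled i j h k" "{1..4} - {i, j} = {h, k}"
    using complementary_letters[OF ij] .
  obtain h' k' where hk': "h' < k'" "letters_labelled i' j' h' k'" "{1..4} - {i', j'} = {h', k'}"
    using complementary_letters[OF ij'] .
  interpret letters_labelled i j h k
    by (rule hk(2))
  interpret L': letters_labelled i' j' h' k'
    by (rule hk'(2))
  have lab: "cuntz_label i j = label i j h k" "cuntz_label i' j' = label i' j' h' k'"
    using cuntz_label_eq hk hk' by simp_all
  obtain x y where xy: "label i' j' h' k' x = i" "label i' j' h' k' y = j"
    using L'.label_cases ij by metis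
  have "fst x = fst y"
    using out_proj_psi_neq_if_blocks_differ[OF labelling_axioms L'.labelling_axioms, of x y b' b] xy eq
    unfolding lab by auto
  \<comment> \<open>Lying in a common block and being ordered, \<open>i\<close> and \<open>j\<close>
    are the smaller and the larger letter of the first or of the second block of the other
    labelling.\<close>
  then have "(i = i' \<and> j = j') \<or> (i = h' \<and> j = k')"
    using xy ij(3) ij'(3) hk'(1) by (cases x; cases y) (auto simp: label_def split: if_splits)
  \<comment> \<open>Here the second pair is the complement of the first, and the two labellings
    differ by the exchange of the blocks.\<close>
  moreover have False if "i = h' \<and> j = k'"
  proof -
    have "{1..4} - {i', j'} = {i, j}"
      using that hk'(3) by simp
    moreover have "{i', j'} \<subseteq> {1..4}"
      using ij'(1,2) by blast
    ultimately have "{1..4} - {i, j} = {i', j'}"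
      by blast
    then have "{h, k} = {i', j'}"
      using hk(3) by simp
    then have "h = i'" "k = j'"
      using hk(1) ij'(3) by (auto simp: doubleton_eq_iff)
    then show False
      using out_proj_psi_neq_swapped_label[of i j h k b' b] hk(2) hk'(2) eq that unfolding lab by simp
  qed
  moreover have "b = b'" if "i = i' \<and> j = j'"
    using out_proj_psi_neq_same_label[OF labelling_cuntz_label[OF ij], of b b'] eq that by auto
  ultimately show ?thesis
    by blast
qed

end

theorem theorem5p4:
  fixes A :: "'a cstar" and S :: "nat \<Rightarrow> 'a"
  assumes "cuntz_algebra 4 A S"
  shows "(\<forall>i\<in>{1..4}. \<forall>j\<in>{1..4}. i < j \<longrightarrow>
            (\<forall>M\<in>{M_grp A S i j, M'_grp A S i j}.
               subgroup M (Aut A) \<and>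
               M \<subseteq> lambda_inv 4 2 A S \<and>
               (Aut A)\<lparr>carrier := M\<rparr> \<cong>
                 dihedral_group 4 \<times>\<times>
                   (integer_mod_group 2 \<times>\<times> (integer_mod_group 2 \<times>\<times> integer_mod_group 2)) \<and>
               kernel ((Aut A)\<lparr>carrier := M\<rparr>) (Out A) (out_proj A) = {\<one>\<^bsub>Aut A\<^esub>})) \<and>
         inj_on (\<lambda>(i, j, primed). out_proj A ` (if primed then M'_grp A S i j else M_grp A S i j))
           {(i, j, primed). i \<in> {1..4} \<and> j \<in> {1..4} \<and> i < j}"
proof -
  interpret cuntz_4 A S
    using universal_cuntzI[OF assms] by (simp add: cuntz_4_def)
  show ?thesis
  proof (intro conjI ballI impI)
    fix i j M assume ij: "i \<in> {1..4}" "j \<in> {1..4}" "i < j" and "M \<in> {M_grp A S i j, M'_grp A S i j}"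
    then obtain b where M: "M = range (psi (cuntz_label i j) b)"
      using M_grp_eq[OF ij, of True] M_grp_eq[OF ij, of False] by auto
    note l = labelling_cuntz_label[OF ij]
    show "subgroup M (Aut A)" "M \<subseteq> lambda_inv 4 2 A S" "(Aut A)\<lparr>carrier := M\<rparr> \<cong> D8xZ2_cubed"
      "kernel ((Aut A)\<lparr>carrier := M\<rparr>) (Out A) (out_proj A) = {\<one>\<^bsub>Aut A\<^esub>}"
      unfolding M using subgroup_psi[OF l] psi_in_lambda_inv[OF l] group_psi_iso[OF l] kernel_out_proj[OF l]
      by auto
  next
    show "inj_on (\<lambda>(i, j, primed). out_proj A ` (if primed then M'_grp A S i j else M_grp A S i j))
        {(i, j, primed). i \<in> {1..4} \<and> j \<in> {1..4} \<and> i < j}"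
    proof (rule inj_onI)
      fix x y
      assume "x \<in> {(i, j, primed :: bool). i \<in> {1..4} \<and> j \<in> {1..4} \<and> i < j}"
        and "y \<in> {(i, j, primed :: bool). i \<in> {1..4} \<and> j \<in> {1..4} \<and> i < j}"
        and eq: "(\<lambda>(i, j, primed). out_proj A ` (if primed then M'_grp A S i j else M_grp A S i j)) x =
          (\<lambda>(i, j, primed). out_proj A ` (if primed then M'_grp A S i j else M_grp A S i j)) y"
      then obtain i j b i' j' b' where x: "x = (i, j, b)" "y = (i', j', b')"
        and ij: "i \<in> {1..4}" "j \<in> {1..4}" "i < j" and ij': "i' \<in> {1..4}" "j' \<in> {1..4}" "i' < j'"
        by blast
      have "out_proj A ` range (psi (cuntz_label i' j') b') = out_proj A ` range (psi (cuntz_label i j) b)"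
        using eq unfolding x prod.case M_grp_eq[OF ij] M_grp_eq[OF ij'] by (rule sym)
      from out_proj_psi_inj[OF ij ij' this] show "x = y"
        by (simp add: x)
    qed
  qed
qed

end
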